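(* Assume $\mathbb E[|Y|^2]+\mathbb E[|X|^8]<\infty$ and that the kernel function is rotationally invariant, $K(x)=\mathcal K(|x|_V^2)$, where $\mathcal K',\mathcal K'':\mathbb R_{\ge0}\to\mathbb R$ are bounded continuous functions and $r\mathcal K'(r)$ is bounded for large $r$. Then: 1. The Riemannian gradient flow $$\frac{d\Sigma_{ab}}{dt}=-\frac12\left(\Sigma_{ac}C_{bd}(D\mathcal J(\Sigma;\lambda))^{cd}+\Sigma_{bd}C_{ac}(D\mathcal J(\Sigma;\lambda))^{cd}\right)$$ on $\mathrm{Sym}^2_+$ extends to a flow on $\mathrm{Sym}^2_{\ge0}$, depending continuously on the initial data, and exists for all time $t\ge0$. 2. If the initial data is contained in a stratum $\mathcal S_l$ for some $0\le l\le d-1$, then the flow stays inside $\mathcal S_l$.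
   Context: $V$ is a real $d$-dimensional vector space with dual $V^*$, and $\lambda>0$ is fixed. $X$ is a $V$-valued random variable and $Y$ a complex-valued random variable. The covariance $\mathrm{Cov}(X)(\omega,\omega)=\mathbb E[\langle\omega,X-\mathbb E[X]\rangle^2]$ is an inner product on $V^*$, with matrix $C^{ij}$; the inverse matrix $C_{ij}$ defines the inner product $|\cdot|_V^2=(\cdot,\cdot)_V$ on $V$. Adjoints $U^T$ are taken with respect to $(\cdot,\cdot)_V$. Summation over repeated indices is understood. Kernel: $k_V:V^*\to(0,\infty)$ is rotationally invariant, i.e. a function of the dual norm $|\omega|_V^2$, with $\int_{V^*}k_V\,d\omega=1$, and $K(x)=\int_{V^*}e^{2\pi i\langle x,\omega\rangle}k_V(\omega)d\omega$. $\mathcal H$ is the Hilbert space of functions $f(x)=\int_{V^*}\hat f(\omega)e^{2\pi i\langle\omega,x\rangle}d\omega$ on $V$ with $\|f\|_{\mathcal H}^2=\int_{V^*}|\hat f|^2/k_V\,d\omega<\infty$. For $U\in\mathrm{End}(V)$: $J(U,\lambda)=\inf_{f\in\mathcal H}\{\frac12\mathbb E[|Y-f(UX)|^2]+\frac\lambda2\|f\|_{\mathcal H}^2\}$. $\mathrm{Sym}^2_+\subset \mathrm{Sym}^2V^*$ is the open set of positive definite inner products on $V$; $\mathcal S_l$ ($0\le l\le d-1$) is the manifold of positive semi-definite forms on $V$ of rank $l$; $\mathrm{Sym}^2_{\ge0}=\mathrm{Sym}^2_+\cup\bigcup_{l\le d-1}\mathcal S_l$. For $\Sigma\in\mathrm{Sym}^2_{\ge0}$,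 $\mathcal J(\Sigma;\lambda):=J(U,\lambda)$ for any $U$ with $|x|_\Sigma^2=|Ux|_V^2$, i.e. $\Sigma=U^TU$ (by rotational invariance this depends only on $\Sigma$). Known background (under the hypotheses of the claim): $\mathcal J$ is $C^1$ on $\mathrm{Sym}^2_{\ge0}$, meaning there is a continuous $D\mathcal J:\mathrm{Sym}^2_{\ge0}\to\mathrm{Sym}^2V$ with $\mathcal J(\Sigma';\lambda)=\mathcal J(\Sigma;\lambda)+\langle D\mathcal J(\Sigma;\lambda),\Sigma'-\Sigma\rangle+o(|\Sigma'-\Sigma|)$ for $\Sigma,\Sigma'\in\mathrm{Sym}^2_{\ge0}$; moreover $D\mathcal J$ extends to a Lipschitz function on $\mathrm{Sym}^2V^*$. With $(X',Y')$ an independent copy of $(X,Y)$, $f_U$ the minimizer in $J(U,\lambda)$ and $r_\Sigma(X,Y)=Y-f_U(UX)$, one has $D\mathcal J(\Sigma;\lambda)=-\frac1{2\lambda}\mathbb E[r_\Sigma(X,Y)\overline{r_\Sigma(X',Y')}\,\mathcal K'(|X-X'|_\Sigma^2)(X-X')\otimes(X-X')]$ for $\Sigma\in \mathrm{Sym}^2_+$. On $\mathrm{Sym}^2_+$ the Riemannian gradient flow is the downward gradient flow of $\mathcal J$ for the Riemannian metric given on cotangent vectors $A,A'\in T^*_\Sigma\mathrm{Sym}^2_+\simeq\mathrm{Sym}^2V$ by $\mathfrak g(A,A')=\frac12\Sigma_{ab}C_{cd}A^{ac}A'^{bd}+\frac12\Sigma_{ab}C_{cd}A^{bd}A'^{ac}$;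 in indices it is the displayed ODE. The extended flow on $\mathrm{Sym}^2_{\ge0}$ is the one given by the same ODE. *)

theory Defs
  imports "HOL-Probability.Probability"
begin

text \<open>
  A basis of the \<open>d\<close>-dimensional space \<open>V\<close> is fixed, so that \<open>V = \<real>\<^sup>d\<close> with \<open>d = CARD('n)\<close>;
  \<open>V\<^sup>*\<close> carries the dual basis, and the pairing of \<open>V\<^sup>*\<close> with \<open>V\<close> is \<open>(\<bullet>)\<close>. Forms on \<open>V\<close> and on
  \<open>V\<^sup>*\<close> are identified with their matrices of components.
\<close>

definition cov_form :: "'w measure \<Rightarrow> ('w \<Rightarrow> real ^ 'n) \<Rightarrow> real ^ 'n \<Rightarrow> real ^ 'n \<Rightarrow> real" where
  "cov_form M X \<omega> \<eta> =
     (\<integral>w. (\<omega> \<bullet> (X w - integral\<^sup>L M X)) * (\<eta> \<bullet> (X w - integral\<^sup>L M X)) \<partial>M)"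

definition cov_upper :: "'w measure \<Rightarrow> ('w \<Rightarrow> real ^ 'n) \<Rightarrow> real ^ 'n ^ 'n" where
  "cov_upper M X = (\<chi> i j. cov_form M X (axis i 1) (axis j 1))"

definition cov_lower :: "'w measure \<Rightarrow> ('w \<Rightarrow> real ^ 'n) \<Rightarrow> real ^ 'n ^ 'n" where
  "cov_lower M X = matrix_inv (cov_upper M X)"

definition V_norm_sq :: "'w measure \<Rightarrow> ('w \<Rightarrow> real ^ 'n) \<Rightarrow> real ^ 'n \<Rightarrow> real" where
  "V_norm_sq M X x = x \<bullet> (cov_lower M X *v x)"

definition kernel_fun :: "(real ^ 'n \<Rightarrow> real) \<Rightarrow> real ^ 'n \<Rightarrow> complex" where
  "kernel_fun k x = (\<integral>\<omega>. cis (2 * pi * (x \<bullet> \<omega>)) * complex_of_real (k \<omega>) \<partial>lborel)"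

text \<open>
  \<open>in_H k f f_hat\<close>: the function \<open>f\<close> belongs to \<open>\<H>\<close>, with Fourier transform \<open>f_hat\<close>. The
  finiteness of the norm makes \<open>f_hat\<close> integrable (Cauchy--Schwarz), so \<open>f\<close> determines \<open>f_hat\<close>
  almost everywhere, and \<open>H_norm_sq k f_hat\<close> is the squared norm of \<open>f\<close>.
\<close>

definition in_H :: "(real ^ 'n \<Rightarrow> real) \<Rightarrow> (real ^ 'n \<Rightarrow> complex) \<Rightarrow> (real ^ 'n \<Rightarrow> complex) \<Rightarrow> bool" where
  "in_H k f f_hat \<longleftrightarrow>
     f_hat \<in> borel_measurable borel \<and>
     integrable lborel (\<lambda>\<omega>. (cmod (f_hat \<omega>))\<^sup>2 / k \<omega>) \<and>
     (\<forall>x. f x = (\<integral>\<omega>. f_hat \<omega> * cis (2 * pi * (\<omega> \<bullet> x)) \<partial>lborel))"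

definition H_norm_sq :: "(real ^ 'n \<Rightarrow> real) \<Rightarrow> (real ^ 'n \<Rightarrow> complex) \<Rightarrow> real" where
  "H_norm_sq k f_hat = (\<integral>\<omega>. (cmod (f_hat \<omega>))\<^sup>2 / k \<omega> \<partial>lborel)"

definition J_End ::
  "'w measure \<Rightarrow> ('w \<Rightarrow> real ^ 'n) \<Rightarrow> ('w \<Rightarrow> complex) \<Rightarrow> (real ^ 'n \<Rightarrow> real) \<Rightarrow> real
    \<Rightarrow> real ^ 'n ^ 'n \<Rightarrow> real" where
  "J_End M X Y k lam U =
     Inf {1/2 * (\<integral>w. (cmod (Y w - f (U *v X w)))\<^sup>2 \<partial>M) + lam/2 * H_norm_sq k f_hat
          | f f_hat. in_H k f f_hat}"

definition pos_semidef :: "real ^ 'n ^ 'n \<Rightarrow> bool" where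
  "pos_semidef S \<longleftrightarrow> transpose S = S \<and> (\<forall>x. 0 \<le> x \<bullet> (S *v x))"

definition Sym_pos :: "(real ^ 'n ^ 'n) set" where
  "Sym_pos = {S. transpose S = S \<and> (\<forall>x. x \<noteq> 0 \<longrightarrow> 0 < x \<bullet> (S *v x))}"

definition stratum :: "nat \<Rightarrow> (real ^ 'n ^ 'n) set" where
  "stratum l = {S. pos_semidef S \<and> rank S = l}"

definition Sym_ge0 :: "(real ^ 'n ^ 'n) set" where
  "Sym_ge0 = Sym_pos \<union> (\<Union>l\<in>{0..CARD('n) - 1}. stratum l)"

text \<open>By rotational invariance of \<open>k\<close>, the value does not depend on the choice of \<open>U\<close>.\<close>

definition J_Sym ::
  "'w measure \<Rightarrow> ('w \<Rightarrow> real ^ 'n) \<Rightarrow> ('w \<Rightarrow> complex) \<Rightarrow> (real ^ 'n \<Rightarrow> real) \<Rightarrow> real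
    \<Rightarrow> real ^ 'n ^ 'n \<Rightarrow> real" where
  "J_Sym M X Y k lam S =
     J_End M X Y k lam (SOME U. \<forall>x. x \<bullet> (S *v x) = V_norm_sq M X (U *v x))"

text \<open>
  The derivative relative to \<open>Sym_ge0\<close>, including boundary points. The inner product of matrices
  is the full contraction \<open>A\<^sup>i\<^sup>j H\<^sub>i\<^sub>j\<close>, i.e. the pairing of \<open>Sym\<^sup>2 V\<close> with \<open>Sym\<^sup>2 V\<^sup>*\<close>. There is at most
  one such \<open>A\<close>, because \<open>S + P\<close> lies in \<open>Sym_ge0\<close> for all positive semi-definite \<open>P\<close> and these
  \<open>P\<close> span the symmetric matrices.
\<close>

definition DJ ::
  "'w measure \<Rightarrow> ('w \<Rightarrow> real ^ 'n) \<Rightarrow> ('w \<Rightarrow> complex) \<Rightarrow> (real ^ 'n \<Rightarrow> real) \<Rightarrow> real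
    \<Rightarrow> real ^ 'n ^ 'n \<Rightarrow> real ^ 'n ^ 'n" where
  "DJ M X Y k lam S =
     (THE A. transpose A = A \<and>
        (J_Sym M X Y k lam has_derivative (\<lambda>H. A \<bullet> H)) (at S within Sym_ge0))"

definition gradient_field ::
  "'w measure \<Rightarrow> ('w \<Rightarrow> real ^ 'n) \<Rightarrow> ('w \<Rightarrow> complex) \<Rightarrow> (real ^ 'n \<Rightarrow> real) \<Rightarrow> real
    \<Rightarrow> real ^ 'n ^ 'n \<Rightarrow> real ^ 'n ^ 'n" where
  "gradient_field M X Y k lam S =
     (\<chi> a b. - (1/2) *
        ((\<Sum>c\<in>UNIV. \<Sum>d\<in>UNIV. S $ a $ c * cov_lower M X $ b $ d * DJ M X Y k lam S $ c $ d)
       + (\<Sum>c\<in>UNIV. \<Sum>d\<in>UNIV. S $ b $ d * cov_lower M X $ a $ c * DJ M X Y k lam S $ c $ d)))"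

definition solves_ode_in ::
  "('a::real_normed_vector \<Rightarrow> 'a) \<Rightarrow> 'a set \<Rightarrow> real set \<Rightarrow> (real \<Rightarrow> 'a) \<Rightarrow> bool" where
  "solves_ode_in F S I \<gamma> \<longleftrightarrow>
     (\<forall>t\<in>I. \<gamma> t \<in> S \<and> (\<gamma> has_vector_derivative F (\<gamma> t)) (at t within I))"

text \<open>
  The forward flow of the differential equation on \<open>S\<close>, defined for all \<open>t \<ge> 0\<close>. The last
  conjunct says that it is the flow of the equation: every solution in \<open>S\<close>, also one given only
  for a finite time, is a piece of a trajectory of \<open>\<phi>\<close>.
\<close>

definition global_flow ::
  "('a::real_normed_vector \<Rightarrow> 'a) \<Rightarrow> 'a set \<Rightarrow> (real \<Rightarrow> 'a \<Rightarrow> 'a) \<Rightarrow> bool" where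
  "global_flow F S \<phi> \<longleftrightarrow>
     (\<forall>x\<in>S. \<phi> 0 x = x) \<and>
     (\<forall>x\<in>S. \<forall>s\<ge>0. \<forall>t\<ge>0. \<phi> (s + t) x = \<phi> s (\<phi> t x)) \<and>
     (\<forall>x\<in>S. solves_ode_in F S {0..} (\<lambda>t. \<phi> t x)) \<and>
     (\<forall>T>0. \<forall>\<gamma>. solves_ode_in F S {0..<T} \<gamma> \<longrightarrow> (\<forall>t\<in>{0..<T}. \<gamma> t = \<phi> t (\<gamma> 0)))"

end

theory Submission
  imports Defs
begin

text \<open>
  In matrix form the vector field is \<open>N(\<Sigma>) \<Sigma> + \<Sigma> N(\<Sigma>)\<^sup>T\<close> with \<open>N(\<Sigma>) = - C D\<J>(\<Sigma>) / 2\<close>, where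
  \<open>C = cov_lower M X\<close>. If \<open>N\<close> is bounded and Lipschitz on the positive semidefinite cone, then
  \<open>P' = N(P \<Sigma> P\<^sup>T) P\<close>, \<open>P(0) = 1\<close> has a global solution by Picard iteration, and \<open>P \<Sigma> P\<^sup>T\<close> solves the
  original equation. As \<open>P\<close> stays invertible, both the cone and the rank are preserved.
  Uniqueness and continuity in the initial data follow from Gronwall's inequality.

  The bounds on \<open>D\<J>\<close> come from the dual problem. Write \<open>z = X - X'\<close>, with \<open>(r, X)\<close> and \<open>(r', X')\<close>
  independent copies. Then \<open>\<J>(\<Sigma>)\<close> is the supremum over \<open>r\<close> in \<open>L\<^sup>2\<close> of
  \<open>Re E[Y \<cdot> cnj r] - E|r|\<^sup>2 / 2 - Re E[r \<cdot> cnj r' \<cdot> \<K>(z\<^sup>T \<Sigma> z)] / (2 \<lambda>)\<close>, and the maximiser is the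
  residual. By Bochner positivity the last form is nonnegative, so the residual depends Lipschitz
  continuously on \<open>\<Sigma>\<close>, and an envelope argument shows that
  \<open>D\<J>(\<Sigma>) = - Re E[r \<cdot> cnj r' \<cdot> \<K>'(z\<^sup>T \<Sigma> z) z z\<^sup>T] / (2 \<lambda>)\<close>. The eighth moment of \<open>X\<close> makes \<open>|z|\<^sup>4\<close>,
  which bounds the second derivative of the kernel in \<open>\<Sigma>\<close>, square integrable.
\<close>

section \<open>Positive semidefinite forms\<close>

text \<open>The field is controlled only on the cone, and Picard iterates of the equation itself may
  leave it. The lifted equation removes this obstacle: \<open>P ** S ** transpose P\<close> lies in
  the cone for every matrix \<open>P\<close>, so the lifted field is controlled on a whole vector
  space. There it is Lipschitz on balls and grows at most linearly, which excludes blow-up.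

  The maximiser of the dual problem is never constructed. Functions that solve its Euler equation up
  to a small error in \<open>L^2\<close> take its place; coercivity makes them close to each other,
  and only their gradients, which are matrices, are passed to the limit.

  The envelope argument needs just a lower Taylor bound: the objective lies above each dual value,
  and exchanging the two forms turns the lower bound into an upper one once the gradient is
  Lipschitz.

  Complex functions are treated as functions with values in a real Euclidean plane, where the real
  part of \<open>a * cnj b\<close> is the inner product.\<close>

lemma quadratic_nonneg_imp_discriminant_le:
  fixes a b c :: real
  assumes "0 \<le> c" and q: "\<And>t. 0 \<le> a + 2 * b * t + c * t\<^sup>2"
  shows "b\<^sup>2 \<le> a * c"
proof (cases "c = 0")
  case True
  have "b = 0"
  proof (rule ccontr)
    assume "b \<noteq> 0"
    \<comment> \<open>At the chosen \<open>t\<close> the linear polynomial equals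
      \<open>-1\<close>.\<close>
    then show False
      using q[of "- (a + 1) / (2 * b)"] True by simp
  qed
  then show ?thesis using True by simp
next
  case False
  then have "c > 0" using assms by simp
  \<comment> \<open>Evaluation at the vertex of the parabola.\<close>
  then show ?thesis
    using q[of "- b / c"] by (simp add: field_simps power2_eq_square)
qed

lemma pos_semidef_Cauchy_Schwarz:
  assumes "pos_semidef S"
  shows "(x \<bullet> (S *v y))\<^sup>2 \<le> (x \<bullet> (S *v x)) * (y \<bullet> (S *v y))"
proof -
  define a b c where "a = x \<bullet> (S *v x)" and "b = x \<bullet> (S *v y)" and "c = y \<bullet> (S *v y)"
  have "y \<bullet> (S *v x) = b"
  proof -
    have "y \<bullet> (S *v x) = (y v* S) \<bullet> x" by (simp add: dot_lmul_matrix)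
    also have "y v* S = S *v y"
      using assms unfolding pos_semidef_def by (metis transpose_matrix_vector)
    finally show ?thesis by (simp add: b_def inner_commute)
  qed
  then have q: "0 \<le> a + 2 * b * t + c * t\<^sup>2" for t
    using assms[unfolded pos_semidef_def, THEN conjunct2, rule_format, of "x + t *\<^sub>R y"]
    by (simp add: a_def b_def c_def algebra_simps matrix_vector_mult_scaleR power2_eq_square matrix_vector_right_distrib)
  have "0 \<le> c" using assms by (simp add: c_def pos_semidef_def)
  then have "b\<^sup>2 \<le> a * c" using q by (rule quadratic_nonneg_imp_discriminant_le)
  then show ?thesis by (simp add: a_def b_def c_def)
qed

text \<open>Cauchy-Schwarz with \<open>S *v x\<close> as test vector makes the fourth power of its
  norm vanish.\<close>

lemma pos_semidef_null_vector:
  assumes "pos_semidef S" "x \<bullet> (S *v x) = 0"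
  shows "S *v x = 0"
proof -
  have "((S *v x) \<bullet> (S *v x))\<^sup>2 \<le> 0"
    using pos_semidef_Cauchy_Schwarz[OF assms(1), of "S *v x" x] assms(2) by simp
  then show ?thesis by simp
qed

lemma Sym_pos_imp_pos_semidef: "S \<in> Sym_pos \<Longrightarrow> pos_semidef S"
  by (auto simp: Sym_pos_def pos_semidef_def) (metis inner_zero_left order.refl order.strict_implies_order)

text \<open>Makes positive definiteness one more rank condition, so that preservation of rank covers
  \<open>Sym_pos\<close> and the strata at once.\<close>

lemma Sym_pos_eq: "Sym_pos = {S :: real ^ 'n ^ 'n. pos_semidef S \<and> rank S = CARD('n)}"
proof (intro equalityI subsetI)
  fix S :: "real ^ 'n ^ 'n" assume S: "S \<in> Sym_pos"
  have "inj ((*v) S)"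
  proof (rule injI)
    fix x y assume "S *v x = S *v y"
    then have "S *v (x - y) = 0" by (simp add: matrix_vector_mult_diff_distrib)
    then have "\<not> 0 < (x - y) \<bullet> (S *v (x - y))" by simp
    then have "x - y = 0" using S unfolding Sym_pos_def by blast
    then show "x = y" by simp
  qed
  then show "S \<in> {S. pos_semidef S \<and> rank S = CARD('n)}"
    using S Sym_pos_imp_pos_semidef full_rank_injective by blast
next
  fix S :: "real ^ 'n ^ 'n" assume "S \<in> {S. pos_semidef S \<and> rank S = CARD('n)}"
  then have S: "pos_semidef S" and i: "inj ((*v) S)"
    using full_rank_injective by blast+
  have "0 < x \<bullet> (S *v x)" if "x \<noteq> 0" for x
  proof -
    have "S *v x \<noteq> 0" using injD[OF i, of x 0] that by auto
    then have "x \<bullet> (S *v x) \<noteq> 0" using pos_semidef_null_vector[OF S] by blast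
    moreover have "0 \<le> x \<bullet> (S *v x)" using S by (simp add: pos_semidef_def)
    ultimately show ?thesis by linarith
  qed
  then show "S \<in> Sym_pos" using S by (auto simp: Sym_pos_def pos_semidef_def)
qed

lemma Sym_ge0_eq: "Sym_ge0 = Collect pos_semidef"
proof -
  have "rank S = CARD('n) \<or> rank S \<in> {0..CARD('n) - 1}" for S :: "real ^ 'n ^ 'n"
    using rank_bound[of S] by auto
  then show ?thesis unfolding Sym_ge0_def Sym_pos_eq stratum_def by blast
qed

lemma Sym_pos_subset_Sym_ge0: "Sym_pos \<subseteq> Sym_ge0"
  by (auto simp: Sym_ge0_def)

lemma pos_semidef_congruence:
  assumes "pos_semidef S"
  shows "pos_semidef (P ** S ** transpose P)"
proof -
  have "x \<bullet> ((P ** S ** transpose P) *v x) = (x v* P) \<bullet> (S *v (x v* P))" for x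
    by (simp add: matrix_vector_mul_assoc[symmetric] dot_lmul_matrix)
  then show ?thesis
    using assms by (simp add: pos_semidef_def matrix_transpose_mul matrix_mul_assoc)
qed

text \<open>Multiplication cannot raise the rank, and \<open>Q\<close> undoes the congruence. The
  left inverse is explicit data because the lifted flow supplies it.\<close>

lemma rank_congruence:
  fixes P S :: "real ^ 'n ^ 'n"
  assumes "Q ** P = mat 1"
  shows "rank (P ** S ** transpose P) = rank S"
proof (rule antisym)
  show "rank (P ** S ** transpose P) \<le> rank S"
    by (rule order_trans[OF rank_mul_le_left rank_mul_le_right])
  have "Q ** (P ** S ** transpose P) ** transpose Q = (Q ** P) ** S ** transpose (Q ** P)"
    by (simp add: matrix_mul_assoc matrix_transpose_mul)
  also have "\<dots> = S" by (simp add: assms)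
  finally have "rank S = rank (Q ** (P ** S ** transpose P) ** transpose Q)" by simp
  also have "\<dots> \<le> rank (P ** S ** transpose P)"
    by (rule order_trans[OF rank_mul_le_left rank_mul_le_right])
  finally show "rank S \<le> rank (P ** S ** transpose P)" .
qed

definition outer :: "real ^ 'n \<Rightarrow> real ^ 'n ^ 'n" where
  "outer z = (\<chi> i j. z $ i * z $ j)"

lemma transpose_outer: "transpose (outer z) = outer z"
  by (simp add: outer_def transpose_def vec_eq_iff)

lemma outer_mult_vec: "outer z *v x = (z \<bullet> x) *\<^sub>R z"
  by (simp add: outer_def vec_eq_iff matrix_vector_mult_def inner_vec_def sum_distrib_left mult_ac)

lemma inner_outer: "A \<bullet> outer z = z \<bullet> (A *v z)"
  by (simp add: outer_def inner_vec_def matrix_vector_mult_def sum_distrib_left mult_ac)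

lemma norm_outer: "norm (outer z) = (norm z)\<^sup>2"
proof -
  have "(norm (outer z))\<^sup>2 = outer z \<bullet> outer z" by (simp add: power2_norm_eq_inner)
  also have "\<dots> = ((norm z)\<^sup>2)\<^sup>2"
    unfolding inner_outer by (simp add: outer_mult_vec power2_norm_eq_inner) (simp add: power2_eq_square)
  finally show ?thesis by (rule power2_eq_imp_eq) auto
qed

lemma pos_semidef_outer: "pos_semidef (outer z)"
  by (simp add: pos_semidef_def transpose_outer outer_mult_vec inner_commute)

lemma pos_semidef_add: "pos_semidef S \<Longrightarrow> pos_semidef T \<Longrightarrow> pos_semidef (S + T)"
  by (auto simp: pos_semidef_def transpose_def vec_eq_iff matrix_vector_mult_add_rdistrib inner_add_right)

lemma pos_semidef_scaleR: "pos_semidef S \<Longrightarrow> 0 \<le> c \<Longrightarrow> pos_semidef (c *\<^sub>R S)"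
  by (auto simp: pos_semidef_def transpose_scalar scaleR_matrix_vector_assoc[symmetric])

text \<open>Cholesky elimination: subtracting a rank one form removes one column of \<open>S\<close> at a time.\<close>

lemma pos_semidef_factorization:
  fixes S :: "real ^ 'n ^ 'n"
  assumes "pos_semidef S"
  obtains B :: "real ^ 'n ^ 'n" where "transpose B ** B = S"
proof -
  \<comment> \<open>The clause on rows is what the induction needs: the recursive factor leaves the
    row of the pivot empty, so the eliminated part can be stored there.\<close>
  have "\<exists>B :: real ^ 'n ^ 'n. (\<forall>i. column i S = 0 \<longrightarrow> row i B = 0) \<and> transpose B ** B = S"
    using assms
  proof (induction "card {i. column i S \<noteq> 0}" arbitrary: S rule: less_induct)
    case less
    have sym: "S $ a $ b = S $ b $ a" for a b
      using less.prems by (simp add: pos_semidef_def transpose_def vec_eq_iff)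
    have ax: "x \<bullet> (S *v axis i 1) = x \<bullet> column i S" for x i
      by (simp only: matrix_vector_mult_basis)
    have ax': "axis i 1 \<bullet> (S *v axis i 1) = S $ i $ i" for i
      by (simp add: matrix_vector_mult_basis inner_axis' column_def)
    show ?case
    proof (cases "\<exists>i. column i S \<noteq> 0")
      case False
      then have "S = 0" by (simp add: column_def vec_eq_iff)
      then show ?thesis
        by (intro exI[of _ 0]) (simp add: row_def vec_eq_iff matrix_matrix_mult_def)
    next
      case True
      then obtain i where i: "column i S \<noteq> 0" by blast
      define d where "d = S $ i $ i"
      define c where "c = column i S"
      \<comment> \<open>A vanishing diagonal entry would make the basis vector a null vector and its
        column zero.\<close>
      have "d \<noteq> 0"
        using pos_semidef_null_vector[OF less.prems, of "axis i 1"] i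
        unfolding ax' d_def by (metis matrix_vector_mult_basis)
      then have d: "d > 0"
        using less.prems ax'[of i] unfolding d_def pos_semidef_def by (metis less_eq_real_def)
      define S' where "S' = S - (1 / d) *\<^sub>R outer c"
      have comp: "S' $ a $ b = S $ a $ b - S $ a $ i * S $ b $ i / d" for a b
        by (simp add: S'_def outer_def c_def column_def)
      have psd: "pos_semidef S'"
        unfolding pos_semidef_def
      proof (intro conjI allI)
        show "transpose S' = S'" by (simp add: transpose_def vec_eq_iff comp) (metis mult.commute sym)
        fix x
        \<comment> \<open>Cauchy-Schwarz against the pivot vector is precisely nonnegativity of the
          Schur complement.\<close>
        have "(x \<bullet> c)\<^sup>2 \<le> (x \<bullet> (S *v x)) * d"
          using pos_semidef_Cauchy_Schwarz[OF less.prems, of x "axis i 1"]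
          unfolding ax' c_def d_def by (simp only: ax)
        then show "0 \<le> x \<bullet> (S' *v x)"
          using d by (simp add: S'_def matrix_vector_mult_diff_rdistrib inner_diff_right
              scaleR_matrix_vector_assoc[symmetric] outer_mult_vec field_simps power2_eq_square inner_commute)
      qed
      \<comment> \<open>By symmetry \<open>c\<close> vanishes at the index of a zero column, so
        elimination leaves that column zero. With the pivot column gone, the number of nonzero
        columns drops.\<close>
      have sub: "column j S' = 0" if "column j S = 0" for j
      proof -
        have "S $ a $ j = 0" for a using that by (simp add: column_def vec_eq_iff)
        then show ?thesis using sym[of j i] by (simp add: column_def vec_eq_iff comp)
      qed
      have ci: "column i S' = 0"
        using d by (simp add: column_def vec_eq_iff comp d_def[symmetric])
      have "card {j. column j S' \<noteq> 0} < card {j. column j S \<noteq> 0}"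
        by (rule psubset_card_mono) (use sub ci i in auto)
      from less.hyps[OF this psd] obtain B' where
        B'0: "\<And>j. column j S' = 0 \<Longrightarrow> row j B' = 0" and B': "transpose B' ** B' = S'" by blast
      define B where "B = (\<chi> j. if j = i then (1 / sqrt d) *\<^sub>R c else B' $ j)"
      have B'i: "B' $ i $ a = 0" for a using B'0[OF ci] by (simp add: row_def vec_eq_iff)
      have "(\<Sum>j\<in>UNIV. B $ j $ a * B $ j $ b) = S $ a $ b" for a b
      proof -
        have "(\<Sum>j\<in>UNIV. B $ j $ a * B $ j $ b)
            = B $ i $ a * B $ i $ b + (\<Sum>j\<in>UNIV - {i}. B $ j $ a * B $ j $ b)"
          by (subst sum.remove[of UNIV i]) auto
        also have "(\<Sum>j\<in>UNIV - {i}. B $ j $ a * B $ j $ b) = (\<Sum>j\<in>UNIV - {i}. B' $ j $ a * B' $ j $ b)"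
          by (rule sum.cong) (auto simp: B_def)
        also have "\<dots> = (\<Sum>j\<in>UNIV. B' $ j $ a * B' $ j $ b)"
          by (rule sum.mono_neutral_left) (auto simp: B'i)
        also have "\<dots> = S' $ a $ b"
          unfolding B'[symmetric] by (simp add: matrix_matrix_mult_def transpose_def)
        also have "B $ i $ a * B $ i $ b = S $ a $ i * S $ b $ i / d"
          using d by (simp add: B_def c_def column_def)
        finally show ?thesis by (simp add: comp)
      qed
      then have "transpose B ** B = S"
        by (simp add: matrix_matrix_mult_def transpose_def vec_eq_iff)
      moreover have "row j B = 0" if "column j S = 0" for j
        using that i B'0[OF sub[OF that]] by (auto simp: B_def row_def vec_eq_iff)
      ultimately show ?thesis by blast
    qed
  qed
  then show ?thesis using that by blast
qed

text \<open>Write \<open>D = B^T B\<close> and \<open>S = R^T R\<close>. Then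
  \<open>B D^(-1) B^T = 1\<close>, so \<open>U = B^T R\<close> works.\<close>

lemma pos_semidef_congruent_to_inverse:
  fixes D S :: "real ^ 'n ^ 'n"
  assumes D: "D \<in> Sym_pos" and S: "pos_semidef S"
  obtains U where "transpose U ** matrix_inv D ** U = S"
proof -
  obtain B :: "real ^ 'n ^ 'n" where B: "transpose B ** B = D"
    using pos_semidef_factorization[OF Sym_pos_imp_pos_semidef[OF D]] by blast
  obtain R :: "real ^ 'n ^ 'n" where R: "transpose R ** R = S"
    using pos_semidef_factorization[OF S] by blast
  have "invertible D"
    using D unfolding Sym_pos_eq
    by (metis (mono_tags, lifting) full_rank_injective inj_matrix_vector_mult invertible_left_inverse matrix_left_invertible_injective mem_Collect_eq)
  then have "D ** matrix_inv D = mat 1"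
    unfolding invertible_def matrix_inv_def by (rule someI_ex[THEN conjunct1])
  then have "transpose B ** (B ** matrix_inv D) = mat 1"
    by (simp add: B[symmetric] matrix_mul_assoc)
  \<comment> \<open>A one-sided inverse of a square matrix is two-sided.\<close>
  then have *: "B ** matrix_inv D ** transpose B = mat 1"
    using matrix_left_right_inverse by blast
  have "transpose (transpose B ** R) ** matrix_inv D ** (transpose B ** R)
      = transpose R ** (B ** matrix_inv D ** transpose B) ** R"
    by (simp add: matrix_transpose_mul matrix_mul_assoc)
  also have "\<dots> = S" by (simp add: * R)
  finally show ?thesis using that by blast
qed

text \<open>The rays \<open>S + t *\<^sub>R outer z\<close> with \<open>t \<ge> 0\<close> stay in
  the cone, also from boundary points, and right derivatives along them determine the quadratic form
  of the gradient.\<close>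

lemma Sym_ge0_derivative_unique:
  fixes J :: "real ^ 'n ^ 'n \<Rightarrow> real"
  assumes S: "S \<in> Sym_ge0"
    and A: "transpose A = A" "(J has_derivative (\<lambda>H. A \<bullet> H)) (at S within Sym_ge0)"
    and B: "transpose B = B" "(J has_derivative (\<lambda>H. B \<bullet> H)) (at S within Sym_ge0)"
  shows "A = B"
proof -
  have ps: "S + t *\<^sub>R outer z \<in> Sym_ge0" if "t \<ge> 0" for t z
    using S that unfolding Sym_ge0_eq by (simp add: pos_semidef_add pos_semidef_scaleR pos_semidef_outer)
  have der: "((\<lambda>t. J (S + t *\<^sub>R outer z)) has_real_derivative C \<bullet> outer z) (at 0 within {0..})"
    if "(J has_derivative (\<lambda>H. C \<bullet> H)) (at S within Sym_ge0)" for C z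
  proof -
    have 1: "((\<lambda>t. S + t *\<^sub>R outer z) has_derivative (\<lambda>t. t *\<^sub>R outer z)) (at 0 within {0..})"
      by (auto intro!: derivative_eq_intros)
    have 2: "(J has_derivative (\<lambda>H. C \<bullet> H)) (at (S + 0 *\<^sub>R outer z) within (\<lambda>t. S + t *\<^sub>R outer z) ` {0..})"
      using that by (rule_tac has_derivative_subset[where s = Sym_ge0]) (use ps in auto)
    show ?thesis
      using diff_chain_within[OF 1 2] unfolding has_field_derivative_def o_def
      by (rule has_derivative_eq_rhs) (simp add: fun_eq_iff)
  qed
  have eq: "A \<bullet> outer z = B \<bullet> outer z" for z
  proof -
    have "at (0::real) within {0..} \<noteq> bot" by (simp add: at_within_Ici_at_right)
    then show ?thesis
      using has_field_derivative_unique[OF der[OF A(2)] der[OF B(2)]] by blast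
  qed
  define E where "E = A - B"
  have E: "z \<bullet> (E *v z) = 0" for z
    using eq[of z] by (simp add: E_def inner_outer matrix_vector_mult_diff_rdistrib inner_diff_right)
  \<comment> \<open>A form with vanishing quadratic values is semidefinite, so the lemma on null
    vectors replaces polarization.\<close>
  have "pos_semidef E"
    using E A(1) B(1) by (simp add: pos_semidef_def) (simp add: E_def transpose_def vec_eq_iff)
  then have "E *v z = 0" for z using pos_semidef_null_vector E by blast
  then have "E = 0" by (simp add: matrix_eq)
  then show ?thesis by (simp add: E_def)
qed

section \<open>Ordinary differential equations\<close>

lemma has_vector_derivative_within_Ici:
  assumes "(f has_vector_derivative d) (at t within {0..b})" "t < b"
  shows "(f has_vector_derivative d) (at t within {0::real..})"
proof -
  have "at t within {0..b} = at t within {0..}"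
    by (rule at_within_nhd[of t "{..<b}"]) (use assms(2) in auto)
  then show ?thesis using assms(1) by simp
qed

text \<open>The squared norm is differentiable also where \<open>u\<close> vanishes; multiplied by
  \<open>exp (- (2 * L * s))\<close> it is nonincreasing.\<close>

lemma norm_Gronwall:
  fixes u :: "real \<Rightarrow> 'a::real_inner"
  assumes der: "\<And>s. s \<in> {0..T} \<Longrightarrow> (u has_vector_derivative u' s) (at s within {0..T})"
    and le: "\<And>s. s \<in> {0..T} \<Longrightarrow> norm (u' s) \<le> L * norm (u s)"
    and t: "t \<in> {0..T}"
  shows "norm (u t) \<le> norm (u 0) * exp (L * t)"
proof (cases "t = 0")
  case True then show ?thesis by simp
next
  case False
  then have t0: "0 < t" using t by simp
  define g where "g s = (u s \<bullet> u s) * exp (- (2 * L * s))" for s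
  define g' where "g' s = 2 * (u s \<bullet> u' s - L * (u s \<bullet> u s)) * exp (- (2 * L * s))" for s
  have d: "(g has_derivative (\<lambda>h. h * g' s)) (at s within {0..t})" if "0 \<le> s" "s \<le> t" for s
  proof -
    have "(u has_derivative (\<lambda>h. h *\<^sub>R u' s)) (at s within {0..t})"
      using der[of s] that t unfolding has_vector_derivative_def
      by (auto intro: has_derivative_subset)
    then show ?thesis unfolding g_def g'_def
      by (auto intro!: derivative_eq_intros simp: algebra_simps inner_commute)
  qed
  obtain s where s: "s \<in> {0<..<t}" "g t - g 0 = (t - 0) * g' s"
    using mvt_simple[OF t0 d] by blast
  have "u s \<bullet> u' s \<le> norm (u s) * norm (u' s)" by (rule norm_cauchy_schwarz)
  also have "\<dots> \<le> norm (u s) * (L * norm (u s))"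
    using le[of s] s t by (intro mult_left_mono) auto
  also have "\<dots> = L * (u s \<bullet> u s)"
    by (simp add: power2_norm_eq_inner[symmetric] power2_eq_square)
  finally have "g' s \<le> 0" by (simp add: g'_def mult_nonpos_nonneg)
  then have "g t \<le> g 0" using s t0 by (simp add: mult_nonneg_nonpos algebra_simps)
  then have "(norm (u t))\<^sup>2 \<le> (norm (u 0))\<^sup>2 * exp (2 * L * t)"
    by (simp add: g_def power2_norm_eq_inner exp_minus field_simps)
  also have "\<dots> = (norm (u 0) * exp (L * t))\<^sup>2"
    by (simp add: power_mult_distrib exp_double[symmetric] mult.assoc)
  finally show ?thesis by (rule power2_le_imp_le) simp
qed

text \<open>Lipschitz constants may depend on the ball, because the growth bound confines all Picard
  iterates on \<open>{0..T}\<close> to a single ball. The lifted field is of this kind, being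
  quadratic in \<open>P\<close> inside \<open>N\<close>.\<close>

locale linear_growth_field =
  fixes F :: "'a::euclidean_space \<Rightarrow> 'a" and K :: real and x0 :: 'a
  assumes lip: "\<And>R. \<exists>L. \<forall>x y. norm x \<le> R \<longrightarrow> norm y \<le> R \<longrightarrow> norm (F x - F y) \<le> L * norm (x - y)"
    and growth: "\<And>x. norm (F x) \<le> K * norm x"
begin

primrec iterate :: "nat \<Rightarrow> real \<Rightarrow> 'a" where
  "iterate 0 = (\<lambda>t. x0)"
| "iterate (Suc n) = (\<lambda>t. x0 + integral {0..t} (\<lambda>s. F (iterate n s)))"

lemma lip_nonneg:
  obtains L where "0 \<le> L"
    "\<And>x y. norm x \<le> R \<Longrightarrow> norm y \<le> R \<Longrightarrow> norm (F x - F y) \<le> L * norm (x - y)"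
proof -
  obtain L where L: "\<And>x y. norm x \<le> R \<Longrightarrow> norm y \<le> R \<Longrightarrow> norm (F x - F y) \<le> L * norm (x - y)"
    using lip[of R] by blast
  have "L * norm (x - y) \<le> max L 0 * norm (x - y)" for x y
    by (rule mult_right_mono) auto
  then show ?thesis by (intro that[of "max L 0"] order_trans[OF L]) simp_all
qed

lemma continuous_F: "continuous_on UNIV F"
proof -
  have "isCont F x" for x
  proof -
    obtain L where L: "0 \<le> L"
      "\<And>u v. norm u \<le> norm x + 1 \<Longrightarrow> norm v \<le> norm x + 1 \<Longrightarrow> norm (F u - F v) \<le> L * norm (u - v)"
      using lip_nonneg by blast
    have "L-lipschitz_on (ball x 1) F"
    proof (rule lipschitz_onI)
      fix u v assume "u \<in> ball x 1" "v \<in> ball x 1"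
      then have "norm u \<le> norm x + 1" "norm v \<le> norm x + 1"
        using norm_triangle_sub[of u x] norm_triangle_sub[of v x]
        by (auto simp: dist_norm norm_minus_commute)
      then show "dist (F u) (F v) \<le> L * dist u v" using L(2) by (simp add: dist_norm)
    qed (use L in simp)
    then have "continuous_on (ball x 1) F" by (rule lipschitz_on_continuous_on)
    then show ?thesis by (simp add: continuous_on_eq_continuous_at)
  qed
  then show ?thesis by (simp add: continuous_at_imp_continuous_on)
qed

lemma continuous_on_F_comp: "continuous_on A f \<Longrightarrow> continuous_on A (\<lambda>s. F (f s))"
  by (rule continuous_on_compose2[OF continuous_F]) auto

lemma continuous_iterate: "continuous_on {0..T} (iterate n)"
proof (induction n)
  case (Suc n)
  have "(\<lambda>s. F (iterate n s)) integrable_on {0..T}"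
    by (intro integrable_continuous_interval continuous_on_F_comp Suc)
  then show ?case
    by (auto intro!: continuous_intros indefinite_integral_continuous_1)
qed simp

lemma integrable_F_iterate: "(\<lambda>s. F (iterate n s)) integrable_on {0..t}"
  by (intro integrable_continuous_interval continuous_on_F_comp continuous_iterate)

lemma K_nonneg: "0 \<le> K \<or> x0 = 0"
  using growth[of x0] norm_ge_zero[of "F x0"] by (metis mult_neg_pos not_le order_trans zero_less_norm_iff)

text \<open>The bound reproduces itself under integration: \<open>norm x0\<close> plus the integral
  of \<open>K * norm x0 * exp (K * s)\<close> is again the bound.\<close>

lemma norm_iterate_le: "0 \<le> t \<Longrightarrow> norm (iterate n t) \<le> norm x0 * exp (K * t)"
proof (induction n arbitrary: t)
  case 0
  have "1 \<le> exp (K * t) \<or> x0 = 0" using K_nonneg 0 by auto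
  then show ?case by (auto simp: mult_le_cancel_left1)
next
  case (Suc n)
  have der: "((\<lambda>s. norm x0 * exp (K * s)) has_vector_derivative K * (norm x0 * exp (K * s)))
      (at s within {0..t})" for s
    by (auto intro!: derivative_eq_intros
        simp: has_real_derivative_iff_has_vector_derivative[symmetric])
  have hi: "((\<lambda>s. K * (norm x0 * exp (K * s))) has_integral
      norm x0 * exp (K * t) - norm x0 * exp (K * 0)) {0..t}"
    by (rule fundamental_theorem_of_calculus) (use Suc.prems der in auto)
  have "norm (integral {0..t} (\<lambda>s. F (iterate n s))) \<le> integral {0..t} (\<lambda>s. K * (norm x0 * exp (K * s)))"
  proof (rule integral_norm_bound_integral)
    fix s assume s: "s \<in> {0..t}"
    have "norm (F (iterate n s)) \<le> K * norm (iterate n s)" by (rule growth)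
    also have "\<dots> \<le> K * (norm x0 * exp (K * s))"
    proof (cases "0 \<le> K")
      case True
      then show ?thesis using Suc.IH[of s] s by (intro mult_left_mono) auto
    next
      case False
      then have "x0 = 0" using K_nonneg by simp
      then show ?thesis using Suc.IH[of s] s by simp
    qed
    finally show "norm (F (iterate n s)) \<le> K * (norm x0 * exp (K * s))" .
  qed (use hi integrable_F_iterate in \<open>auto simp: has_integral_integrable\<close>)
  also have "\<dots> = norm x0 * exp (K * t) - norm x0"
    using integral_unique[OF hi] by simp
  finally show ?case
    using norm_triangle_ineq[of x0 "integral {0..t} (\<lambda>s. F (iterate n s))"] by simp
qed

lemma iterate_bounded:
  obtains R where "0 \<le> R" "\<And>n t. t \<in> {0..T} \<Longrightarrow> norm (iterate n t) \<le> R"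
proof
  show "0 \<le> norm x0 * exp (\<bar>K\<bar> * T)" by simp
  fix n t assume t: "t \<in> {0..T}"
  have "norm (iterate n t) \<le> norm x0 * exp (K * t)" using norm_iterate_le t by simp
  also have "\<dots> \<le> norm x0 * exp (\<bar>K\<bar> * T)"
    using t by (intro mult_left_mono) (auto intro: mult_mono)
  finally show "norm (iterate n t) \<le> norm x0 * exp (\<bar>K\<bar> * T)" .
qed

text \<open>Each integration gains a factor \<open>L * t / (n + 1)\<close>. The initial
  \<open>2 * R\<close> is the diameter of the ball that contains all iterates.\<close>

lemma iterate_diff_le:
  assumes L: "0 \<le> L"
    "\<And>x y. norm x \<le> R \<Longrightarrow> norm y \<le> R \<Longrightarrow> norm (F x - F y) \<le> L * norm (x - y)"
    and R: "\<And>n t. t \<in> {0..T} \<Longrightarrow> norm (iterate n t) \<le> R"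
  shows "t \<in> {0..T} \<Longrightarrow> norm (iterate (Suc n) t - iterate n t) \<le> 2 * R * (L * t) ^ n / fact n"
proof (induction n arbitrary: t)
  case 0
  show ?case
    using norm_triangle_ineq4[of "iterate (Suc 0) t" "iterate 0 t"] R[OF 0, of 0] R[OF 0, of "Suc 0"]
    by simp
next
  case (Suc n)
  define c where "c = L * (2 * R * L ^ n / fact n)"
  have der: "((\<lambda>s. c * s ^ Suc n / Suc n) has_vector_derivative c * s ^ n) (at s within {0..t})" for s
  proof -
    have "((\<lambda>s. c * s ^ Suc n / Suc n) has_real_derivative c * (real (Suc n) * s ^ n) / Suc n) (at s within {0..t})"
      by (auto intro!: derivative_eq_intros simp del: power_Suc)
    also have "c * (real (Suc n) * s ^ n) / Suc n = c * s ^ n" by (simp del: of_nat_Suc)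
    finally show ?thesis by (simp add: has_real_derivative_iff_has_vector_derivative)
  qed
  have hi: "((\<lambda>s. c * s ^ n) has_integral c * t ^ Suc n / Suc n - c * 0 ^ Suc n / Suc n) {0..t}"
    by (rule fundamental_theorem_of_calculus) (use Suc.prems der in auto)
  have "iterate (Suc (Suc n)) t - iterate (Suc n) t
      = integral {0..t} (\<lambda>s. F (iterate (Suc n) s) - F (iterate n s))"
    using integral_diff[OF integrable_F_iterate[of "Suc n" t] integrable_F_iterate[of n t]] by simp
  also have "norm \<dots> \<le> integral {0..t} (\<lambda>s. c * s ^ n)"
  proof (rule integral_norm_bound_integral)
    fix s assume s: "s \<in> {0..t}"
    then have sT: "s \<in> {0..T}" using Suc.prems by simp
    have "norm (F (iterate (Suc n) s) - F (iterate n s)) \<le> L * norm (iterate (Suc n) s - iterate n s)"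
      by (rule L(2)[OF R[OF sT] R[OF sT]])
    also have "\<dots> \<le> L * (2 * R * (L * s) ^ n / fact n)"
      using Suc.IH[OF sT] L(1) by (rule mult_left_mono)
    also have "\<dots> = c * s ^ n" by (simp add: c_def power_mult_distrib)
    finally show "norm (F (iterate (Suc n) s) - F (iterate n s)) \<le> c * s ^ n" .
  qed (use hi integrable_diff[OF integrable_F_iterate[of "Suc n" t] integrable_F_iterate[of n t]]
      in \<open>auto simp: has_integral_integrable\<close>)
  also have "\<dots> = c * t ^ Suc n / Suc n" using integral_unique[OF hi] by simp
  also have "\<dots> = 2 * R * (L * t) ^ Suc n / fact (Suc n)"
    by (simp add: c_def power_mult_distrib field_simps)
  finally show ?case .
qed

text \<open>A telescoping series suits the Weierstrass test and gives one curve independent of the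
  horizon \<open>T\<close>.\<close>

definition limit_curve :: "real \<Rightarrow> 'a" where
  "limit_curve t = x0 + (\<Sum>n. iterate (Suc n) t - iterate n t)"

lemma iterate_uniform_limit: "uniform_limit {0..T} iterate limit_curve sequentially"
proof -
  obtain R where R: "0 \<le> R" "\<And>n t. t \<in> {0..T} \<Longrightarrow> norm (iterate n t) \<le> R"
    using iterate_bounded by blast
  obtain L where L: "0 \<le> L"
    "\<And>x y. norm x \<le> R \<Longrightarrow> norm y \<le> R \<Longrightarrow> norm (F x - F y) \<le> L * norm (x - y)"
    using lip_nonneg by blast
  have "norm (iterate (Suc n) t - iterate n t) \<le> 2 * R * ((L * T) ^ n / fact n)" if "t \<in> {0..T}" for n t
  proof -
    have "norm (iterate (Suc n) t - iterate n t) \<le> 2 * R * (L * t) ^ n / fact n"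
      by (rule iterate_diff_le[OF L R(2) that])
    also have "\<dots> \<le> 2 * R * (L * T) ^ n / fact n"
      using that L(1) by (intro divide_right_mono mult_left_mono power_mono) (auto simp: R(1))
    finally show ?thesis by simp
  qed
  moreover have "summable (\<lambda>n. 2 * R * ((L * T) ^ n / fact n))"
    using summable_exp[of "L * T"] by (intro summable_mult) (simp add: divide_inverse mult.commute)
  ultimately have "uniform_limit {0..T} (\<lambda>n t. \<Sum>i<n. iterate (Suc i) t - iterate i t)
      (\<lambda>t. \<Sum>i. iterate (Suc i) t - iterate i t) sequentially"
    by (rule Weierstrass_m_test)
  then have "uniform_limit {0..T} (\<lambda>n t. x0 + (\<Sum>i<n. iterate (Suc i) t - iterate i t))
      (\<lambda>t. x0 + (\<Sum>i. iterate (Suc i) t - iterate i t)) sequentially"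
    by (intro uniform_limit_intros)
  moreover have "x0 + (\<Sum>i<n. iterate (Suc i) t - iterate i t) = iterate n t" for n t
    using sum_lessThan_telescope[of "\<lambda>i. iterate i t" n] by simp
  ultimately show ?thesis by (simp only: limit_curve_def[abs_def])
qed

lemma limit_curve_integral:
  assumes "0 \<le> T"
  shows "continuous_on {0..T} limit_curve"
    and "limit_curve T = x0 + integral {0..T} (\<lambda>s. F (limit_curve s))"
proof -
  show cont: "continuous_on {0..T} limit_curve"
    by (rule uniform_limit_theorem[OF _ iterate_uniform_limit])
      (auto intro!: always_eventually continuous_iterate)
  have lim: "(\<lambda>n. iterate n t) \<longlonglongrightarrow> limit_curve t" if "t \<in> {0..T}" for t
    using iterate_uniform_limit that by (rule tendsto_uniform_limitI)
  have "uniform_limit {0..T} (\<lambda>n t. F (iterate n t)) (\<lambda>t. F (limit_curve t)) sequentially"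
  proof -
    obtain R where R: "0 \<le> R" "\<And>n t. t \<in> {0..T} \<Longrightarrow> norm (iterate n t) \<le> R"
      using iterate_bounded by blast
    \<comment> \<open>Compactness of the ball containing the iterates lets uniform convergence pass
      through \<open>F\<close>, and then through the integral.\<close>
    have "uniformly_continuous_on (cball 0 R) F"
      by (intro compact_uniformly_continuous continuous_on_subset[OF continuous_F]) auto
    then show ?thesis
      by (rule uniform_limit_compose_uniformly_continuous_on[OF iterate_uniform_limit])
        (use R in \<open>auto intro!: always_eventually\<close>)
  qed
  then obtain I J where I: "\<And>n. ((\<lambda>t. F (iterate n t)) has_integral I n) {0..T}"
    and J: "((\<lambda>t. F (limit_curve t)) has_integral J) {0..T}" and IJ: "I \<longlonglongrightarrow> J"
    by (rule uniform_limit_integral)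
      (auto intro!: continuous_on_F_comp continuous_iterate)
  have "(\<lambda>n. x0 + I n) \<longlonglongrightarrow> x0 + J" by (intro tendsto_intros IJ)
  moreover have "x0 + I n = iterate (Suc n) T" for n
    using integral_unique[OF I] by simp
  ultimately have "(\<lambda>n. iterate (Suc n) T) \<longlonglongrightarrow> x0 + J" by simp
  moreover have "(\<lambda>n. iterate (Suc n) T) \<longlonglongrightarrow> limit_curve T"
    using lim[of T] assms by (intro LIMSEQ_Suc) simp
  ultimately have "limit_curve T = x0 + J" using LIMSEQ_unique by blast
  then show "limit_curve T = x0 + integral {0..T} (\<lambda>s. F (limit_curve s))"
    using integral_unique[OF J] by simp
qed

lemma global_solution:
  obtains x where "x 0 = x0"
    "\<And>t. 0 \<le> t \<Longrightarrow> (x has_vector_derivative F (x t)) (at t within {0..})"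
proof
  show "limit_curve 0 = x0" using limit_curve_integral(2)[of 0] by simp
  fix t :: real assume t: "0 \<le> t"
  \<comment> \<open>The interval extends past \<open>t\<close>, so that its right end does not
    affect the derivative at \<open>t\<close>.\<close>
  have "((\<lambda>u. x0 + integral {0..u} (\<lambda>s. F (limit_curve s))) has_vector_derivative F (limit_curve t))
      (at t within {0..t + 1})"
    using integral_has_vector_derivative[OF continuous_on_F_comp[OF limit_curve_integral(1)], of "t + 1" t] t
    by (auto intro!: derivative_eq_intros)
  then have "(limit_curve has_vector_derivative F (limit_curve t)) (at t within {0..t + 1})"
    by (rule has_vector_derivative_transform[rotated -1]) (use t limit_curve_integral(2) in auto)
  then show "(limit_curve has_vector_derivative F (limit_curve t)) (at t within {0..})"
    by (rule has_vector_derivative_within_Ici) simp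
qed

end

section \<open>Flows by congruence on the positive semidefinite cone\<close>

lemma norm_sq_matrix: "(norm (A :: real ^ 'n ^ 'm))\<^sup>2 = (\<Sum>i\<in>UNIV. (norm (A $ i))\<^sup>2)"
  unfolding power2_norm_eq_inner by (simp add: inner_vec_def[of A])

lemma norm_sq_matrix_entries:
  "(norm (A :: real ^ 'n ^ 'm))\<^sup>2 = (\<Sum>i\<in>UNIV. \<Sum>j\<in>UNIV. (A $ i $ j)\<^sup>2)"
  unfolding power2_norm_eq_inner by (simp add: inner_vec_def power2_eq_square)

lemma norm_transpose: "norm (transpose A) = norm (A :: real ^ 'n ^ 'm)"
proof -
  have "(norm (transpose A))\<^sup>2 = (\<Sum>j\<in>UNIV. \<Sum>i\<in>UNIV. (A $ i $ j)\<^sup>2)"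
    by (simp add: norm_sq_matrix_entries transpose_def)
  also have "\<dots> = (norm A)\<^sup>2"
    unfolding norm_sq_matrix_entries by (rule sum.swap)
  finally show ?thesis by (rule power2_eq_imp_eq) auto
qed

lemma norm_matrix_mult_le:
  fixes A :: "real ^ 'n ^ 'm" and B :: "real ^ 'k ^ 'n"
  shows "norm (A ** B) \<le> norm A * norm B"
proof -
  have "(norm (A ** B))\<^sup>2 = (\<Sum>i\<in>UNIV. \<Sum>j\<in>UNIV. (A $ i \<bullet> transpose B $ j)\<^sup>2)"
    by (simp add: norm_sq_matrix_entries matrix_matrix_mult_def transpose_def inner_vec_def)
  also have "\<dots> \<le> (\<Sum>i\<in>UNIV. \<Sum>j\<in>UNIV. (norm (A $ i))\<^sup>2 * (norm (transpose B $ j))\<^sup>2)"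
    by (intro sum_mono) (simp only: power2_norm_eq_inner Cauchy_Schwarz_ineq)
  also have "\<dots> = (norm A)\<^sup>2 * (norm (transpose B))\<^sup>2"
    by (simp add: norm_sq_matrix[of A] norm_sq_matrix[of "transpose B"] sum_product)
  also have "\<dots> = (norm A * norm B)\<^sup>2"
    by (simp add: power_mult_distrib norm_transpose)
  finally show ?thesis by (rule power2_le_imp_le) simp
qed

lemma bounded_bilinear_matrix_mult:
  "bounded_bilinear ((**) :: real ^ 'n ^ 'm \<Rightarrow> real ^ 'k ^ 'n \<Rightarrow> real ^ 'k ^ 'm)"
proof
  show "\<exists>K. \<forall>(a :: real ^ 'n ^ 'm) (b :: real ^ 'k ^ 'n). norm (a ** b) \<le> norm a * norm b * K"
    by (intro exI[of _ 1]) (simp add: norm_matrix_mult_le)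
qed (simp_all add: matrix_matrix_mult_def vec_eq_iff sum.distrib sum_distrib_left algebra_simps)

lemmas has_vector_derivative_matrix_mult =
  bounded_bilinear.has_vector_derivative[OF bounded_bilinear_matrix_mult]

lemma bounded_linear_transpose: "bounded_linear (transpose :: real ^ 'n ^ 'm \<Rightarrow> real ^ 'm ^ 'n)"
  by (rule bounded_linear_intro[of _ 1])
    (simp_all add: transpose_scalar norm_transpose, simp add: transpose_def vec_eq_iff)

lemma norm_matrix_mult_diff_le:
  fixes A A' :: "real ^ 'n ^ 'm" and B B' :: "real ^ 'k ^ 'n"
  shows "norm (A ** B - A' ** B') \<le> norm (A - A') * norm B + norm A' * norm (B - B')"
proof -
  have "A ** B - A' ** B' = (A - A') ** B + A' ** (B - B')"
    by (simp add: bounded_bilinear.diff_left[OF bounded_bilinear_matrix_mult]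
        bounded_bilinear.diff_right[OF bounded_bilinear_matrix_mult])
  then have "norm (A ** B - A' ** B') \<le> norm ((A - A') ** B) + norm (A' ** (B - B'))"
    by (simp add: norm_triangle_ineq)
  also have "\<dots> \<le> norm (A - A') * norm B + norm A' * norm (B - B')"
    by (intro add_mono norm_matrix_mult_le)
  finally show ?thesis .
qed

lemma zero_in_Sym_ge0: "0 \<in> Sym_ge0"
  by (simp add: Sym_ge0_eq pos_semidef_def transpose_def vec_eq_iff)

lemma Sym_ge0_congruence: "S \<in> Sym_ge0 \<Longrightarrow> P ** S ** transpose P \<in> Sym_ge0"
  by (simp add: Sym_ge0_eq pos_semidef_congruence)

lemma solves_ode_in_subset:
  "solves_ode_in G A I \<gamma> \<Longrightarrow> J \<subseteq> I \<Longrightarrow> solves_ode_in G A J \<gamma>"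
  unfolding solves_ode_in_def by (meson has_vector_derivative_within_subset subsetD)

lemma solves_ode_in_shift:
  assumes "solves_ode_in F A {0..} \<gamma>" "0 \<le> t"
  shows "solves_ode_in F A {0..} (\<lambda>s. \<gamma> (s + t))"
proof -
  have "((\<lambda>s. \<gamma> (s + t)) has_vector_derivative F (\<gamma> (s + t))) (at s within {0..})" if "0 \<le> s" for s
  proof -
    have "(\<gamma> has_vector_derivative F (\<gamma> (s + t))) (at (s + t) within {0..})"
      using assms that by (auto simp: solves_ode_in_def)
    then have g: "(\<gamma> has_vector_derivative F (\<gamma> (s + t))) (at (s + t) within (\<lambda>s. s + t) ` {0..})"
      by (rule has_vector_derivative_within_subset) (use assms in auto)
    have "((\<lambda>s. s + t) has_vector_derivative 1) (at s within {0..})"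
      by (auto intro!: derivative_eq_intros)
    from vector_diff_chain_within[OF this g] show ?thesis by (simp add: o_def)
  qed
  then show ?thesis using assms by (auto simp: solves_ode_in_def)
qed

locale congruence_flow =
  fixes N :: "real ^ 'n ^ 'n \<Rightarrow> real ^ 'n ^ 'n" and K L :: real
    and F :: "real ^ 'n ^ 'n \<Rightarrow> real ^ 'n ^ 'n"
  assumes N_bound: "\<And>S. S \<in> Sym_ge0 \<Longrightarrow> norm (N S) \<le> K"
    and N_lip: "\<And>S T. S \<in> Sym_ge0 \<Longrightarrow> T \<in> Sym_ge0 \<Longrightarrow> norm (N S - N T) \<le> L * norm (S - T)"
    and F_eq: "\<And>S. S \<in> Sym_ge0 \<Longrightarrow> F S = N S ** S + S ** transpose (N S)"
    and L_nonneg: "0 \<le> L"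
begin

lemma K_nonneg: "0 \<le> K"
  using N_bound[OF zero_in_Sym_ge0] norm_ge_zero order_trans by blast

text \<open>\<open>N\<close> is evaluated only at points of the cone, whatever \<open>P\<close> is.
  The second component obeys the equation of the inverse of \<open>P\<close>; carrying it along
  avoids determinants.\<close>

definition pair_field :: "real ^ 'n ^ 'n \<Rightarrow> (real ^ 'n ^ 'n) \<times> (real ^ 'n ^ 'n) \<Rightarrow> (real ^ 'n ^ 'n) \<times> (real ^ 'n ^ 'n)" where
  "pair_field S PQ = (N (fst PQ ** S ** transpose (fst PQ)) ** fst PQ,
     - (snd PQ ** N (fst PQ ** S ** transpose (fst PQ))))"

lemma pair_field_growth:
  assumes S: "S \<in> Sym_ge0"
  shows "norm (pair_field S PQ) \<le> K * norm PQ"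
proof (cases PQ)
  case (Pair P Q)
  define A where "A = N (P ** S ** transpose P)"
  have A: "norm A \<le> K" unfolding A_def by (intro N_bound Sym_ge0_congruence S)
  have "norm (A ** P) \<le> K * norm P"
    by (rule order_trans[OF norm_matrix_mult_le mult_right_mono[OF A]]) simp
  moreover have "norm (Q ** A) \<le> K * norm Q"
    by (rule order_trans[OF norm_matrix_mult_le])
      (simp add: mult.commute[of K] mult_left_mono A)
  ultimately have "(norm (A ** P))\<^sup>2 + (norm (Q ** A))\<^sup>2 \<le> (K * norm P)\<^sup>2 + (K * norm Q)\<^sup>2"
    by (intro add_mono power_mono) auto
  also have "\<dots> = (K * norm PQ)\<^sup>2"
    by (simp add: Pair norm_Pair power_mult_distrib distrib_left)
  finally have "(norm (pair_field S PQ))\<^sup>2 \<le> (K * norm PQ)\<^sup>2"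
    by (simp add: pair_field_def Pair norm_Pair A_def)
  then show ?thesis by (rule power2_le_imp_le) (simp add: K_nonneg)
qed

text \<open>On the ball of radius \<open>R\<close> the map from \<open>P\<close> to
  \<open>P S P^T\<close> has Lipschitz constant \<open>2 * R * norm S\<close>. The product rule adds
  the factor \<open>R\<close> and the summand \<open>K\<close>, and the leading \<open>2\<close>
  adds up the components.\<close>

lemma pair_field_lip:
  assumes S: "S \<in> Sym_ge0" and PQ: "norm PQ \<le> R" "norm PQ' \<le> R"
  shows "norm (pair_field S PQ - pair_field S PQ') \<le> 2 * (L * (2 * R * norm S) * R + K) * norm (PQ - PQ')"
proof (cases PQ, cases PQ')
  fix P Q P' Q' assume eq: "PQ = (P, Q)" "PQ' = (P', Q')"
  define d where "d = norm (PQ - PQ')"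
  have n: "norm P \<le> R" "norm Q \<le> R" "norm P' \<le> R" "norm Q' \<le> R"
    using PQ norm_fst_le[of P Q] norm_snd_le[of Q P] norm_fst_le[of P' Q'] norm_snd_le[of Q' P']
    by (auto simp: eq)
  have d: "norm (P - P') \<le> d" "norm (Q - Q') \<le> d"
    using norm_fst_le[of "P - P'" "Q - Q'"] norm_snd_le[of "Q - Q'" "P - P'"] by (auto simp: d_def eq)
  have R: "0 \<le> R" and d0: "0 \<le> d" using n norm_ge_zero order_trans by (blast, simp add: d_def)
  define T T' where "T = P ** S ** transpose P" and "T' = P' ** S ** transpose P'"
  have TS: "T \<in> Sym_ge0" "T' \<in> Sym_ge0" by (auto simp: T_def T'_def intro: Sym_ge0_congruence S)
  have "norm (P ** S - P' ** S) \<le> d * norm S"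
    using norm_matrix_mult_diff_le[of P S P' S] d(1) mult_right_mono[OF d(1), of "norm S"] by simp
  moreover have "norm (P' ** S) \<le> R * norm S"
    by (rule order_trans[OF norm_matrix_mult_le]) (simp add: mult_right_mono n)
  moreover have "norm (T - T') \<le> norm (P ** S - P' ** S) * norm P + norm (P' ** S) * norm (P - P')"
    using norm_matrix_mult_diff_le[of "P ** S" "transpose P" "P' ** S" "transpose P'"]
    by (simp add: T_def T'_def norm_transpose
        linear_diff[OF bounded_linear.linear[OF bounded_linear_transpose], symmetric])
  moreover have "norm (P ** S - P' ** S) * norm P + norm (P' ** S) * norm (P - P')
      \<le> (d * norm S) * R + (R * norm S) * d"
    using calculation(1,2) n d d0 R by (intro add_mono mult_mono) auto
  ultimately have "norm (T - T') \<le> 2 * R * norm S * d" by (simp add: mult_ac)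
  then have "L * norm (T - T') \<le> L * (2 * R * norm S * d)" using L_nonneg by (rule mult_left_mono)
  then have NT: "norm (N T - N T') \<le> L * (2 * R * norm S) * d"
    using N_lip[OF TS] by (simp add: mult.assoc)
  have 1: "norm (N T ** P - N T' ** P') \<le> (L * (2 * R * norm S) * d) * R + K * d"
    by (rule order_trans[OF norm_matrix_mult_diff_le], intro add_mono mult_mono)
      (use NT n d d0 R K_nonneg L_nonneg N_bound[OF TS(2)] in auto)
  have 2: "norm (Q ** N T - Q' ** N T') \<le> d * K + R * (L * (2 * R * norm S) * d)"
    by (rule order_trans[OF norm_matrix_mult_diff_le], intro add_mono mult_mono)
      (use NT n d d0 R K_nonneg L_nonneg N_bound[OF TS(1)] in auto)
  have "pair_field S PQ - pair_field S PQ' = (N T ** P - N T' ** P', - (Q ** N T - Q' ** N T'))"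
    by (simp add: pair_field_def eq T_def T'_def)
  then have "norm (pair_field S PQ - pair_field S PQ') \<le> norm (N T ** P - N T' ** P') + norm (Q ** N T - Q' ** N T')"
    using norm_Pair_le[of "N T ** P - N T' ** P'" "- (Q ** N T - Q' ** N T')"]
    by (simp only: norm_minus_cancel)
  also have "\<dots> \<le> 2 * (L * (2 * R * norm S) * R + K) * d"
    using 1 2 by (simp add: algebra_simps)
  finally show ?thesis by (simp add: d_def)
qed

text \<open>The second component \<open>Q\<close> is the inverse of \<open>P\<close>, since \<open>(QP)' = 0\<close>; so \<open>P S P\<^sup>T\<close> has the
  rank of \<open>S\<close>.\<close>

lemma solution_exists:
  assumes S: "S \<in> Sym_ge0"
  obtains \<gamma> where "\<gamma> 0 = S" "solves_ode_in F Sym_ge0 {0..} \<gamma>"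
    "\<And>t. 0 \<le> t \<Longrightarrow> \<exists>P Q. Q ** P = mat 1 \<and> \<gamma> t = P ** S ** transpose P"
proof -
  interpret linear_growth_field "pair_field S" K "(mat 1, mat 1)"
    by unfold_locales (use pair_field_lip[OF S] pair_field_growth[OF S] in blast)+
  obtain x where x0: "x 0 = (mat 1, mat 1)"
    and x: "\<And>t. 0 \<le> t \<Longrightarrow> (x has_vector_derivative pair_field S (x t)) (at t within {0..})"
    using global_solution by blast
  define P Q where "P t = fst (x t)" and "Q t = snd (x t)" for t
  define \<gamma> where "\<gamma> t = P t ** S ** transpose (P t)" for t
  have dP: "(P has_vector_derivative N (\<gamma> t) ** P t) (at t within {0..})"
    and dQ: "(Q has_vector_derivative - (Q t ** N (\<gamma> t))) (at t within {0..})" if "0 \<le> t" for t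
    using bounded_linear.has_vector_derivative[OF bounded_linear_fst x[OF that]]
      bounded_linear.has_vector_derivative[OF bounded_linear_snd x[OF that]]
    by (simp_all add: P_def[abs_def] Q_def[abs_def] \<gamma>_def pair_field_def)
  have "((\<lambda>t. Q t ** P t) has_vector_derivative 0) (at t within {0..})" if "0 \<le> t" for t
    using has_vector_derivative_matrix_mult[OF dQ[OF that] dP[OF that]]
    by (simp add: matrix_mul_assoc bounded_bilinear.minus_left[OF bounded_bilinear_matrix_mult])
  then obtain c where "\<And>t. t \<in> {0..} \<Longrightarrow> Q t ** P t = c"
    using has_vector_derivative_zero_constant[of "{0..}" "\<lambda>t. Q t ** P t"] by auto
  then have QP: "Q t ** P t = mat 1" if "0 \<le> t" for t
    using that x0 by (metis P_def Q_def atLeast_iff fst_conv matrix_mul_lid order_refl snd_conv)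
  have d\<gamma>: "(\<gamma> has_vector_derivative F (\<gamma> t)) (at t within {0..})" if "0 \<le> t" for t
  proof -
    have "((\<lambda>t. P t ** S) has_vector_derivative N (\<gamma> t) ** P t ** S) (at t within {0..})"
      using has_vector_derivative_matrix_mult[OF dP[OF that] has_vector_derivative_const[of S]] by simp
    from has_vector_derivative_matrix_mult[OF this
        bounded_linear.has_vector_derivative[OF bounded_linear_transpose dP[OF that]]]
    show ?thesis
      by (simp add: F_eq Sym_ge0_congruence S \<gamma>_def[abs_def] matrix_mul_assoc matrix_transpose_mul add.commute)
  qed
  show ?thesis
  proof (rule that[of \<gamma>])
    show "\<gamma> 0 = S" by (simp add: \<gamma>_def P_def x0)
    show "solves_ode_in F Sym_ge0 {0..} \<gamma>"
      using d\<gamma> by (auto simp: solves_ode_in_def) (simp add: \<gamma>_def Sym_ge0_congruence S)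
  qed (use QP \<gamma>_def in blast)
qed

lemma F_bound: "S \<in> Sym_ge0 \<Longrightarrow> norm (F S) \<le> 2 * K * norm S"
proof -
  assume S: "S \<in> Sym_ge0"
  have "norm (N S ** S) \<le> K * norm S" "norm (S ** transpose (N S)) \<le> norm S * K"
    by (rule order_trans[OF norm_matrix_mult_le],
        intro mult_right_mono mult_left_mono; simp add: norm_transpose N_bound S)+
  then show ?thesis
    using norm_triangle_ineq[of "N S ** S" "S ** transpose (N S)"] by (simp add: F_eq S algebra_simps)
qed

lemma F_lip:
  assumes "S \<in> Sym_ge0" "T \<in> Sym_ge0" "norm S \<le> R" "norm T \<le> R"
  shows "norm (F S - F T) \<le> 2 * (L * R + K) * norm (S - T)"
proof -
  define d where "d = norm (S - T)"
  have R: "0 \<le> R" using assms norm_ge_zero order_trans by blast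
  have d: "0 \<le> d" by (simp add: d_def)
  have NN: "norm (N S - N T) \<le> L * d" using N_lip assms by (simp add: d_def)
  have 1: "norm (N S ** S - N T ** T) \<le> (L * d) * R + K * d"
    by (rule order_trans[OF norm_matrix_mult_diff_le], intro add_mono mult_mono)
      (use NN assms d R L_nonneg K_nonneg N_bound in \<open>auto simp: d_def\<close>)
  have "norm (S ** transpose (N S) - T ** transpose (N T)) \<le> norm (S - T) * norm (transpose (N S)) + norm T * norm (transpose (N S) - transpose (N T))"
    by (rule norm_matrix_mult_diff_le)
  also have "transpose (N S) - transpose (N T) = transpose (N S - N T)"
    by (simp add: transpose_def vec_eq_iff)
  also have "norm (S - T) * norm (transpose (N S)) + norm T * norm (transpose (N S - N T)) \<le> d * K + R * (L * d)"
    by (intro add_mono mult_mono)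
      (use NN assms d R L_nonneg K_nonneg N_bound in \<open>auto simp: d_def norm_transpose\<close>)
  finally have 2: "norm (S ** transpose (N S) - T ** transpose (N T)) \<le> d * K + R * (L * d)" .
  have "F S - F T = (N S ** S - N T ** T) + (S ** transpose (N S) - T ** transpose (N T))"
    using assms by (simp add: F_eq)
  then have "norm (F S - F T) \<le> norm (N S ** S - N T ** T) + norm (S ** transpose (N S) - T ** transpose (N T))"
    by (metis norm_triangle_ineq)
  then show ?thesis using 1 2 unfolding d_def[symmetric] by (simp add: algebra_simps)
qed

section \<open>Stability, uniqueness and the resulting flow\<close>

lemma solution_bound:
  assumes "solves_ode_in F Sym_ge0 {0..T} \<gamma>" "t \<in> {0..T}"
  shows "norm (\<gamma> t) \<le> norm (\<gamma> 0) * exp (2 * K * t)"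
  by (rule norm_Gronwall[of T \<gamma> "\<lambda>s. F (\<gamma> s)"])
    (use assms F_bound in \<open>auto simp: solves_ode_in_def\<close>)

text \<open>Up to time \<open>T\<close> both solutions stay in the ball of radius
  \<open>R * exp (2 * K * T)\<close>, and \<open>F_lip\<close> on this ball feeds Gronwall. The
  estimate serves both uniqueness and continuity in the initial data.\<close>

lemma solution_stability:
  assumes \<gamma>: "solves_ode_in F Sym_ge0 {0..T} \<gamma>" and \<delta>: "solves_ode_in F Sym_ge0 {0..T} \<delta>"
    and R: "norm (\<gamma> 0) \<le> R" "norm (\<delta> 0) \<le> R" and t: "t \<in> {0..T}"
  shows "norm (\<gamma> t - \<delta> t) \<le> norm (\<gamma> 0 - \<delta> 0) * exp (2 * (L * (R * exp (2 * K * T)) + K) * t)"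
proof (rule norm_Gronwall[of T "\<lambda>t. \<gamma> t - \<delta> t" "\<lambda>s. F (\<gamma> s) - F (\<delta> s)"])
  fix s assume s: "s \<in> {0..T}"
  show "((\<lambda>t. \<gamma> t - \<delta> t) has_vector_derivative F (\<gamma> s) - F (\<delta> s)) (at s within {0..T})"
    using \<gamma> \<delta> s by (auto simp: solves_ode_in_def intro!: has_vector_derivative_diff)
  have "norm (\<eta> s) \<le> R * exp (2 * K * T)"
    if "solves_ode_in F Sym_ge0 {0..T} \<eta>" "norm (\<eta> 0) \<le> R" for \<eta>
  proof -
    have "norm (\<eta> s) \<le> norm (\<eta> 0) * exp (2 * K * s)" by (rule solution_bound[OF that(1) s])
    also have "\<dots> \<le> R * exp (2 * K * T)"
      using that(2) s K_nonneg order_trans[OF norm_ge_zero that(2)]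
      by (intro mult_mono) (auto simp: mult_left_mono)
    finally show ?thesis .
  qed
  then show "norm (F (\<gamma> s) - F (\<delta> s)) \<le> 2 * (L * (R * exp (2 * K * T)) + K) * norm (\<gamma> s - \<delta> s)"
    using \<gamma> \<delta> s R by (intro F_lip) (auto simp: solves_ode_in_def)
qed (rule t)

lemma solution_unique:
  assumes "solves_ode_in F Sym_ge0 {0..T} \<gamma>" "solves_ode_in F Sym_ge0 {0..T} \<delta>" "\<gamma> 0 = \<delta> 0"
    "t \<in> {0..T}"
  shows "\<gamma> t = \<delta> t"
  using solution_stability[OF assms(1,2) _ _ assms(4), of "norm (\<gamma> 0)"] assms(3) by simp

text \<open>A whole curve is chosen for each \<open>S\<close>, independently of the outer time. The
  congruence is part of the choice so that rank information is retained.\<close>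

definition flow_of :: "real \<Rightarrow> real ^ 'n ^ 'n \<Rightarrow> real ^ 'n ^ 'n" where
  "flow_of t S = (SOME \<gamma>. \<gamma> 0 = S \<and> solves_ode_in F Sym_ge0 {0..} \<gamma> \<and>
     (\<forall>t\<ge>0. \<exists>P Q. Q ** P = mat 1 \<and> \<gamma> t = P ** S ** transpose P)) t"

lemma flow_of:
  assumes "S \<in> Sym_ge0"
  shows "flow_of 0 S = S" "solves_ode_in F Sym_ge0 {0..} (\<lambda>t. flow_of t S)"
    "0 \<le> t \<Longrightarrow> \<exists>P Q. Q ** P = mat 1 \<and> flow_of t S = P ** S ** transpose P"
proof -
  have "\<exists>\<gamma>. \<gamma> 0 = S \<and> solves_ode_in F Sym_ge0 {0..} \<gamma> \<and>
     (\<forall>t\<ge>0. \<exists>P Q. Q ** P = mat 1 \<and> \<gamma> t = P ** S ** transpose P)"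
    using solution_exists[OF assms] by metis
  note * = someI_ex[OF this, folded flow_of_def]
  show "flow_of 0 S = S" "solves_ode_in F Sym_ge0 {0..} (\<lambda>t. flow_of t S)"
    using * unfolding flow_of_def by blast+
  show "\<exists>P Q. Q ** P = mat 1 \<and> flow_of t S = P ** S ** transpose P" if "0 \<le> t"
    using * that unfolding flow_of_def by blast
qed

lemma flow_of_mem: "S \<in> Sym_ge0 \<Longrightarrow> 0 \<le> t \<Longrightarrow> flow_of t S \<in> Sym_ge0"
  using flow_of(2) by (auto simp: solves_ode_in_def)

lemma rank_flow_of: "S \<in> Sym_ge0 \<Longrightarrow> 0 \<le> t \<Longrightarrow> rank (flow_of t S) = rank S"
  using flow_of(3) rank_congruence by metis

lemma flow_of_unique:
  assumes "solves_ode_in F Sym_ge0 {0..<T} \<gamma>" "t \<in> {0..<T}"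
  shows "\<gamma> t = flow_of t (\<gamma> 0)"
proof -
  have \<gamma>0: "\<gamma> 0 \<in> Sym_ge0" using assms by (auto simp: solves_ode_in_def)
  show ?thesis
  proof (rule solution_unique[of t \<gamma> "\<lambda>t. flow_of t (\<gamma> 0)" t])
    show "solves_ode_in F Sym_ge0 {0..t} \<gamma>"
      using assms by (auto intro: solves_ode_in_subset)
    show "solves_ode_in F Sym_ge0 {0..t} (\<lambda>t. flow_of t (\<gamma> 0))"
      using flow_of(2)[OF \<gamma>0] by (rule solves_ode_in_subset) auto
  qed (use flow_of(1)[OF \<gamma>0] assms in auto)
qed

lemma flow_of_add:
  assumes "S \<in> Sym_ge0" "0 \<le> s" "0 \<le> t"
  shows "flow_of (s + t) S = flow_of s (flow_of t S)"
proof -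
  \<comment> \<open>The half-open interval has to contain \<open>s\<close>.\<close>
  have "solves_ode_in F Sym_ge0 {0..<s + 1} (\<lambda>s. flow_of (s + t) S)"
    using solves_ode_in_shift[OF flow_of(2)[OF assms(1)] assms(3)] by (rule solves_ode_in_subset) auto
  from flow_of_unique[OF this, of s] show ?thesis using assms by simp
qed

text \<open>Formulated for invariant subsets so that one flow serves the closed cone and
  \<open>Sym_pos\<close>; solutions in the subset inherit uniqueness from the cone.\<close>

lemma global_flow_of:
  assumes A: "A \<subseteq> Sym_ge0" and inv: "\<And>S t. S \<in> A \<Longrightarrow> 0 \<le> t \<Longrightarrow> flow_of t S \<in> A"
  shows "global_flow F A flow_of"
  unfolding global_flow_def
proof (intro conjI ballI allI impI)
  fix S assume "S \<in> A"
  then show "flow_of 0 S = S" "solves_ode_in F A {0..} (\<lambda>t. flow_of t S)"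
    using flow_of(1,2)[of S] inv A by (auto simp: solves_ode_in_def)
next
  fix T \<gamma> t assume "solves_ode_in F A {0..<T} \<gamma>" "t \<in> {0..<T}"
  then show "\<gamma> t = flow_of t (\<gamma> 0)"
    using A by (intro flow_of_unique) (auto simp: solves_ode_in_def)
qed (use flow_of_add A in auto)

text \<open>Compare first at equal times, then along the trajectory of \<open>S0\<close>. The factor
  \<open>B\<close> is the stability constant for radius \<open>norm S0 + 1\<close> and horizon
  \<open>t0 + 1\<close>, hence uniform near \<open>(t0, S0)\<close>.\<close>

lemma continuous_flow_of: "continuous_on ({0..} \<times> Sym_ge0) (\<lambda>(t, S). flow_of t S)"
  unfolding continuous_on_def
proof safe
  fix t0 :: real and S0 :: "real ^ 'n ^ 'n" assume t0: "0 \<le> t0" and S0: "S0 \<in> Sym_ge0"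
  define F0 where "F0 = at (t0, S0) within {0..} \<times> Sym_ge0"
  define B where "B = exp (2 * (L * ((norm S0 + 1) * exp (2 * K * (t0 + 1))) + K) * (t0 + 1))"
  have fst: "(fst \<longlongrightarrow> t0) F0" and snd: "(snd \<longlongrightarrow> S0) F0"
    unfolding F0_def by (auto intro!: tendsto_eq_intros)
  have "continuous_on {0..} (\<lambda>t. flow_of t S0)"
    using flow_of(2)[OF S0] unfolding solves_ode_in_def
    by (meson continuous_on_eq_continuous_within has_vector_derivative_continuous)
  have "((\<lambda>x. flow_of (fst x) S0) \<longlongrightarrow> flow_of t0 S0) F0"
    by (rule continuous_on_tendsto_compose[OF \<open>continuous_on {0..} (\<lambda>t. flow_of t S0)\<close> fst])
      (use t0 in \<open>auto simp: F0_def eventually_at_filter intro!: always_eventually\<close>)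
  then have "((\<lambda>x. B * norm (snd x - S0) + norm (flow_of (fst x) S0 - flow_of t0 S0)) \<longlongrightarrow> B * norm (S0 - S0) + norm (flow_of t0 S0 - flow_of t0 S0)) F0"
    by (intro tendsto_intros snd)
  then have 0: "((\<lambda>x. B * norm (snd x - S0) + norm (flow_of (fst x) S0 - flow_of t0 S0)) \<longlongrightarrow> 0) F0" by simp
  have ev: "eventually (\<lambda>x. x \<in> {0..} \<times> Sym_ge0 \<and> dist (fst x) t0 < 1 \<and> dist (snd x) S0 < 1) F0"
    using tendstoD[OF fst, of 1] tendstoD[OF snd, of 1]
    by (intro eventually_conj) (auto simp: F0_def eventually_at_filter)
  have "eventually (\<lambda>x. norm (flow_of (fst x) (snd x) - flow_of t0 S0)
      \<le> B * norm (snd x - S0) + norm (flow_of (fst x) S0 - flow_of t0 S0)) F0"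
  proof (rule eventually_mono[OF ev])
    fix x :: "real \<times> (real ^ 'n ^ 'n)"
    assume a: "x \<in> {0..} \<times> Sym_ge0 \<and> dist (fst x) t0 < 1 \<and> dist (snd x) S0 < 1"
    obtain t S where x: "x = (t, S)" by (cases x)
    have t: "0 \<le> t" "t \<le> t0 + 1" and S: "S \<in> Sym_ge0" "norm S \<le> norm S0 + 1"
      using a norm_triangle_sub[of S S0] by (auto simp: x dist_norm)
    have "norm (flow_of t S - flow_of t S0) \<le> norm (flow_of 0 S - flow_of 0 S0)
        * exp (2 * (L * ((norm S0 + 1) * exp (2 * K * (t0 + 1))) + K) * t)"
      by (rule solution_stability[where T = "t0 + 1"])
        (use t S S0 in \<open>auto simp: flow_of(1) intro: solves_ode_in_subset[OF flow_of(2)]\<close>)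
    also have "\<dots> \<le> norm (S - S0) * B"
      unfolding B_def using t S S0 K_nonneg L_nonneg by (auto simp: flow_of(1) intro!: mult_left_mono)
    finally show "norm (flow_of (fst x) (snd x) - flow_of t0 S0)
      \<le> B * norm (snd x - S0) + norm (flow_of (fst x) S0 - flow_of t0 S0)"
      using norm_triangle_ineq[of "flow_of t S - flow_of t S0" "flow_of t S0 - flow_of t0 S0"]
      by (simp add: x mult.commute)
  qed
  then have "((\<lambda>x. flow_of (fst x) (snd x) - flow_of t0 S0) \<longlongrightarrow> 0) F0"
    using 0 by (rule Lim_null_comparison)
  then have "((\<lambda>x. flow_of (fst x) (snd x)) \<longlongrightarrow> flow_of t0 S0) F0"
    by (simp add: LIM_zero_iff)
  then show "((\<lambda>(t, S). flow_of t S) \<longlongrightarrow> flow_of t0 S0) (at (t0, S0) within {0..} \<times> Sym_ge0)"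
    by (simp add: F0_def split_beta')
qed

theorem flow_exists:
  "\<exists>\<phi>. global_flow F Sym_ge0 \<phi> \<and> global_flow F Sym_pos \<phi> \<and>
     continuous_on ({0..} \<times> Sym_ge0) (\<lambda>(t, S). \<phi> t S) \<and>
     (\<forall>l\<in>{0..CARD('n) - 1}. \<forall>S\<in>stratum l. \<forall>t\<ge>0. \<phi> t S \<in> stratum l)"
proof (intro exI[of _ flow_of] conjI ballI allI impI)
  have inv: "flow_of t S \<in> {S. pos_semidef S \<and> rank S = l}"
    if "S \<in> {S. pos_semidef S \<and> rank S = l}" "0 \<le> t" for S t l
    using that flow_of_mem[of S t] rank_flow_of[of S t] by (auto simp: Sym_ge0_eq)
  show "global_flow F Sym_ge0 flow_of" by (rule global_flow_of) (auto simp: flow_of_mem)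
  show "global_flow F Sym_pos flow_of"
    using inv by (intro global_flow_of Sym_pos_subset_Sym_ge0) (simp only: Sym_pos_eq)
  show "flow_of t S \<in> stratum l" if "S \<in> stratum l" "0 \<le> t" for l S t
    using inv that unfolding stratum_def by blast
qed (rule continuous_flow_of)

end

section \<open>Square integrable functions and integral operators\<close>

lemma norm_integral_le:
  fixes f :: "'a \<Rightarrow> 'b::euclidean_space"
  assumes "integrable M f" "integrable M g" "\<And>x. x \<in> space M \<Longrightarrow> norm (f x) \<le> g x"
  shows "norm (\<integral>x. f x \<partial>M) \<le> (\<integral>x. g x \<partial>M)"
  by (rule order_trans[OF integral_norm_bound integral_mono]) (use assms in auto)

text \<open>Functions rather than classes modulo null sets: the estimates need only the seminorm
  \<open>norm2\<close>, as no limit in \<open>L^2\<close> is taken.\<close>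

definition sq_int :: "'a measure \<Rightarrow> ('a \<Rightarrow> 'b::euclidean_space) \<Rightarrow> bool" where
  "sq_int M f \<longleftrightarrow> f \<in> borel_measurable M \<and> integrable M (\<lambda>x. (norm (f x))\<^sup>2)"

definition norm2 :: "'a measure \<Rightarrow> ('a \<Rightarrow> 'b::euclidean_space) \<Rightarrow> real" where
  "norm2 M f = sqrt (\<integral>x. (norm (f x))\<^sup>2 \<partial>M)"

lemma sq_int_measurable[measurable_dest]: "sq_int M f \<Longrightarrow> f \<in> borel_measurable M"
  by (simp add: sq_int_def)

lemma norm2_nonneg[simp]: "0 \<le> norm2 M f"
  by (simp add: norm2_def)

lemma norm2_sq: "(norm2 M f)\<^sup>2 = (\<integral>x. (norm (f x))\<^sup>2 \<partial>M)"
  by (simp add: norm2_def)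

lemma integrable_norm_mult:
  assumes f: "sq_int M f" and g: "sq_int M g"
  shows "integrable M (\<lambda>x. norm (f x) * norm (g x))"
proof (rule Bochner_Integration.integrable_bound)
  show "integrable M (\<lambda>x. (norm (f x))\<^sup>2 + (norm (g x))\<^sup>2)"
    using f g by (simp add: sq_int_def)
  show "(\<lambda>x. norm (f x) * norm (g x)) \<in> borel_measurable M"
    using f g by measurable
  have "a * b \<le> a\<^sup>2 + b\<^sup>2" if "0 \<le> a" "0 \<le> b" for a b :: real
    using sum_squares_bound[of a b] mult_nonneg_nonneg[OF that] by linarith
  then show "AE x in M. norm (norm (f x) * norm (g x)) \<le> norm ((norm (f x))\<^sup>2 + (norm (g x))\<^sup>2)"
    by simp
qed

text \<open>Discriminant of the nonnegative quadratic polynomial that maps \<open>t\<close> to the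
  integral of \<open>(norm f + t * norm g)^2\<close>.\<close>

lemma norm2_Cauchy_Schwarz:
  assumes f: "sq_int M f" and g: "sq_int M g"
  shows "(\<integral>x. norm (f x) * norm (g x) \<partial>M) \<le> norm2 M f * norm2 M g"
proof -
  let ?b = "\<integral>x. norm (f x) * norm (g x) \<partial>M"
  have "?b\<^sup>2 \<le> (norm2 M f)\<^sup>2 * (norm2 M g)\<^sup>2"
  proof (rule quadratic_nonneg_imp_discriminant_le)
    fix t :: real
    have "0 \<le> (\<integral>x. (norm (f x) + t * norm (g x))\<^sup>2 \<partial>M)" by simp
    also have "\<dots> = (\<integral>x. (norm (f x))\<^sup>2 + 2 * t * (norm (f x) * norm (g x)) + t\<^sup>2 * (norm (g x))\<^sup>2 \<partial>M)"
      by (simp add: power2_sum power_mult_distrib mult_ac add_ac)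
    also have "\<dots> = (norm2 M f)\<^sup>2 + 2 * ?b * t + (norm2 M g)\<^sup>2 * t\<^sup>2"
      using f g integrable_norm_mult[OF f g] by (simp add: norm2_sq sq_int_def)
    finally show "0 \<le> (norm2 M f)\<^sup>2 + 2 * ?b * t + (norm2 M g)\<^sup>2 * t\<^sup>2" .
  qed simp
  then have "?b\<^sup>2 \<le> (norm2 M f * norm2 M g)\<^sup>2" by (simp add: power_mult_distrib)
  then show ?thesis by (rule power2_le_imp_le) simp
qed

lemma integrable_inner_sq_int:
  assumes f: "sq_int M f" and g: "sq_int M g"
  shows "integrable M (\<lambda>x. f x \<bullet> g x)"
  by (rule Bochner_Integration.integrable_bound[OF integrable_norm_mult[OF f g]])
    (use f g in \<open>auto simp: Cauchy_Schwarz_ineq2\<close>)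

lemma integral_inner_le:
  assumes f: "sq_int M f" and g: "sq_int M g"
  shows "\<bar>\<integral>x. f x \<bullet> g x \<partial>M\<bar> \<le> norm2 M f * norm2 M g"
proof -
  have "\<bar>\<integral>x. f x \<bullet> g x \<partial>M\<bar> \<le> (\<integral>x. norm (f x) * norm (g x) \<partial>M)"
    using norm_integral_le[OF integrable_inner_sq_int[OF f g] integrable_norm_mult[OF f g]]
    by (simp add: Cauchy_Schwarz_ineq2)
  also note norm2_Cauchy_Schwarz[OF f g]
  finally show ?thesis .
qed

lemma sq_int_scaleR: "sq_int M f \<Longrightarrow> sq_int M (\<lambda>x. c *\<^sub>R f x)"
  by (auto simp: sq_int_def power_mult_distrib)

lemma norm2_scaleR: "norm2 M (\<lambda>x. c *\<^sub>R f x) = \<bar>c\<bar> * norm2 M f"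
  by (simp add: norm2_def power_mult_distrib real_sqrt_mult)

lemma integral_norm_add_sq:
  assumes f: "sq_int M f" and g: "sq_int M g"
  shows "sq_int M (\<lambda>x. f x + g x)"
    and "(norm2 M (\<lambda>x. f x + g x))\<^sup>2 = (norm2 M f)\<^sup>2 + 2 * (\<integral>x. f x \<bullet> g x \<partial>M) + (norm2 M g)\<^sup>2"
proof -
  have eq: "(norm (f x + g x))\<^sup>2 = (norm (f x))\<^sup>2 + 2 * (f x \<bullet> g x) + (norm (g x))\<^sup>2" for x
    by (simp add: power2_norm_eq_inner inner_add_left inner_add_right inner_commute)
  show "sq_int M (\<lambda>x. f x + g x)"
    using f g integrable_inner_sq_int[OF f g] unfolding sq_int_def eq by auto
  show "(norm2 M (\<lambda>x. f x + g x))\<^sup>2 = (norm2 M f)\<^sup>2 + 2 * (\<integral>x. f x \<bullet> g x \<partial>M) + (norm2 M g)\<^sup>2"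
    using f g integrable_inner_sq_int[OF f g] unfolding norm2_sq eq by (simp add: sq_int_def)
qed

lemmas sq_int_add = integral_norm_add_sq(1)

lemma sq_int_diff: "sq_int M f \<Longrightarrow> sq_int M g \<Longrightarrow> sq_int M (\<lambda>x. f x - g x)"
  using sq_int_add[of M f "\<lambda>x. (-1) *\<^sub>R g x"] sq_int_scaleR[of M g "-1"] by simp

lemma norm2_triangle:
  assumes f: "sq_int M f" and g: "sq_int M g"
  shows "norm2 M (\<lambda>x. f x + g x) \<le> norm2 M f + norm2 M g"
proof -
  have "(norm2 M (\<lambda>x. f x + g x))\<^sup>2 \<le> (norm2 M f + norm2 M g)\<^sup>2"
    using integral_norm_add_sq(2)[OF f g] integral_inner_le[OF f g] by (simp add: power2_sum)
  then show ?thesis by (rule power2_le_imp_le) simp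
qed

lemma norm2_triangle_diff:
  assumes f: "sq_int M f" and g: "sq_int M g"
  shows "norm2 M (\<lambda>x. f x - g x) \<le> norm2 M f + norm2 M g"
  using norm2_triangle[OF f sq_int_scaleR[OF g, of "-1"]] norm2_scaleR[of M "-1" g] by simp

lemma norm2_mono:
  assumes "sq_int M g" "f \<in> borel_measurable M" "\<And>x. x \<in> space M \<Longrightarrow> norm (f x) \<le> norm (g x)"
  shows "sq_int M f" "norm2 M f \<le> norm2 M g"
proof -
  have le: "(norm (f x))\<^sup>2 \<le> (norm (g x))\<^sup>2" if "x \<in> space M" for x
    using assms(3)[OF that] by (rule power_mono) simp
  have g: "integrable M (\<lambda>x. (norm (g x))\<^sup>2)" using assms(1) by (simp add: sq_int_def)
  note [measurable] = assms(2)
  have f: "integrable M (\<lambda>x. (norm (f x))\<^sup>2)"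
    by (rule Bochner_Integration.integrable_bound[OF g]) (use le in \<open>auto intro!: AE_I2\<close>)
  then show "sq_int M f" using assms(2) by (simp add: sq_int_def)
  show "norm2 M f \<le> norm2 M g"
    unfolding norm2_def by (intro real_sqrt_le_mono integral_mono f g le)
qed

lemma integrable_sq_int:
  assumes "finite_measure M" "sq_int M f"
  shows "integrable M f"
proof -
  interpret finite_measure M by fact
  have "sq_int M (\<lambda>_. 1 :: real)" by (simp add: sq_int_def)
  from integrable_norm_mult[OF assms(2) this] show ?thesis
    using assms(2) by (simp add: integrable_norm_iff)
qed

lemma (in pair_sigma_finite) integrable_tensor:
  fixes f g :: "_ \<Rightarrow> real"
  assumes f: "integrable M1 f" and g: "integrable M2 g"
  shows "integrable (M1 \<Otimes>\<^sub>M M2) (\<lambda>p. f (fst p) * g (snd p))"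
    and "(\<integral>p. f (fst p) * g (snd p) \<partial>(M1 \<Otimes>\<^sub>M M2)) = (\<integral>x. f x \<partial>M1) * (\<integral>y. g y \<partial>M2)"
proof -
  show *: "integrable (M1 \<Otimes>\<^sub>M M2) (\<lambda>p. f (fst p) * g (snd p))"
    by (rule Fubini_integrable) (use f g in \<open>auto simp: abs_mult\<close>)
  show "(\<integral>p. f (fst p) * g (snd p) \<partial>(M1 \<Otimes>\<^sub>M M2)) = (\<integral>x. f x \<partial>M1) * (\<integral>y. g y \<partial>M2)"
    using integral_fst'[OF *] by simp
qed

section \<open>Bilinear forms and integral operators of kernels\<close>

context prob_space
begin

interpretation MM: pair_prob_space M M ..

lemma tensor_norm2:
  fixes r s :: "'a \<Rightarrow> 'b::euclidean_space"
  assumes r: "sq_int M r" and s: "sq_int M s"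
  shows "sq_int (M \<Otimes>\<^sub>M M) (\<lambda>p. norm (r (fst p)) * norm (s (snd p)))"
    and "norm2 (M \<Otimes>\<^sub>M M) (\<lambda>p. norm (r (fst p)) * norm (s (snd p))) = norm2 M r * norm2 M s"
  using MM.integrable_tensor[of "\<lambda>x. (norm (r x))\<^sup>2" "\<lambda>x. (norm (s x))\<^sup>2"] r s
  by (auto simp: sq_int_def norm2_def power_mult_distrib real_sqrt_mult)

text \<open>The kernel may be vector valued, so that the same estimates apply to the real kernel and
  to its matrix valued derivative.\<close>

definition kernel_form :: "('a \<times> 'a \<Rightarrow> 'c::euclidean_space) \<Rightarrow> ('a \<Rightarrow> 'b::euclidean_space) \<Rightarrow> ('a \<Rightarrow> 'b) \<Rightarrow> 'c" where
  "kernel_form \<kappa> r s = (\<integral>p. (r (fst p) \<bullet> s (snd p)) *\<^sub>R \<kappa> p \<partial>(M \<Otimes>\<^sub>M M))"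

lemma kernel_form_integrable:
  fixes r s :: "'a \<Rightarrow> 'b::euclidean_space"
  assumes \<kappa>: "sq_int (M \<Otimes>\<^sub>M M) \<kappa>" and r: "sq_int M r" and s: "sq_int M s"
  shows "integrable (M \<Otimes>\<^sub>M M) (\<lambda>p. (r (fst p) \<bullet> s (snd p)) *\<^sub>R \<kappa> p)"
proof (rule Bochner_Integration.integrable_bound[OF integrable_norm_mult[OF tensor_norm2(1)[OF r s] \<kappa>]])
  note [measurable] = assms[THEN sq_int_measurable]
  show "(\<lambda>p. (r (fst p) \<bullet> s (snd p)) *\<^sub>R \<kappa> p) \<in> borel_measurable (M \<Otimes>\<^sub>M M)"
    by measurable
qed (auto intro!: mult_right_mono simp: Cauchy_Schwarz_ineq2)

lemma norm_kernel_form_le: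
  fixes r s :: "'a \<Rightarrow> 'b::euclidean_space"
  assumes \<kappa>: "sq_int (M \<Otimes>\<^sub>M M) \<kappa>" and r: "sq_int M r" and s: "sq_int M s"
  shows "norm (kernel_form \<kappa> r s) \<le> norm2 (M \<Otimes>\<^sub>M M) \<kappa> * (norm2 M r * norm2 M s)"
proof -
  have "norm (kernel_form \<kappa> r s) \<le> (\<integral>p. norm (norm (r (fst p)) * norm (s (snd p))) * norm (\<kappa> p) \<partial>(M \<Otimes>\<^sub>M M))"
    unfolding kernel_form_def
    by (rule norm_integral_le[OF kernel_form_integrable[OF assms]
          integrable_norm_mult[OF tensor_norm2(1)[OF r s] \<kappa>]])
      (auto intro!: mult_right_mono simp: Cauchy_Schwarz_ineq2)
  also have "\<dots> \<le> (norm2 M r * norm2 M s) * norm2 (M \<Otimes>\<^sub>M M) \<kappa>"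
    using norm2_Cauchy_Schwarz[OF tensor_norm2(1)[OF r s] \<kappa>] by (simp add: tensor_norm2(2)[OF r s])
  finally show ?thesis by (simp add: mult.commute)
qed

lemma kernel_form_diff:
  fixes r s t :: "'a \<Rightarrow> 'b::euclidean_space"
  assumes "sq_int (M \<Otimes>\<^sub>M M) \<kappa>" "sq_int M r" "sq_int M s" "sq_int M t"
  shows "kernel_form \<kappa> (\<lambda>w. r w - s w) t = kernel_form \<kappa> r t - kernel_form \<kappa> s t"
    and "kernel_form \<kappa> t (\<lambda>w. r w - s w) = kernel_form \<kappa> t r - kernel_form \<kappa> t s"
  using Bochner_Integration.integral_diff[OF kernel_form_integrable[OF assms(1,2,4)]
      kernel_form_integrable[OF assms(1,3,4)]]
    Bochner_Integration.integral_diff[OF kernel_form_integrable[OF assms(1,4,2)]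
      kernel_form_integrable[OF assms(1,4,3)]]
  by (simp_all add: kernel_form_def inner_diff_left inner_diff_right scaleR_left_diff_distrib)

lemma kernel_form_diff_kernel:
  fixes r s :: "'a \<Rightarrow> 'b::euclidean_space"
  assumes "sq_int (M \<Otimes>\<^sub>M M) \<kappa>" "sq_int (M \<Otimes>\<^sub>M M) \<kappa>'" "sq_int M r" "sq_int M s"
  shows "kernel_form (\<lambda>p. \<kappa> p - \<kappa>' p) r s = kernel_form \<kappa> r s - kernel_form \<kappa>' r s"
  using kernel_form_integrable[OF assms(1,3,4)] kernel_form_integrable[OF assms(2,3,4)]
  by (simp add: kernel_form_def scaleR_right_diff_distrib)

text \<open>Separates the effect of changing the kernel from that of changing the function; the
  Lipschitz bound for the gradient has these two sources.\<close>

lemma kernel_form_quadratic_diff_le: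
  fixes r s :: "'a \<Rightarrow> 'b::euclidean_space"
  assumes \<kappa>: "sq_int (M \<Otimes>\<^sub>M M) \<kappa>" "sq_int (M \<Otimes>\<^sub>M M) \<kappa>'" and r: "sq_int M r" and s: "sq_int M s"
  shows "norm (kernel_form \<kappa> r r - kernel_form \<kappa>' s s)
    \<le> norm2 (M \<Otimes>\<^sub>M M) (\<lambda>p. \<kappa> p - \<kappa>' p) * (norm2 M r)\<^sup>2
      + norm2 (M \<Otimes>\<^sub>M M) \<kappa>' * ((norm2 M r + norm2 M s) * norm2 M (\<lambda>w. r w - s w))"
proof -
  let ?d = "\<lambda>w. r w - s w"
  have d: "sq_int M ?d" by (rule sq_int_diff[OF r s])
  have "kernel_form \<kappa> r r - kernel_form \<kappa>' s s
      = kernel_form (\<lambda>p. \<kappa> p - \<kappa>' p) r r + (kernel_form \<kappa>' ?d r + kernel_form \<kappa>' s ?d)"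
    using kernel_form_diff_kernel[OF \<kappa> r r] kernel_form_diff(1)[OF \<kappa>(2) r s r]
      kernel_form_diff(2)[OF \<kappa>(2) r s s] by simp
  also have "norm \<dots> \<le> norm (kernel_form (\<lambda>p. \<kappa> p - \<kappa>' p) r r)
      + (norm (kernel_form \<kappa>' ?d r) + norm (kernel_form \<kappa>' s ?d))"
    by (rule order_trans[OF norm_triangle_ineq add_left_mono[OF norm_triangle_ineq]])
  also have "\<dots> \<le> norm2 (M \<Otimes>\<^sub>M M) (\<lambda>p. \<kappa> p - \<kappa>' p) * (norm2 M r * norm2 M r)
      + (norm2 (M \<Otimes>\<^sub>M M) \<kappa>' * (norm2 M ?d * norm2 M r) + norm2 (M \<Otimes>\<^sub>M M) \<kappa>' * (norm2 M s * norm2 M ?d))"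
    by (intro add_mono norm_kernel_form_le \<kappa> r s d sq_int_diff[OF \<kappa>])
  also have "\<dots> = norm2 (M \<Otimes>\<^sub>M M) (\<lambda>p. \<kappa> p - \<kappa>' p) * (norm2 M r)\<^sup>2
      + norm2 (M \<Otimes>\<^sub>M M) \<kappa>' * ((norm2 M r + norm2 M s) * norm2 M ?d)"
    by (simp add: power2_eq_square distrib_left distrib_right mult.commute[of "norm2 M ?d"])
  finally show ?thesis .
qed

definition kernel_op :: "('a \<times> 'a \<Rightarrow> real) \<Rightarrow> ('a \<Rightarrow> 'b::euclidean_space) \<Rightarrow> 'a \<Rightarrow> 'b" where
  "kernel_op \<kappa> r w = (\<integral>v. \<kappa> (w, v) *\<^sub>R r v \<partial>M)"

text \<open>With \<open>c = 1 / lam\<close>, the equation \<open>shifted_op \<kappa> c r = Y\<close>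
  is the Euler equation of the dual problem.\<close>

definition shifted_op :: "('a \<times> 'a \<Rightarrow> real) \<Rightarrow> real \<Rightarrow> ('a \<Rightarrow> 'b::euclidean_space) \<Rightarrow> 'a \<Rightarrow> 'b" where
  "shifted_op \<kappa> c r w = r w + c *\<^sub>R kernel_op \<kappa> r w"

lemma norm2_const: "norm2 M (\<lambda>_. c) = norm c"
  by (simp add: norm2_def prob_space)

lemma sq_int_const: "sq_int M (\<lambda>_. c)"
  by (simp add: sq_int_def)

lemma norm2_cong: "(\<And>w. w \<in> space M \<Longrightarrow> f w = g w) \<Longrightarrow> norm2 M f = norm2 M g"
  unfolding norm2_def by (intro arg_cong[where f = sqrt] Bochner_Integration.integral_cong) auto

context
  fixes \<kappa> :: "'a \<times> 'a \<Rightarrow> real"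
  assumes \<kappa>_meas[measurable]: "\<kappa> \<in> borel_measurable (M \<Otimes>\<^sub>M M)" and \<kappa>_le: "\<And>p. \<bar>\<kappa> p\<bar> \<le> 1"
begin

lemma sq_int_bounded_kernel: "sq_int (M \<Otimes>\<^sub>M M) \<kappa>"
  unfolding sq_int_def
  by (intro conjI \<kappa>_meas MM.P.integrable_const_bound[where B = 1])
    (auto simp: \<kappa>_le abs_square_le_1)

lemma kernel_op_integrable:
  assumes w: "w \<in> space M" and r: "sq_int M r"
  shows "integrable M (\<lambda>v. \<kappa> (w, v) *\<^sub>R r v)"
proof (rule Bochner_Integration.integrable_bound)
  show "integrable M r" using r finite_measure_axioms by (intro integrable_sq_int)
  show "(\<lambda>v. \<kappa> (w, v) *\<^sub>R r v) \<in> borel_measurable M"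
    using w r by measurable
  show "AE v in M. norm (\<kappa> (w, v) *\<^sub>R r v) \<le> norm (r v)"
    using mult_right_mono[OF \<kappa>_le] by (auto simp: mult_left_le_one_le)
qed

lemma norm_kernel_op_le:
  assumes w: "w \<in> space M" and r: "sq_int M r"
  shows "norm (kernel_op \<kappa> r w) \<le> norm2 M r"
proof -
  have one: "sq_int M (\<lambda>_. 1 :: real)" by (rule sq_int_const)
  have "norm (kernel_op \<kappa> r w) \<le> (\<integral>v. norm (r v) * norm (1 :: real) \<partial>M)"
    unfolding kernel_op_def
    by (rule norm_integral_le[OF kernel_op_integrable[OF w r] integrable_norm_mult[OF r one]])
      (auto simp: mult_left_le_one_le \<kappa>_le)
  also have "\<dots> \<le> norm2 M r * norm2 M (\<lambda>_. 1 :: real)"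
    by (rule norm2_Cauchy_Schwarz[OF r one])
  finally show ?thesis by (simp add: norm2_const)
qed

lemma kernel_op_sq_int:
  assumes r: "sq_int M r"
  shows "sq_int M (kernel_op \<kappa> r)" "norm2 M (kernel_op \<kappa> r) \<le> norm2 M r"
proof -
  note [measurable] = sq_int_measurable[OF r]
  have m: "kernel_op \<kappa> r \<in> borel_measurable M"
    unfolding kernel_op_def by measurable
  have "sq_int M (kernel_op \<kappa> r) \<and> norm2 M (kernel_op \<kappa> r) \<le> norm2 M (\<lambda>_. norm2 M r)"
    using norm_kernel_op_le[OF _ r] norm2_mono[OF sq_int_const[of "norm2 M r"] m] by auto
  then show "sq_int M (kernel_op \<kappa> r)" "norm2 M (kernel_op \<kappa> r) \<le> norm2 M r"
    by (auto simp: norm2_const)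
qed

lemma integral_inner_kernel_op:
  assumes r: "sq_int M r" and s: "sq_int M s"
  shows "(\<integral>w. s w \<bullet> kernel_op \<kappa> r w \<partial>M) = kernel_form \<kappa> s r"
proof -
  have "kernel_form \<kappa> s r = (\<integral>w. \<integral>v. (s w \<bullet> r v) *\<^sub>R \<kappa> (w, v) \<partial>M \<partial>M)"
    using MM.integral_fst'[OF kernel_form_integrable[OF sq_int_bounded_kernel s r]]
    by (simp add: kernel_form_def)
  also have "\<dots> = (\<integral>w. s w \<bullet> kernel_op \<kappa> r w \<partial>M)"
  proof (rule Bochner_Integration.integral_cong[OF refl])
    fix w assume w: "w \<in> space M"
    show "(\<integral>v. (s w \<bullet> r v) *\<^sub>R \<kappa> (w, v) \<partial>M) = s w \<bullet> kernel_op \<kappa> r w"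
      unfolding kernel_op_def integral_inner_right[OF kernel_op_integrable[OF w r], symmetric]
      by (simp add: mult.commute)
  qed
  finally show ?thesis by simp
qed

lemma kernel_op_add_scaleR:
  assumes "w \<in> space M" "sq_int M r" "sq_int M s"
  shows "kernel_op \<kappa> (\<lambda>w. r w + c *\<^sub>R s w) w = kernel_op \<kappa> r w + c *\<^sub>R kernel_op \<kappa> s w"
proof -
  have "kernel_op \<kappa> (\<lambda>w. r w + c *\<^sub>R s w) w
      = (\<integral>v. \<kappa> (w, v) *\<^sub>R r v + c *\<^sub>R (\<kappa> (w, v) *\<^sub>R s v) \<partial>M)"
    by (simp add: kernel_op_def scaleR_add_right mult.commute)
  also have "\<dots> = kernel_op \<kappa> r w + c *\<^sub>R kernel_op \<kappa> s w"
    using kernel_op_integrable[OF assms(1,2)] kernel_op_integrable[OF assms(1,3)]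
    by (simp add: kernel_op_def del: scaleR_scaleR)
  finally show ?thesis .
qed

lemma shifted_op_sq_int:
  assumes "sq_int M r" "0 \<le> c"
  shows "sq_int M (shifted_op \<kappa> c r)" "norm2 M (shifted_op \<kappa> c r) \<le> (1 + c) * norm2 M r"
proof -
  show "sq_int M (shifted_op \<kappa> c r)"
    unfolding shifted_op_def by (intro sq_int_add sq_int_scaleR kernel_op_sq_int assms)
  have "norm2 M (shifted_op \<kappa> c r) \<le> norm2 M r + \<bar>c\<bar> * norm2 M (kernel_op \<kappa> r)"
    unfolding shifted_op_def norm2_scaleR[symmetric]
    by (intro norm2_triangle sq_int_scaleR kernel_op_sq_int assms)
  also have "\<dots> \<le> norm2 M r + c * norm2 M r"
    using kernel_op_sq_int(2)[OF assms(1)] assms(2) by (simp add: mult_left_mono)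
  finally show "norm2 M (shifted_op \<kappa> c r) \<le> (1 + c) * norm2 M r" by (simp add: algebra_simps)
qed

lemma integral_inner_shifted_op:
  assumes "sq_int M r" "sq_int M s"
  shows "(\<integral>w. s w \<bullet> shifted_op \<kappa> c r w \<partial>M) = (\<integral>w. s w \<bullet> r w \<partial>M) + c * kernel_form \<kappa> s r"
  unfolding shifted_op_def integral_inner_kernel_op[OF assms, symmetric]
  using integrable_inner_sq_int[OF assms(2,1)] integrable_inner_sq_int[OF assms(2) kernel_op_sq_int(1)[OF assms(1)]]
  by (simp add: inner_add_right)

context
  fixes c :: real
  assumes pos: "\<And>r :: 'a \<Rightarrow> 'b::euclidean_space. sq_int M r \<Longrightarrow> 0 \<le> kernel_form \<kappa> r r" and c: "0 \<le> c"
begin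

text \<open>The identity alone gives the lower bound, as the kernel part contributes a nonnegative
  amount. The constant 1 is therefore uniform in the kernel.\<close>

lemma shifted_op_coercive:
  fixes r :: "'a \<Rightarrow> 'b"
  assumes r: "sq_int M r"
  shows "(norm2 M r)\<^sup>2 \<le> (\<integral>w. r w \<bullet> shifted_op \<kappa> c r w \<partial>M)" "norm2 M r \<le> norm2 M (shifted_op \<kappa> c r)"
proof -
  show *: "(norm2 M r)\<^sup>2 \<le> (\<integral>w. r w \<bullet> shifted_op \<kappa> c r w \<partial>M)"
    using pos[OF r] c by (simp add: integral_inner_shifted_op[OF r r] norm2_sq power2_norm_eq_inner)
  have "(norm2 M r)\<^sup>2 \<le> norm2 M r * norm2 M (shifted_op \<kappa> c r)"
    using * integral_inner_le[OF r shifted_op_sq_int(1)[OF r c]] by linarith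
  then show "norm2 M r \<le> norm2 M (shifted_op \<kappa> c r)"
    by (cases "norm2 M r = 0") (auto simp: power2_eq_square less_le)
qed

text \<open>Richardson iteration with step \<open>1 / (1 + c)\<^sup>2\<close>: it produces approximate solutions without
  appealing to the completeness of \<open>L\<^sup>2\<close>.\<close>

lemma shifted_op_approximate_solution:
  fixes Y :: "'a \<Rightarrow> 'b"
  assumes Y: "sq_int M Y" and \<epsilon>: "0 < \<epsilon>"
  obtains r where "sq_int M r" "norm2 M (\<lambda>w. Y w - shifted_op \<kappa> c r w) \<le> \<epsilon>"
proof -
  \<comment> \<open>One step multiplies the squared error by at most
    \<open>1 - 2 * \<tau> + \<tau>^2 * (1 + c)^2\<close>. This \<open>\<tau>\<close> minimises the
    factor, with minimum \<open>1 - \<tau>\<close>.\<close>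
  define \<tau> where "\<tau> = 1 / (1 + c)\<^sup>2"
  have \<tau>: "0 < \<tau>" "\<tau> \<le> 1" "\<tau>\<^sup>2 * (1 + c)\<^sup>2 = \<tau>"
    using c one_le_power[of "1 + c" 2] by (auto simp: \<tau>_def power_divide power2_eq_square)
  have "\<exists>r. sq_int M r \<and> (norm2 M (\<lambda>w. Y w - shifted_op \<kappa> c r w))\<^sup>2 \<le> (1 - \<tau>) ^ n * (norm2 M Y)\<^sup>2" for n
  proof (induction n)
    case 0
    show ?case
      by (intro exI[of _ "\<lambda>_. 0"]) (simp add: sq_int_const shifted_op_def kernel_op_def)
  next
    case (Suc n)
    then obtain r where r: "sq_int M r"
      and IH: "(norm2 M (\<lambda>w. Y w - shifted_op \<kappa> c r w))\<^sup>2 \<le> (1 - \<tau>) ^ n * (norm2 M Y)\<^sup>2" by blast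
    define e where "e w = Y w - shifted_op \<kappa> c r w" for w
    have e: "sq_int M e" unfolding e_def by (intro sq_int_diff Y shifted_op_sq_int r c)
    have Ae: "sq_int M (shifted_op \<kappa> c e)" by (intro shifted_op_sq_int e c)
    \<comment> \<open>By linearity the new error is the old one minus \<open>\<tau>\<close> times
      its image.\<close>
    have "norm2 M (\<lambda>w. Y w - shifted_op \<kappa> c (\<lambda>w. r w + \<tau> *\<^sub>R e w) w)
        = norm2 M (\<lambda>w. e w + (- \<tau>) *\<^sub>R shifted_op \<kappa> c e w)"
    proof (rule norm2_cong)
      fix w assume w: "w \<in> space M"
      have "Y w = e w + shifted_op \<kappa> c r w" by (simp add: e_def)
      then show "Y w - shifted_op \<kappa> c (\<lambda>w. r w + \<tau> *\<^sub>R e w) w = e w + (- \<tau>) *\<^sub>R shifted_op \<kappa> c e w"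
        by (simp add: shifted_op_def kernel_op_add_scaleR[OF w r e] algebra_simps)
    qed
    also have "\<dots>\<^sup>2 = (norm2 M e)\<^sup>2 - 2 * \<tau> * (\<integral>w. e w \<bullet> shifted_op \<kappa> c e w \<partial>M) + \<tau>\<^sup>2 * (norm2 M (shifted_op \<kappa> c e))\<^sup>2"
      by (subst integral_norm_add_sq(2)[OF e sq_int_scaleR[OF Ae]])
        (simp add: norm2_scaleR[of M "- \<tau>", simplified] power_mult_distrib)
    also have "\<dots> \<le> (norm2 M e)\<^sup>2 - 2 * \<tau> * (norm2 M e)\<^sup>2 + \<tau>\<^sup>2 * ((1 + c) * norm2 M e)\<^sup>2"
      using \<tau> shifted_op_coercive(1)[OF e] shifted_op_sq_int(2)[OF e c]
      by (intro add_mono diff_mono mult_left_mono power_mono) auto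
    also have "\<dots> = (1 - \<tau>) * (norm2 M e)\<^sup>2"
      unfolding power_mult_distrib mult.assoc[symmetric] \<tau>(3) by (simp add: algebra_simps)
    also have "\<dots> \<le> (1 - \<tau>) * ((1 - \<tau>) ^ n * (norm2 M Y)\<^sup>2)"
      using IH \<tau> unfolding e_def by (intro mult_left_mono) auto
    finally show ?case
      by (intro exI[of _ "\<lambda>w. r w + \<tau> *\<^sub>R e w"]) (simp add: sq_int_add sq_int_scaleR r e)
  qed
  moreover have "(\<lambda>n. (1 - \<tau>) ^ n * (norm2 M Y)\<^sup>2) \<longlonglongrightarrow> 0 * (norm2 M Y)\<^sup>2"
    using \<tau> by (intro tendsto_intros LIMSEQ_power_zero) auto
  then have "eventually (\<lambda>n. (1 - \<tau>) ^ n * (norm2 M Y)\<^sup>2 < \<epsilon>\<^sup>2) sequentially"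
    using \<epsilon> by (intro order_tendstoD(2)) auto
  then obtain n where "(1 - \<tau>) ^ n * (norm2 M Y)\<^sup>2 < \<epsilon>\<^sup>2"
    by (auto simp: eventually_sequentially)
  ultimately obtain r where r: "sq_int M r" "(norm2 M (\<lambda>w. Y w - shifted_op \<kappa> c r w))\<^sup>2 \<le> \<epsilon>\<^sup>2"
    by (meson less_imp_le order_trans)
  from r(2) have "norm2 M (\<lambda>w. Y w - shifted_op \<kappa> c r w) \<le> \<epsilon>"
    by (rule power2_le_imp_le) (use \<epsilon> in simp)
  with r(1) show ?thesis by (rule that)
qed

end

end

end

section \<open>Duality for kernel ridge regression\<close>

text \<open>Lets a single high moment control all lower ones.\<close>

lemma power_le_one_add_power: "0 \<le> x \<Longrightarrow> m \<le> n \<Longrightarrow> x ^ m \<le> 1 + x ^ n" for x :: real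
proof (cases "x \<le> 1")
  case True
  then show "0 \<le> x \<Longrightarrow> m \<le> n \<Longrightarrow> x ^ m \<le> 1 + x ^ n"
    using power_le_one[of x m] zero_le_power[of x n] by linarith
next
  case False
  then show "0 \<le> x \<Longrightarrow> m \<le> n \<Longrightarrow> x ^ m \<le> 1 + x ^ n"
    using power_increasing[of m n x] by linarith
qed

text \<open>The adjoint of a rotation is the inverse rotation; this moves the character from the
  frequency side to the data.\<close>

lemma inner_mult_cis: "(a * cis t) \<bullet> b = a \<bullet> (cis (- t) * b)"
  by (simp add: inner_complex_def algebra_simps)

lemma cis_meas[measurable]: "cis \<in> borel_measurable borel"
  by (intro borel_measurable_continuous_onI continuous_intros)

locale ridge_regression = prob_space M
  for M :: "'w measure" +
  fixes X :: "'w \<Rightarrow> real ^ 'n" and Y :: "'w \<Rightarrow> complex" and k :: "real ^ 'n \<Rightarrow> real"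
    and \<K> \<K>' \<K>'' :: "real \<Rightarrow> real" and lam :: real
  assumes X_meas[measurable]: "X \<in> borel_measurable M"
    and Y: "sq_int M Y"
    and lam: "lam > 0"
    and X8: "integrable M (\<lambda>w. norm (X w) ^ 8)"
    and cov_pos: "\<And>\<omega>. \<omega> \<noteq> 0 \<Longrightarrow> cov_form M X \<omega> \<omega> > 0"
    and k_pos: "\<And>\<omega>. k \<omega> > 0"
    and k_int: "has_bochner_integral lborel k 1"
    and K_rot: "\<And>x. kernel_fun k x = complex_of_real (\<K> (V_norm_sq M X x))"
    and dK: "\<And>r. r \<ge> 0 \<Longrightarrow> (\<K> has_real_derivative \<K>' r) (at r within {0..})"
    and dK': "\<And>r. r \<ge> 0 \<Longrightarrow> (\<K>' has_real_derivative \<K>'' r) (at r within {0..})"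
    and K'_bd: "bounded (\<K>' ` {0..})"
    and K''_bd: "bounded (\<K>'' ` {0..})"
begin

lemma sq_int_X: "sq_int M X"
proof -
  have "integrable M (\<lambda>w. (norm (X w))\<^sup>2)"
  proof (rule Bochner_Integration.integrable_bound)
    show "integrable M (\<lambda>w. 1 + norm (X w) ^ 8)" using X8 by simp
    show "AE w in M. norm ((norm (X w))\<^sup>2) \<le> norm (1 + norm (X w) ^ 8)"
    proof (rule AE_I2)
      fix w show "norm ((norm (X w))\<^sup>2) \<le> norm (1 + norm (X w) ^ 8)"
        using power_le_one_add_power[of "norm (X w)" 2 8] by simp
    qed
  qed measurable
  then show ?thesis by (simp add: sq_int_def)
qed

lemma cov_upper_form: "x \<bullet> (cov_upper M X *v x) = cov_form M X x x"
proof -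
  define Z where "Z w = X w - integral\<^sup>L M X" for w
  have Z: "sq_int M Z" unfolding Z_def by (intro sq_int_diff sq_int_X sq_int_const)
  note [measurable] = sq_int_measurable[OF Z]
  have "sq_int M (\<lambda>w. Z w $ i)" for i
  proof (rule norm2_mono[OF Z])
    have "(\<lambda>w. Z w \<bullet> axis i 1) \<in> borel_measurable M" by measurable
    then show "(\<lambda>w. Z w $ i) \<in> borel_measurable M" by (simp add: inner_axis)
  qed (simp add: component_le_norm_cart)
  then have int: "integrable M (\<lambda>w. Z w $ i * Z w $ j)" for i j
    using integrable_inner_sq_int[of M "\<lambda>w. Z w $ i" "\<lambda>w. Z w $ j"] by (simp add: mult.commute)
  have "x \<bullet> (cov_upper M X *v x) = (\<Sum>i\<in>UNIV. \<Sum>j\<in>UNIV. x $ i * x $ j * (\<integral>w. Z w $ i * Z w $ j \<partial>M))"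
  proof -
    have "cov_upper M X $ i $ j = (\<integral>w. Z w $ i * Z w $ j \<partial>M)" for i j
      by (simp add: cov_upper_def cov_form_def Z_def[symmetric] inner_axis')
    then show ?thesis
      by (simp add: inner_vec_def matrix_vector_mult_def sum_distrib_left mult_ac)
  qed
  also have "\<dots> = (\<integral>w. (\<Sum>i\<in>UNIV. \<Sum>j\<in>UNIV. x $ i * x $ j * (Z w $ i * Z w $ j)) \<partial>M)"
    using int by (simp add: Bochner_Integration.integral_sum)
  also have "\<dots> = cov_form M X x x"
    unfolding cov_form_def Z_def[symmetric]
    by (rule Bochner_Integration.integral_cong) (auto simp: inner_vec_def sum_product mult_ac)
  finally show ?thesis .
qed

lemma cov_upper_Sym_pos: "cov_upper M X \<in> Sym_pos"
  using cov_pos unfolding Sym_pos_def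
  by (auto simp: cov_upper_form) (simp add: cov_upper_def cov_form_def transpose_def vec_eq_iff mult.commute)

text \<open>Validates the choice operator in \<open>J_Sym\<close>: the form of \<open>V\<close> is
  the inverse of the positive definite covariance, to which every form of the cone is congruent by
  some, possibly singular, \<open>U\<close>.\<close>

lemma factor_exists:
  fixes S :: "real ^ 'n ^ 'n"
  assumes "S \<in> Sym_ge0"
  shows "\<exists>U :: real ^ 'n ^ 'n. \<forall>x. x \<bullet> (S *v x) = V_norm_sq M X (U *v x)"
proof -
  obtain U :: "real ^ 'n ^ 'n" where "transpose U ** matrix_inv (cov_upper M X) ** U = S"
    using pos_semidef_congruent_to_inverse[OF cov_upper_Sym_pos, of S] assms
    unfolding Sym_ge0_eq by blast
  then have "x \<bullet> (S *v x) = V_norm_sq M X (U *v x)" for x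
    by (auto simp: V_norm_sq_def cov_lower_def matrix_vector_mul_assoc[symmetric] inner_commute dot_lmul_matrix)
      (metis dot_lmul_matrix inner_commute)
  then show ?thesis by blast
qed

definition gap :: "'w \<times> 'w \<Rightarrow> real ^ 'n" where
  "gap p = X (fst p) - X (snd p)"

text \<open>The kernel between \<open>U X\<close> and \<open>U X'\<close>, written through
  \<open>S\<close> alone. Unlike \<open>U\<close>, the form enters linearly in the argument of
  \<open>\<K>\<close>, also at degenerate forms.\<close>

definition kern :: "real ^ 'n ^ 'n \<Rightarrow> 'w \<times> 'w \<Rightarrow> real" where
  "kern S p = \<K> (gap p \<bullet> (S *v gap p))"

lemma gap_meas[measurable]: "gap \<in> borel_measurable (M \<Otimes>\<^sub>M M)"
  unfolding gap_def by measurable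

lemma measurable_quadratic_form:
  assumes "continuous_on {0..} g" "S \<in> Sym_ge0"
  shows "(\<lambda>p. g (gap p \<bullet> (S *v gap p)) :: real) \<in> borel_measurable (M \<Otimes>\<^sub>M M)"
proof -
  \<comment> \<open>Nothing is known about \<open>g\<close> on negative numbers;
    \<open>max 0\<close> extends it continuously and changes no value taken on the cone.\<close>
  have "continuous_on UNIV (\<lambda>x. g (max 0 x))"
    by (rule continuous_on_compose2[OF assms(1)]) (auto intro!: continuous_intros)
  then have g[measurable]: "(\<lambda>x. g (max 0 x)) \<in> borel_measurable borel"
    by (rule borel_measurable_continuous_onI)
  have "continuous_on UNIV (\<lambda>z. z \<bullet> (S *v z))"
    by (intro continuous_intros linear_continuous_on linear_conv_bounded_linear[THEN iffD1] matrix_vector_mul_linear)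
  then have [measurable]: "(\<lambda>z. z \<bullet> (S *v z)) \<in> borel_measurable borel"
    by (rule borel_measurable_continuous_onI)
  have "(\<lambda>p. g (max 0 (gap p \<bullet> (S *v gap p)))) \<in> borel_measurable (M \<Otimes>\<^sub>M M)"
    by measurable
  also have "(\<lambda>p. g (max 0 (gap p \<bullet> (S *v gap p)))) = (\<lambda>p. g (gap p \<bullet> (S *v gap p)))"
    using assms(2) by (auto simp: Sym_ge0_eq pos_semidef_def max_def)
  finally show ?thesis .
qed

lemma kern_meas: "S \<in> Sym_ge0 \<Longrightarrow> kern S \<in> borel_measurable (M \<Otimes>\<^sub>M M)"
  unfolding kern_def using dK
  by (intro measurable_quadratic_form DERIV_continuous_on[of _ _ \<K>']) auto

lemma k_meas[measurable]: "k \<in> borel_measurable borel" and k_integrable: "integrable lborel k"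
  and k_integral: "integral\<^sup>L lborel k = 1"
  using k_int by (auto simp: has_bochner_integral_iff)

lemma in_H_integrable:
  assumes "in_H k f f_hat"
  shows "integrable lborel f_hat"
proof (rule Bochner_Integration.integrable_bound)
  show "integrable lborel (\<lambda>\<omega>. (cmod (f_hat \<omega>))\<^sup>2 / k \<omega> + k \<omega>)"
    using assms k_integrable by (simp add: in_H_def)
  show "f_hat \<in> borel_measurable lborel" using assms by (simp add: in_H_def)
  \<comment> \<open>The weighted mean inequality splits the modulus of \<open>f_hat\<close> into the
    integrand of the norm and the density \<open>k\<close>.\<close>
  have "a \<le> a\<^sup>2 / b + b" if "0 < b" for a b :: real
  proof -
    have "a * b \<le> a\<^sup>2 + b\<^sup>2" using sum_squares_bound[of a b]
      zero_le_power2[of a] zero_le_power2[of b] by linarith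
    then show ?thesis using that by (simp add: field_simps power2_eq_square)
  qed
  then show "AE \<omega> in lborel. norm (f_hat \<omega>) \<le> norm ((cmod (f_hat \<omega>))\<^sup>2 / k \<omega> + k \<omega>)"
    using k_pos by (intro AE_I2) (auto intro: order_trans[OF _ abs_ge_self])
qed

text \<open>A Fourier transform of a probability density is bounded by 1.\<close>

lemma kern_le: "S \<in> Sym_ge0 \<Longrightarrow> \<bar>kern S p\<bar> \<le> 1"
proof -
  assume "S \<in> Sym_ge0"
  then obtain U where U: "\<And>x. x \<bullet> (S *v x) = V_norm_sq M X (U *v x)" using factor_exists by blast
  have "\<bar>kern S p\<bar> = norm (kernel_fun k (U *v gap p))" by (simp add: kern_def U K_rot)
  also have "\<dots> \<le> (\<integral>\<omega>. norm (cis (2 * pi * ((U *v gap p) \<bullet> \<omega>)) * complex_of_real (k \<omega>)) \<partial>lborel)"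
    unfolding kernel_fun_def by (rule integral_norm_bound)
  also have "\<dots> = (\<integral>\<omega>. k \<omega> \<partial>lborel)" using k_pos by (simp add: norm_mult less_imp_le)
  finally show ?thesis by (simp add: k_integral)
qed

abbreviation "Q S r \<equiv> kernel_form (kern S) r r"

definition dual_value :: "real ^ 'n ^ 'n \<Rightarrow> ('w \<Rightarrow> complex) \<Rightarrow> real" where
  "dual_value S r = (\<integral>w. Y w \<bullet> r w \<partial>M) - (norm2 M r)\<^sup>2 / 2 - Q S r / (2 * lam)"

section \<open>Frequency side of the regression problem for a fixed form\<close>

context
  fixes S U :: "real ^ 'n ^ 'n"
  assumes S: "S \<in> Sym_ge0" and U: "\<And>x. x \<bullet> (S *v x) = V_norm_sq M X (U *v x)"
begin

interpretation LM: pair_sigma_finite lborel M ..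

definition synthesis :: "(real ^ 'n \<Rightarrow> complex) \<Rightarrow> real ^ 'n \<Rightarrow> complex" where
  "synthesis h x = (\<integral>\<omega>. h \<omega> * cis (2 * pi * (\<omega> \<bullet> x)) \<partial>lborel)"

text \<open>Fourier transform of the image under \<open>U X\<close> of the complex measure with
  density \<open>r\<close>; adjoint to evaluating \<open>synthesis\<close> on the sample.\<close>

definition data_transform :: "('w \<Rightarrow> complex) \<Rightarrow> real ^ 'n \<Rightarrow> complex" where
  "data_transform r \<omega> = (\<integral>w. cis (- (2 * pi * (\<omega> \<bullet> (U *v X w)))) * r w \<partial>M)"

lemma UX_meas[measurable]: "(\<lambda>w. U *v X w) \<in> borel_measurable M"
proof -
  have [measurable]: "(*v) U \<in> borel_measurable borel"
    by (intro borel_measurable_continuous_onI linear_continuous_on linear_conv_bounded_linear[THEN iffD1] matrix_vector_mul_linear)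
  show ?thesis by measurable
qed

lemma data_transform_meas: "sq_int M r \<Longrightarrow> data_transform r \<in> borel_measurable borel"
proof -
  assume r: "sq_int M r"
  note [measurable] = sq_int_measurable[OF r]
  have "data_transform r \<in> borel_measurable lborel" unfolding data_transform_def by measurable
  then show ?thesis by simp
qed

lemma data_transform_integrable:
  assumes r: "sq_int M r"
  shows "integrable M (\<lambda>w. cis (- (2 * pi * (\<omega> \<bullet> (U *v X w)))) * r w)"
proof -
  note [measurable] = sq_int_measurable[OF r]
  show ?thesis
    by (rule Bochner_Integration.integrable_bound[OF integrable_sq_int[OF finite_measure_axioms r]])
      (auto simp: norm_mult)
qed

lemma norm_data_transform_le: "norm (data_transform r \<omega>) \<le> (\<integral>w. norm (r w) \<partial>M)"
  unfolding data_transform_def by (rule order_trans[OF integral_norm_bound]) (simp add: norm_mult)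

lemma synthesis_meas: "h \<in> borel_measurable borel \<Longrightarrow> synthesis h \<in> borel_measurable borel"
proof -
  assume [measurable]: "h \<in> borel_measurable borel"
  show ?thesis unfolding synthesis_def by measurable
qed

lemma synthesis_integrable:
  assumes h: "integrable lborel h"
  shows "integrable lborel (\<lambda>\<omega>. h \<omega> * cis (2 * pi * (\<omega> \<bullet> x)))"
proof -
  note [measurable] = borel_measurable_integrable[OF h, simplified]
  show ?thesis by (rule Bochner_Integration.integrable_bound[OF h]) (auto simp: norm_mult)
qed

lemma synthesis_sq_int:
  assumes h: "integrable lborel h"
  shows "sq_int M (\<lambda>w. synthesis h (U *v X w))"
proof (rule norm2_mono(1)[OF sq_int_const])
  note [measurable] = synthesis_meas[OF borel_measurable_integrable[OF h, simplified]]
  show "(\<lambda>w. synthesis h (U *v X w)) \<in> borel_measurable M" by measurable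
  have "norm (synthesis h x) \<le> (\<integral>\<omega>. norm (h \<omega>) \<partial>lborel)" for x
    unfolding synthesis_def by (rule order_trans[OF integral_norm_bound]) (simp add: norm_mult)
  then show "norm (synthesis h (U *v X w)) \<le> norm (\<integral>\<omega>. norm (h \<omega>) \<partial>lborel)" for w
    by (rule order_trans) simp
qed

lemma integral_synthesis_inner:
  assumes h: "integrable lborel h" and r: "sq_int M r"
  shows "(\<integral>w. synthesis h (U *v X w) \<bullet> r w \<partial>M) = (\<integral>\<omega>. h \<omega> \<bullet> data_transform r \<omega> \<partial>lborel)"
proof -
  note [measurable] = borel_measurable_integrable[OF h, simplified] sq_int_measurable[OF r]
  have rn: "integrable M (\<lambda>w. norm (r w))"
    by (intro integrable_norm integrable_sq_int[OF finite_measure_axioms r])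
  have int: "integrable (lborel \<Otimes>\<^sub>M M) (\<lambda>(\<omega>, w). (h \<omega> * cis (2 * pi * (\<omega> \<bullet> (U *v X w)))) \<bullet> r w)"
  proof (rule Bochner_Integration.integrable_bound[OF LM.integrable_tensor(1)[OF integrable_norm[OF h] rn]])
    show "AE p in lborel \<Otimes>\<^sub>M M. norm (case p of (\<omega>, w) \<Rightarrow> (h \<omega> * cis (2 * pi * (\<omega> \<bullet> (U *v X w)))) \<bullet> r w)
        \<le> norm (norm (h (fst p)) * norm (r (snd p)))"
      by (intro AE_I2) (auto simp: norm_mult intro: order_trans[OF Cauchy_Schwarz_ineq2])
  qed measurable
  have "(\<integral>w. synthesis h (U *v X w) \<bullet> r w \<partial>M)
      = (\<integral>w. \<integral>\<omega>. (h \<omega> * cis (2 * pi * (\<omega> \<bullet> (U *v X w)))) \<bullet> r w \<partial>lborel \<partial>M)"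
    unfolding synthesis_def using synthesis_integrable[OF h] by simp
  also have "\<dots> = (\<integral>\<omega>. \<integral>w. (h \<omega> * cis (2 * pi * (\<omega> \<bullet> (U *v X w)))) \<bullet> r w \<partial>M \<partial>lborel)"
    by (rule LM.Fubini_integral[OF int])
  also have "\<dots> = (\<integral>\<omega>. h \<omega> \<bullet> data_transform r \<omega> \<partial>lborel)"
    unfolding data_transform_def inner_mult_cis using data_transform_integrable[OF r] by simp
  finally show ?thesis .
qed

lemma density_data_transform_integrable:
  assumes r: "sq_int M r"
  shows "integrable lborel (\<lambda>\<omega>. k \<omega> *\<^sub>R data_transform r \<omega>)"
proof (rule Bochner_Integration.integrable_bound)
  note [measurable] = data_transform_meas[OF r]
  show "integrable lborel (\<lambda>\<omega>. k \<omega> * (\<integral>w. norm (r w) \<partial>M))"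
    by (intro integrable_mult_left k_integrable)
  show "(\<lambda>\<omega>. k \<omega> *\<^sub>R data_transform r \<omega>) \<in> borel_measurable lborel" by measurable
  show "AE \<omega> in lborel. norm (k \<omega> *\<^sub>R data_transform r \<omega>) \<le> norm (k \<omega> * (\<integral>w. norm (r w) \<partial>M))"
    using k_pos by (intro AE_I2) (auto simp: abs_mult intro!: mult_left_mono norm_data_transform_le)
qed

text \<open>A character of \<open>U X w - U X v\<close> is a product of two characters, so weighting
  by \<open>k\<close> between analysis and synthesis yields the kernel operator.\<close>

lemma synthesis_density_data_transform:
  assumes r: "sq_int M r"
  shows "synthesis (\<lambda>\<omega>. k \<omega> *\<^sub>R data_transform r \<omega>) (U *v X w) = kernel_op (kern S) r w"
proof -
  note [measurable] = sq_int_measurable[OF r]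
  let ?e = "\<lambda>\<omega> v. cis (2 * pi * (\<omega> \<bullet> (U *v X w))) * cis (- (2 * pi * (\<omega> \<bullet> (U *v X v))))"
  let ?F = "\<lambda>\<omega> v. of_real (k \<omega>) * ?e \<omega> v * r v"
  have rn: "integrable M (\<lambda>w. norm (r w))"
    by (intro integrable_norm integrable_sq_int[OF finite_measure_axioms r])
  have int: "integrable (lborel \<Otimes>\<^sub>M M) (\<lambda>(\<omega>, v). ?F \<omega> v)"
  proof (rule Bochner_Integration.integrable_bound[OF LM.integrable_tensor(1)[OF k_integrable rn]])
    show "AE p in lborel \<Otimes>\<^sub>M M. norm (case p of (\<omega>, v) \<Rightarrow> ?F \<omega> v) \<le> norm (k (fst p) * norm (r (snd p)))"
      by (intro AE_I2) (auto simp: norm_mult)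
  qed measurable
  have "kernel_op (kern S) r w = (\<integral>v. \<integral>\<omega>. ?F \<omega> v \<partial>lborel \<partial>M)"
    unfolding kernel_op_def
  proof (rule Bochner_Integration.integral_cong[OF refl])
    fix v
    have "complex_of_real (kern S (w, v)) = kernel_fun k (U *v (X w - X v))"
      by (simp add: kern_def gap_def U K_rot)
    also have "\<dots> = (\<integral>\<omega>. of_real (k \<omega>) * ?e \<omega> v \<partial>lborel)"
      unfolding kernel_fun_def
      by (rule Bochner_Integration.integral_cong)
        (auto simp: cis_mult matrix_vector_mult_diff_distrib inner_diff_left inner_commute algebra_simps)
    finally show "kern S (w, v) *\<^sub>R r v = (\<integral>\<omega>. ?F \<omega> v \<partial>lborel)"
      by (simp add: scaleR_conv_of_real)
  qed
  also have "\<dots> = (\<integral>\<omega>. \<integral>v. ?F \<omega> v \<partial>M \<partial>lborel)"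
    by (rule LM.Fubini_integral[OF int])
  also have "\<dots> = synthesis (\<lambda>\<omega>. k \<omega> *\<^sub>R data_transform r \<omega>) (U *v X w)"
    unfolding synthesis_def
  proof (rule Bochner_Integration.integral_cong[OF refl])
    fix \<omega>
    have "(\<integral>v. ?F \<omega> v \<partial>M) = (\<integral>v. (of_real (k \<omega>) * cis (2 * pi * (\<omega> \<bullet> (U *v X w))))
        * (cis (- (2 * pi * (\<omega> \<bullet> (U *v X v)))) * r v) \<partial>M)"
      by (simp add: mult_ac)
    also have "\<dots> = of_real (k \<omega>) * cis (2 * pi * (\<omega> \<bullet> (U *v X w))) * data_transform r \<omega>"
      unfolding data_transform_def using data_transform_integrable[OF r] by simp
    finally show "(\<integral>v. ?F \<omega> v \<partial>M) = k \<omega> *\<^sub>R data_transform r \<omega> * cis (2 * pi * (\<omega> \<bullet> (U *v X w)))"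
      by (simp add: scaleR_conv_of_real mult_ac)
  qed
  finally show ?thesis by simp
qed

text \<open>The easy direction of Bochner's theorem: on the frequency side the form is a weighted
  squared norm.\<close>

lemma Q_eq:
  assumes r: "sq_int M r"
  shows "Q S r = (\<integral>\<omega>. k \<omega> * (norm (data_transform r \<omega>))\<^sup>2 \<partial>lborel)"
proof -
  have "Q S r = (\<integral>w. r w \<bullet> kernel_op (kern S) r w \<partial>M)"
    using integral_inner_kernel_op[OF kern_meas[OF S] kern_le[OF S] r r] by simp
  also have "\<dots> = (\<integral>w. synthesis (\<lambda>\<omega>. k \<omega> *\<^sub>R data_transform r \<omega>) (U *v X w) \<bullet> r w \<partial>M)"
    by (simp add: synthesis_density_data_transform[OF r] inner_commute)
  also have "\<dots> = (\<integral>\<omega>. (k \<omega> *\<^sub>R data_transform r \<omega>) \<bullet> data_transform r \<omega> \<partial>lborel)"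
    by (rule integral_synthesis_inner[OF density_data_transform_integrable[OF r] r])
  finally show ?thesis by (simp add: power2_norm_eq_inner)
qed

lemma density_data_transform_sq_integrable:
  assumes r: "sq_int M r"
  shows "integrable lborel (\<lambda>\<omega>. k \<omega> * (norm (data_transform r \<omega>))\<^sup>2)"
proof (rule Bochner_Integration.integrable_bound)
  note [measurable] = data_transform_meas[OF r]
  show "integrable lborel (\<lambda>\<omega>. k \<omega> * (\<integral>w. norm (r w) \<partial>M)\<^sup>2)"
    by (intro integrable_mult_left k_integrable)
  show "(\<lambda>\<omega>. k \<omega> * (norm (data_transform r \<omega>))\<^sup>2) \<in> borel_measurable lborel" by measurable
  show "AE \<omega> in lborel. norm (k \<omega> * (norm (data_transform r \<omega>))\<^sup>2) \<le> norm (k \<omega> * (\<integral>w. norm (r w) \<partial>M)\<^sup>2)"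
    using k_pos by (intro AE_I2) (auto simp: abs_mult intro!: mult_left_mono power_mono norm_data_transform_le)
qed

lemma Q_nonneg_aux: "sq_int M r \<Longrightarrow> 0 \<le> Q S r" for r :: "'w \<Rightarrow> complex"
  using k_pos by (simp add: Q_eq less_imp_le)

text \<open>Young's inequality twice: in frequency space with weight \<open>lam / k\<close> for the
  pairing of \<open>f_hat\<close> with \<open>data_transform r\<close>, and in sample space for the
  pairing of \<open>Y - g\<close> with \<open>r\<close>.\<close>

lemma weak_duality:
  assumes H: "in_H k f f_hat" and r: "sq_int M r"
  shows "dual_value S r \<le> 1/2 * (\<integral>w. (cmod (Y w - f (U *v X w)))\<^sup>2 \<partial>M) + lam/2 * H_norm_sq k f_hat"
proof -
  have fh: "integrable lborel f_hat" by (rule in_H_integrable[OF H])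
  have f: "f = synthesis f_hat" using H by (auto simp: in_H_def synthesis_def)
  define g where "g w = f (U *v X w)" for w
  have g: "sq_int M g" unfolding g_def f by (rule synthesis_sq_int[OF fh])
  have "(\<integral>w. g w \<bullet> r w \<partial>M) = (\<integral>\<omega>. f_hat \<omega> \<bullet> data_transform r \<omega> \<partial>lborel)"
    unfolding g_def f by (rule integral_synthesis_inner[OF fh r])
  also have "\<dots> \<le> (\<integral>\<omega>. lam / 2 * ((cmod (f_hat \<omega>))\<^sup>2 / k \<omega>) + (k \<omega> * (norm (data_transform r \<omega>))\<^sup>2) / (2 * lam) \<partial>lborel)"
  proof (rule integral_mono')
    show "integrable lborel (\<lambda>\<omega>. lam / 2 * ((cmod (f_hat \<omega>))\<^sup>2 / k \<omega>) + (k \<omega> * (norm (data_transform r \<omega>))\<^sup>2) / (2 * lam))"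
      using H density_data_transform_sq_integrable[OF r]
      by (intro Bochner_Integration.integrable_add integrable_mult_right integrable_divide) (auto simp: in_H_def)
    fix \<omega>
    have "0 \<le> (lam * cmod (f_hat \<omega>) - k \<omega> * cmod (data_transform r \<omega>))\<^sup>2 / (2 * lam * k \<omega>)"
      using lam k_pos[of \<omega>] by simp
    also have "\<dots> = lam / 2 * ((cmod (f_hat \<omega>))\<^sup>2 / k \<omega>) + (k \<omega> * (norm (data_transform r \<omega>))\<^sup>2) / (2 * lam)
        - cmod (f_hat \<omega>) * cmod (data_transform r \<omega>)"
      using lam k_pos[of \<omega>] by (simp add: field_simps power2_eq_square)
    finally show "f_hat \<omega> \<bullet> data_transform r \<omega> \<le> lam / 2 * ((cmod (f_hat \<omega>))\<^sup>2 / k \<omega>) + (k \<omega> * (norm (data_transform r \<omega>))\<^sup>2) / (2 * lam)"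
      using norm_cauchy_schwarz[of "f_hat \<omega>" "data_transform r \<omega>"] by linarith
    show "0 \<le> lam / 2 * ((cmod (f_hat \<omega>))\<^sup>2 / k \<omega>) + (k \<omega> * (norm (data_transform r \<omega>))\<^sup>2) / (2 * lam)"
      using lam k_pos[of \<omega>] by simp
  qed
  also have "\<dots> = lam / 2 * H_norm_sq k f_hat + Q S r / (2 * lam)"
    unfolding H_norm_sq_def Q_eq[OF r] using H density_data_transform_sq_integrable[OF r]
    by (subst Bochner_Integration.integral_add)
      (auto simp: in_H_def simp del: times_divide_eq_right intro: integrable_mult_right)
  finally have 1: "(\<integral>w. g w \<bullet> r w \<partial>M) \<le> lam / 2 * H_norm_sq k f_hat + Q S r / (2 * lam)" .
  have Yg: "sq_int M (\<lambda>w. Y w - g w)" by (intro sq_int_diff Y g)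
  have "(norm2 M (\<lambda>w. (Y w - g w) - r w))\<^sup>2
      = (norm2 M (\<lambda>w. Y w - g w))\<^sup>2 - 2 * (\<integral>w. (Y w - g w) \<bullet> r w \<partial>M) + (norm2 M r)\<^sup>2"
    using integral_norm_add_sq(2)[OF Yg sq_int_scaleR[OF r, of "-1"]] norm2_scaleR[of M "-1" r] by simp
  moreover have "(\<integral>w. (Y w - g w) \<bullet> r w \<partial>M) = (\<integral>w. Y w \<bullet> r w \<partial>M) - (\<integral>w. g w \<bullet> r w \<partial>M)"
    using integrable_inner_sq_int[OF Y r] integrable_inner_sq_int[OF g r] by (simp add: inner_diff_left)
  ultimately have "(\<integral>w. Y w \<bullet> r w \<partial>M) - (\<integral>w. g w \<bullet> r w \<partial>M) \<le> (norm2 M (\<lambda>w. Y w - g w))\<^sup>2 / 2 + (norm2 M r)\<^sup>2 / 2"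
    using zero_le_power2[of "norm2 M (\<lambda>w. (Y w - g w) - r w)"] by linarith
  with 1 show ?thesis by (simp add: dual_value_def norm2_sq g_def)
qed

text \<open>The function with transform \<open>k * data_transform r / lam\<close> takes the values
  \<open>kernel_op r / lam\<close> on the sample. Hence \<open>Y - f = e + r\<close>, where
  \<open>e\<close> is the defect in the Euler equation, and the duality gap is exactly half the
  squared norm of \<open>e\<close>, for every \<open>r\<close>.\<close>

lemma strong_duality:
  assumes r: "sq_int M r"
  obtains f f_hat where "in_H k f f_hat"
    "1/2 * (\<integral>w. (cmod (Y w - f (U *v X w)))\<^sup>2 \<partial>M) + lam/2 * H_norm_sq k f_hat
      = dual_value S r + (norm2 M (\<lambda>w. Y w - shifted_op (kern S) (1 / lam) r w))\<^sup>2 / 2"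
proof -
  define fh where "fh \<omega> = (1 / lam) *\<^sub>R (k \<omega> *\<^sub>R data_transform r \<omega>)" for \<omega>
  note [measurable] = data_transform_meas[OF r]
  have sq: "(cmod (fh \<omega>))\<^sup>2 / k \<omega> = (1 / lam\<^sup>2) * (k \<omega> * (cmod (data_transform r \<omega>))\<^sup>2)" for \<omega>
    using lam k_pos[of \<omega>] by (simp add: fh_def power_mult_distrib power_divide power2_eq_square)
  have H: "in_H k (synthesis fh) fh"
    unfolding in_H_def sq
  proof (intro conjI)
    show "fh \<in> borel_measurable borel" unfolding fh_def by measurable
  qed (use density_data_transform_sq_integrable[OF r] in \<open>auto simp: synthesis_def\<close>)
  have norm: "H_norm_sq k fh = Q S r / lam\<^sup>2"
    unfolding H_norm_sq_def sq using density_data_transform_sq_integrable[OF r] by (simp add: Q_eq[OF r])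
  have T: "synthesis fh (U *v X w) = (1 / lam) *\<^sub>R kernel_op (kern S) r w" for w
    unfolding synthesis_density_data_transform[OF r, symmetric] synthesis_def fh_def
    using synthesis_integrable[OF density_data_transform_integrable[OF r], of "U *v X w"]
    by (subst integral_scaleR_right[symmetric]) (simp_all only: mult_scaleR_left)
  define e where "e w = Y w - shifted_op (kern S) (1 / lam) r w" for w
  note kS = kern_meas[OF S] kern_le[OF S]
  have A: "sq_int M (shifted_op (kern S) (1 / lam) r)"
    using shifted_op_sq_int(1)[OF kS r] lam by simp
  have e: "sq_int M e" unfolding e_def by (intro sq_int_diff Y A)
  have "(\<integral>w. (cmod (Y w - synthesis fh (U *v X w)))\<^sup>2 \<partial>M) = (norm2 M (\<lambda>w. e w + r w))\<^sup>2"
    unfolding norm2_sq T by (simp add: e_def shifted_op_def algebra_simps)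
  also have "\<dots> = (norm2 M e)\<^sup>2 + 2 * (\<integral>w. e w \<bullet> r w \<partial>M) + (norm2 M r)\<^sup>2"
    by (rule integral_norm_add_sq(2)[OF e r])
  finally have 1: "(\<integral>w. (cmod (Y w - synthesis fh (U *v X w)))\<^sup>2 \<partial>M) = (norm2 M e)\<^sup>2 + 2 * (\<integral>w. e w \<bullet> r w \<partial>M) + (norm2 M r)\<^sup>2" .
  have "(\<integral>w. r w \<bullet> shifted_op (kern S) (1 / lam) r w \<partial>M) = (norm2 M r)\<^sup>2 + Q S r / lam"
    using integral_inner_shifted_op[OF kS r r, of "1 / lam"] by (simp add: norm2_sq power2_norm_eq_inner)
  moreover have "(\<integral>w. e w \<bullet> r w \<partial>M) = (\<integral>w. Y w \<bullet> r w \<partial>M) - (\<integral>w. r w \<bullet> shifted_op (kern S) (1 / lam) r w \<partial>M)"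
    using integrable_inner_sq_int[OF Y r] integrable_inner_sq_int[OF r A]
    by (simp add: e_def inner_diff_left inner_commute[of "shifted_op (kern S) (1 / lam) r _"])
  ultimately have 2: "(\<integral>w. e w \<bullet> r w \<partial>M) = (\<integral>w. Y w \<bullet> r w \<partial>M) - (norm2 M r)\<^sup>2 - Q S r / lam" by simp
  have "1/2 * (\<integral>w. (cmod (Y w - synthesis fh (U *v X w)))\<^sup>2 \<partial>M) + lam/2 * H_norm_sq k fh
      = dual_value S r + (norm2 M e)\<^sup>2 / 2"
    unfolding 1 2 norm dual_value_def using lam by (simp add: field_simps power2_eq_square)
  then show ?thesis unfolding e_def using that[OF H] by blast
qed

lemma J_End_bounds:
  assumes r: "sq_int M r"
  shows "dual_value S r \<le> J_End M X Y k lam U"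
    and "J_End M X Y k lam U \<le> dual_value S r + (norm2 M (\<lambda>w. Y w - shifted_op (kern S) (1 / lam) r w))\<^sup>2 / 2"
proof -
  obtain f f_hat where H: "in_H k f f_hat" and eq: "1/2 * (\<integral>w. (cmod (Y w - f (U *v X w)))\<^sup>2 \<partial>M) + lam/2 * H_norm_sq k f_hat
      = dual_value S r + (norm2 M (\<lambda>w. Y w - shifted_op (kern S) (1 / lam) r w))\<^sup>2 / 2"
    using strong_duality[OF r] by blast
  show "dual_value S r \<le> J_End M X Y k lam U"
    unfolding J_End_def by (rule cInf_greatest) (use H weak_duality[OF _ r] in auto)
  show "J_End M X Y k lam U \<le> dual_value S r + (norm2 M (\<lambda>w. Y w - shifted_op (kern S) (1 / lam) r w))\<^sup>2 / 2"
    unfolding J_End_def eq[symmetric]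
    by (rule cInf_lower) (use H weak_duality[OF _ r] in \<open>auto intro!: bdd_belowI[of _ "dual_value S r"]\<close>)
qed

end

lemma Q_nonneg: "S \<in> Sym_ge0 \<Longrightarrow> sq_int M r \<Longrightarrow> 0 \<le> kernel_form (kern S) r r" for r :: "'w \<Rightarrow> complex"
  using Q_nonneg_aux factor_exists by blast

text \<open>The interface for the rest of the argument: neither bound mentions \<open>U\<close> or
  the function space.\<close>

lemma J_Sym_bounds:
  assumes S: "S \<in> Sym_ge0" and r: "sq_int M r"
  shows "dual_value S r \<le> J_Sym M X Y k lam S"
    and "J_Sym M X Y k lam S \<le> dual_value S r + (norm2 M (\<lambda>w. Y w - shifted_op (kern S) (1 / lam) r w))\<^sup>2 / 2"
  using J_End_bounds[OF S _ r] someI_ex[OF factor_exists[OF S]] unfolding J_Sym_def by blast+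

end

section \<open>The derivative of the objective\<close>

lemma has_derivative_quadratic_remainder:
  fixes f :: "'a::real_normed_vector \<Rightarrow> real"
  assumes "bounded_linear f'"
    and le: "\<And>y. y \<in> S \<Longrightarrow> \<bar>f y - f x - f' (y - x)\<bar> \<le> C * (norm (y - x))\<^sup>2"
  shows "(f has_derivative f') (at x within S)"
  unfolding has_derivative_within
proof (intro conjI assms(1))
  have "((\<lambda>y. C * norm (y - x)) \<longlongrightarrow> C * norm (x - x)) (at x within S)"
    by (intro tendsto_intros)
  then have lim: "((\<lambda>y. C * norm (y - x)) \<longlongrightarrow> 0) (at x within S)" by simp
  have "norm ((1 / norm (y - x)) *\<^sub>R (f y - (f x + f' (y - x)))) \<le> C * norm (y - x)" if "y \<in> S" "y \<noteq> x" for y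
    using le[OF that(1)] that(2) by (simp add: abs_mult divide_simps power2_eq_square mult_ac algebra_simps)
  then show "((\<lambda>y. (1 / norm (y - x)) *\<^sub>R (f y - (f x + f' (y - x)))) \<longlongrightarrow> 0) (at x within S)"
    by (intro Lim_null_comparison[OF _ lim]) (auto simp: eventually_at_filter)
qed

text \<open>Mean value inequality for \<open>f t - f' a * t\<close>. It loses a harmless factor 2
  against the integral remainder.\<close>

lemma first_order_Taylor_bound:
  fixes f f' :: "real \<Rightarrow> real"
  assumes d: "\<And>t. 0 \<le> t \<Longrightarrow> (f has_real_derivative f' t) (at t within {0..})"
    and lip: "\<And>s t. 0 \<le> s \<Longrightarrow> 0 \<le> t \<Longrightarrow> \<bar>f' s - f' t\<bar> \<le> B * \<bar>s - t\<bar>"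
    and B: "0 \<le> B" and ab: "0 \<le> a" "0 \<le> b"
  shows "\<bar>f b - f a - f' a * (b - a)\<bar> \<le> B * (b - a)\<^sup>2"
proof -
  let ?S = "closed_segment a b"
  have S0: "?S \<subseteq> {0..}" using ab by (auto simp: closed_segment_eq_real_ivl)
  have "norm ((f b - f' a * b) - (f a - f' a * a)) \<le> (B * \<bar>b - a\<bar>) * norm (b - a)"
  proof (rule field_differentiable_bound[of ?S "\<lambda>t. f t - f' a * t" "\<lambda>t. f' t - f' a"])
    fix t assume t: "t \<in> ?S"
    have "(f has_real_derivative f' t) (at t within ?S)"
      using d[of t] t S0 by (auto intro: DERIV_subset)
    then show "((\<lambda>t. f t - f' a * t) has_field_derivative f' t - f' a) (at t within ?S)"
      by (auto intro!: derivative_eq_intros)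
    have "\<bar>t - a\<bar> \<le> \<bar>b - a\<bar>" using t by (auto simp: closed_segment_eq_real_ivl split: if_splits)
    then have "B * \<bar>t - a\<bar> \<le> B * \<bar>b - a\<bar>" using B by (rule mult_left_mono)
    moreover have "0 \<le> t" using t S0 by auto
    ultimately show "norm (f' t - f' a) \<le> B * \<bar>b - a\<bar>"
      using lip[of t a] ab by simp
  qed auto
  then show ?thesis by (simp add: algebra_simps power2_eq_square)
qed

lemma bounded_image_Ici:
  assumes "bounded (f ` {0::real..})"
  shows "\<exists>B\<ge>0. \<forall>t\<ge>0. \<bar>f t :: real\<bar> \<le> B"
proof -
  obtain B where B: "\<forall>x\<in>f ` {0..}. norm x \<le> B" using assms by (auto simp: bounded_iff)
  then have "0 \<le> B" using order_trans[OF abs_ge_zero, of "f 0" B] by auto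
  then show ?thesis using B by (intro exI[of _ B]) auto
qed

lemma Sym_ge0_form_nonneg: "S \<in> Sym_ge0 \<Longrightarrow> 0 \<le> z \<bullet> (S *v z)"
  by (simp add: Sym_ge0_eq pos_semidef_def)

lemma quadratic_form_diff_le:
  fixes S T :: "real ^ 'n ^ 'n"
  shows "\<bar>z \<bullet> (S *v z) - z \<bullet> (T *v z)\<bar> \<le> norm (S - T) * (norm z)\<^sup>2"
proof -
  have "z \<bullet> (S *v z) - z \<bullet> (T *v z) = (S - T) \<bullet> outer z"
    by (simp add: inner_outer inner_diff_left inner_diff_right matrix_vector_mult_diff_rdistrib)
  then show ?thesis using Cauchy_Schwarz_ineq2[of "S - T" "outer z"] by (simp add: norm_outer)
qed

text \<open>A Hilbert-Schmidt bound: pair the difference \<open>u\<close> with itself and cancel one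
  factor \<open>norm2 M u\<close>.\<close>

lemma (in prob_space) kernel_op_diff_le:
  fixes r :: "'a \<Rightarrow> 'b::euclidean_space"
  assumes \<kappa>: "\<kappa> \<in> borel_measurable (M \<Otimes>\<^sub>M M)" "\<And>p. \<bar>\<kappa> p\<bar> \<le> 1"
    and \<kappa>': "\<kappa>' \<in> borel_measurable (M \<Otimes>\<^sub>M M)" "\<And>p. \<bar>\<kappa>' p\<bar> \<le> 1" and r: "sq_int M r"
  shows "norm2 M (\<lambda>w. kernel_op \<kappa> r w - kernel_op \<kappa>' r w) \<le> norm2 (M \<Otimes>\<^sub>M M) (\<lambda>p. \<kappa> p - \<kappa>' p) * norm2 M r"
proof -
  define u where "u w = kernel_op \<kappa> r w - kernel_op \<kappa>' r w" for w
  note T = kernel_op_sq_int(1)[OF \<kappa> r] kernel_op_sq_int(1)[OF \<kappa>' r]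
  have u: "sq_int M u" unfolding u_def by (intro sq_int_diff T)
  note sq = sq_int_bounded_kernel[OF \<kappa>] sq_int_bounded_kernel[OF \<kappa>']
  have "(norm2 M u)\<^sup>2 = (\<integral>w. u w \<bullet> kernel_op \<kappa> r w - u w \<bullet> kernel_op \<kappa>' r w \<partial>M)"
    unfolding norm2_sq power2_norm_eq_inner by (simp add: u_def inner_diff_right)
  also have "\<dots> = kernel_form \<kappa> u r - kernel_form \<kappa>' u r"
    using integrable_inner_sq_int[OF u T(1)] integrable_inner_sq_int[OF u T(2)]
    by (simp add: integral_inner_kernel_op[OF \<kappa> r u] integral_inner_kernel_op[OF \<kappa>' r u])
  also have "\<dots> \<le> norm2 (M \<Otimes>\<^sub>M M) (\<lambda>p. \<kappa> p - \<kappa>' p) * (norm2 M u * norm2 M r)"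
    using norm_kernel_form_le[OF sq_int_diff[OF sq] u r]
    by (simp add: kernel_form_diff_kernel[OF sq u r])
  finally have "norm2 M u * norm2 M u \<le> norm2 M u * (norm2 (M \<Otimes>\<^sub>M M) (\<lambda>p. \<kappa> p - \<kappa>' p) * norm2 M r)"
    by (simp add: power2_eq_square mult_ac)
  then have "norm2 M u \<le> norm2 (M \<Otimes>\<^sub>M M) (\<lambda>p. \<kappa> p - \<kappa>' p) * norm2 M r"
    by (cases "norm2 M u = 0") (auto simp: less_le)
  then show ?thesis by (simp add: u_def[abs_def])
qed

section \<open>Moment bounds for the kernel and its derivative in the form\<close>

context ridge_regression
begin

interpretation MM: pair_prob_space M M ..

definition K'_bound :: real where "K'_bound = (SOME B. 0 \<le> B \<and> (\<forall>t\<ge>0. \<bar>\<K>' t\<bar> \<le> B))"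
definition K''_bound :: real where "K''_bound = (SOME B. 0 \<le> B \<and> (\<forall>t\<ge>0. \<bar>\<K>'' t\<bar> \<le> B))"

lemma K'_bound: "0 \<le> K'_bound" "0 \<le> t \<Longrightarrow> \<bar>\<K>' t\<bar> \<le> K'_bound"
  using someI_ex[OF bounded_image_Ici[OF K'_bd]] unfolding K'_bound_def by auto

lemma K''_bound: "0 \<le> K''_bound" "0 \<le> t \<Longrightarrow> \<bar>\<K>'' t\<bar> \<le> K''_bound"
  using someI_ex[OF bounded_image_Ici[OF K''_bd]] unfolding K''_bound_def by auto

lemma \<K>_lip: "0 \<le> s \<Longrightarrow> 0 \<le> t \<Longrightarrow> \<bar>\<K> s - \<K> t\<bar> \<le> K'_bound * \<bar>s - t\<bar>"
  using field_differentiable_bound[of "{0..}" \<K> \<K>' K'_bound s t] dK K'_bound(2) by auto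

lemma \<K>'_lip: "0 \<le> s \<Longrightarrow> 0 \<le> t \<Longrightarrow> \<bar>\<K>' s - \<K>' t\<bar> \<le> K''_bound * \<bar>s - t\<bar>"
  using field_differentiable_bound[of "{0..}" \<K>' \<K>'' K''_bound s t] dK' K''_bound(2) by auto

abbreviation MM :: "('w \<times> 'w) measure" where "MM \<equiv> M \<Otimes>\<^sub>M M"

text \<open>A single weight dominates every power of the gap up to the fourth, hence the kernel
  differences, the derivative and the Taylor remainder alike.\<close>

definition weight :: "'w \<times> 'w \<Rightarrow> real" where "weight p = 1 + norm (gap p) ^ 4"

lemma sq_int_weight: "sq_int MM weight"
proof -
  \<comment> \<open>The factor \<open>512\<close> is \<open>2 * 2^8\<close>: the first 2 from
    squaring a sum, the power from bounding the gap by twice the larger norm.\<close>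
  have le: "(weight p)\<^sup>2 \<le> 2 + 512 * (norm (X (fst p)) ^ 8 + norm (X (snd p)) ^ 8)" for p
  proof -
    define a b where "a = norm (X (fst p))" and "b = norm (X (snd p))"
    have ab: "0 \<le> a" "0 \<le> b" by (auto simp: a_def b_def)
    have "norm (gap p) \<le> 2 * max a b"
      using norm_triangle_ineq4[of "X (fst p)" "X (snd p)"] by (auto simp: gap_def a_def b_def)
    then have "norm (gap p) ^ 8 \<le> (2 * max a b) ^ 8" by (intro power_mono) auto
    also have "\<dots> \<le> 256 * (a ^ 8 + b ^ 8)" using ab by (auto simp: power_mult_distrib max_def)
    finally have g: "norm (gap p) ^ 8 \<le> 256 * (a ^ 8 + b ^ 8)" .
    have "(weight p)\<^sup>2 \<le> 2 + 2 * norm (gap p) ^ 8"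
      using sum_squares_bound[of 1 "norm (gap p) ^ 4"]
      by (simp add: weight_def power2_sum power_mult[symmetric])
    also have "\<dots> \<le> 2 + 512 * (a ^ 8 + b ^ 8)" using g by simp
    finally show ?thesis by (simp add: a_def b_def)
  qed
  have X8': "integrable MM (\<lambda>p. 2 + 512 * (norm (X (fst p)) ^ 8 + norm (X (snd p)) ^ 8))"
    using MM.integrable_tensor(1)[of "\<lambda>w. norm (X w) ^ 8" "\<lambda>_. 1"]
      MM.integrable_tensor(1)[of "\<lambda>_. 1" "\<lambda>w. norm (X w) ^ 8"] X8
    by (intro Bochner_Integration.integrable_add integrable_mult_right) auto
  have [measurable]: "weight \<in> borel_measurable MM" unfolding weight_def by measurable
  have "integrable MM (\<lambda>p. (norm (weight p))\<^sup>2)"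
    by (rule Bochner_Integration.integrable_bound[OF X8'])
      (auto intro!: AE_I2 order_trans[OF le] simp del: distrib_left_numeral)
  then show ?thesis by (simp add: sq_int_def)
qed

definition weight_norm :: real where "weight_norm = norm2 MM weight"

lemma weight_norm_nonneg: "0 \<le> weight_norm" by (simp add: weight_norm_def)

lemma weight_bound:
  fixes f :: "'w \<times> 'w \<Rightarrow> 'c::euclidean_space"
  assumes "f \<in> borel_measurable MM" "\<And>p. norm (f p) \<le> c * norm (gap p) ^ j" "j \<le> 4" "0 \<le> c"
  shows "sq_int MM f" "norm2 MM f \<le> c * weight_norm"
proof -
  have "norm (f p) \<le> norm (c *\<^sub>R weight p)" for p
  proof -
    have "norm (f p) \<le> c * norm (gap p) ^ j" by (rule assms)
    also have "\<dots> \<le> c * weight p"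
      unfolding weight_def using assms by (intro mult_left_mono power_le_one_add_power) auto
    finally show ?thesis using assms(4) by (auto simp: abs_mult intro: order_trans[OF _ mult_left_mono])
  qed
  then have "sq_int MM f \<and> norm2 MM f \<le> norm2 MM (\<lambda>p. c *\<^sub>R weight p)"
    using norm2_mono[OF sq_int_scaleR[OF sq_int_weight, of c] assms(1)] by blast
  then show "sq_int MM f" "norm2 MM f \<le> c * weight_norm"
    unfolding norm2_scaleR weight_norm_def[symmetric] using assms(4) by auto
qed

definition dkern :: "real ^ 'n ^ 'n \<Rightarrow> 'w \<times> 'w \<Rightarrow> real ^ 'n ^ 'n" where
  "dkern S p = \<K>' (gap p \<bullet> (S *v gap p)) *\<^sub>R outer (gap p)"

lemma outer_gap_meas[measurable]: "(\<lambda>p. outer (gap p)) \<in> borel_measurable MM"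
proof -
  have "continuous_on UNIV (outer :: real ^ 'n \<Rightarrow> _)"
    unfolding outer_def by (intro continuous_intros)
  then have [measurable]: "(outer :: real ^ 'n \<Rightarrow> _) \<in> borel_measurable borel"
    by (rule borel_measurable_continuous_onI)
  show ?thesis by measurable
qed

lemma dkern_meas: "S \<in> Sym_ge0 \<Longrightarrow> dkern S \<in> borel_measurable MM"
proof -
  assume S: "S \<in> Sym_ge0"
  have [measurable]: "(\<lambda>p. \<K>' (gap p \<bullet> (S *v gap p))) \<in> borel_measurable MM"
    using dK' S by (intro measurable_quadratic_form DERIV_continuous_on[of _ _ \<K>'']) auto
  show ?thesis unfolding dkern_def by measurable
qed

lemma dkern_bound:
  assumes S: "S \<in> Sym_ge0"
  shows "sq_int MM (dkern S)" "norm2 MM (dkern S) \<le> K'_bound * weight_norm"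
proof -
  have "norm (dkern S p) \<le> K'_bound * norm (gap p) ^ 2" for p
    using K'_bound(2)[OF Sym_ge0_form_nonneg[OF S]] by (simp add: dkern_def norm_outer mult_right_mono)
  from weight_bound[OF dkern_meas[OF S] this] K'_bound(1)
  show "sq_int MM (dkern S)" "norm2 MM (dkern S) \<le> K'_bound * weight_norm" by auto
qed

lemma kern_diff_bound:
  assumes S: "S \<in> Sym_ge0" and T: "T \<in> Sym_ge0"
  shows "norm2 MM (\<lambda>p. kern S p - kern T p) \<le> K'_bound * norm (S - T) * weight_norm"
proof (rule weight_bound(2)[where j = 2])
  show "norm (kern S p - kern T p) \<le> K'_bound * norm (S - T) * norm (gap p) ^ 2" for p
  proof -
    have "\<bar>kern S p - kern T p\<bar> \<le> K'_bound * \<bar>gap p \<bullet> (S *v gap p) - gap p \<bullet> (T *v gap p)\<bar>"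
      unfolding kern_def by (intro \<K>_lip Sym_ge0_form_nonneg S T)
    also have "\<dots> \<le> K'_bound * (norm (S - T) * (norm (gap p))\<^sup>2)"
      by (intro mult_left_mono quadratic_form_diff_le K'_bound)
    finally show ?thesis by (simp add: mult.assoc)
  qed
qed (use kern_meas[OF S] kern_meas[OF T] K'_bound(1) in \<open>auto intro: borel_measurable_diff\<close>)

text \<open>The fourth power arises here: two factors of the gap come from the change of the
  quadratic form and two from \<open>outer\<close>.\<close>

lemma dkern_diff_bound:
  assumes S: "S \<in> Sym_ge0" and T: "T \<in> Sym_ge0"
  shows "norm2 MM (\<lambda>p. dkern S p - dkern T p) \<le> K''_bound * norm (S - T) * weight_norm"
proof (rule weight_bound(2)[where j = 4])
  show "norm (dkern S p - dkern T p) \<le> K''_bound * norm (S - T) * norm (gap p) ^ 4" for p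
  proof -
    have "norm (dkern S p - dkern T p)
        = \<bar>\<K>' (gap p \<bullet> (S *v gap p)) - \<K>' (gap p \<bullet> (T *v gap p))\<bar> * (norm (gap p))\<^sup>2"
      by (simp add: dkern_def scaleR_left_diff_distrib[symmetric] norm_outer)
    also have "\<dots> \<le> (K''_bound * \<bar>gap p \<bullet> (S *v gap p) - gap p \<bullet> (T *v gap p)\<bar>) * (norm (gap p))\<^sup>2"
      by (intro mult_right_mono \<K>'_lip Sym_ge0_form_nonneg S T) auto
    also have "\<dots> \<le> (K''_bound * (norm (S - T) * (norm (gap p))\<^sup>2)) * (norm (gap p))\<^sup>2"
      by (intro mult_right_mono mult_left_mono quadratic_form_diff_le K''_bound) auto
    also have "\<dots> = K''_bound * norm (S - T) * norm (gap p) ^ 4" by (simp add: power_numeral_reduce)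
    finally show ?thesis .
  qed
qed (use dkern_meas[OF S] dkern_meas[OF T] K''_bound(1) in \<open>auto intro: borel_measurable_diff\<close>)

text \<open>The derivative of \<open>dual_value\<close> in the form with \<open>r\<close> held
  fixed. Along the envelope the dependence of the optimal \<open>r\<close> on the form contributes
  nothing at first order.\<close>

definition grad :: "real ^ 'n ^ 'n \<Rightarrow> ('w \<Rightarrow> complex) \<Rightarrow> real ^ 'n ^ 'n" where
  "grad S r = - ((1 / (2 * lam)) *\<^sub>R kernel_form (dkern S) r r)"

text \<open>For fixed \<open>r\<close> only the kernel depends on the form, so the pointwise
  expansion of \<open>kern\<close> is integrated against \<open>r\<close>.\<close>

lemma dual_value_Taylor:
  assumes S: "S \<in> Sym_ge0" and T: "T \<in> Sym_ge0" and r: "sq_int M r"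
  shows "dual_value S r + grad S r \<bullet> (T - S) - K''_bound * weight_norm / (2 * lam) * (norm2 M r)\<^sup>2 * (norm (T - S))\<^sup>2 \<le> dual_value T r"
proof -
  define H where "H = T - S"
  define R where "R p = kern T p - kern S p - dkern S p \<bullet> H" for p
  note [measurable] = kern_meas[OF S] kern_meas[OF T] dkern_meas[OF S]
  have sqS: "sq_int MM (kern S)" and sqT: "sq_int MM (kern T)"
    by (intro sq_int_bounded_kernel kern_meas kern_le S T)+
  have sqD: "sq_int MM (\<lambda>p. dkern S p \<bullet> H)"
  proof (rule norm2_mono(1)[OF sq_int_scaleR[OF dkern_bound(1)[OF S], of "norm H"]])
    show "norm (dkern S p \<bullet> H) \<le> norm (norm H *\<^sub>R dkern S p)" for p
      using Cauchy_Schwarz_ineq2[of "dkern S p" H] by (simp add: mult.commute)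
  qed measurable
  have R: "norm2 MM R \<le> K''_bound * (norm H)\<^sup>2 * weight_norm" "sq_int MM R"
  proof -
    have le: "norm (R p) \<le> K''_bound * (norm H)\<^sup>2 * norm (gap p) ^ 4" for p
    proof -
      let ?a = "gap p \<bullet> (S *v gap p)" and ?b = "gap p \<bullet> (T *v gap p)"
      \<comment> \<open>The argument of \<open>\<K>\<close> is linear in the form, so the chain rule
        has no further terms.\<close>
      have "dkern S p \<bullet> H = \<K>' ?a * (?b - ?a)"
        by (simp add: dkern_def H_def inner_commute[of "outer _"] inner_outer inner_diff_left
            matrix_vector_mult_diff_rdistrib inner_diff_right right_diff_distrib)
      then have "norm (R p) \<le> K''_bound * (?b - ?a)\<^sup>2"
        using first_order_Taylor_bound[of \<K> \<K>' K''_bound ?a ?b, OF dK \<K>'_lip K''_bound(1) Sym_ge0_form_nonneg[OF S] Sym_ge0_form_nonneg[OF T]]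
        by (simp add: R_def kern_def)
      also have "(?b - ?a)\<^sup>2 \<le> (norm H * (norm (gap p))\<^sup>2)\<^sup>2"
        using power_mono[OF quadratic_form_diff_le[of "gap p" T S] abs_ge_zero, of 2]
        by (simp add: H_def)
      finally show ?thesis using K''_bound(1)
        by (auto simp: power_mult_distrib power_mult[symmetric] mult_left_mono mult.assoc)
    qed
    show "norm2 MM R \<le> K''_bound * (norm H)\<^sup>2 * weight_norm" "sq_int MM R"
      by (rule weight_bound[OF _ le]; use K''_bound(1) in \<open>simp add: R_def[abs_def]\<close>)+
  qed
  have "kernel_form R r r = Q T r - Q S r - kernel_form (\<lambda>p. dkern S p \<bullet> H) r r"
    unfolding R_def
    by (simp add: kernel_form_diff_kernel[OF sq_int_diff[OF sqT sqS] sqD r r] kernel_form_diff_kernel[OF sqT sqS r r])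
  also have "kernel_form (\<lambda>p. dkern S p \<bullet> H) r r = kernel_form (dkern S) r r \<bullet> H"
    using integral_inner_left[of H MM "\<lambda>p. (r (fst p) \<bullet> r (snd p)) *\<^sub>R dkern S p"]
      kernel_form_integrable[OF dkern_bound(1)[OF S] r r] by (simp add: kernel_form_def)
  finally have "Q T r = Q S r + kernel_form (dkern S) r r \<bullet> H + kernel_form R r r" by simp
  also have "kernel_form R r r \<le> norm2 MM R * (norm2 M r * norm2 M r)"
    using norm_kernel_form_le[OF R(2) r r] by simp
  also have "\<dots> \<le> (K''_bound * (norm H)\<^sup>2 * weight_norm) * (norm2 M r)\<^sup>2"
    using R(1) by (simp add: power2_eq_square mult_right_mono)
  finally have "Q T r / (2 * lam) \<le> (Q S r + kernel_form (dkern S) r r \<bullet> H + (K''_bound * (norm H)\<^sup>2 * weight_norm) * (norm2 M r)\<^sup>2) / (2 * lam)"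
    using lam by (simp add: divide_right_mono)
  then show ?thesis
    unfolding dual_value_def grad_def H_def[symmetric] by (simp add: add_divide_distrib mult_ac)
qed

text \<open>An approximate residual: its defect in the Euler equation is at most
  \<open>\<epsilon>\<close>. By \<open>J_Sym_bounds\<close> its dual value is within
  \<open>\<epsilon>^2 / 2\<close> of the objective.\<close>

definition approx_min :: "real ^ 'n ^ 'n \<Rightarrow> real \<Rightarrow> ('w \<Rightarrow> complex) \<Rightarrow> bool" where
  "approx_min S \<epsilon> r \<longleftrightarrow> sq_int M r \<and> norm2 M (\<lambda>w. Y w - shifted_op (kern S) (1 / lam) r w) \<le> \<epsilon>"

lemma approx_min_exists:
  assumes "S \<in> Sym_ge0" "0 < \<epsilon>"
  shows "\<exists>r. approx_min S \<epsilon> r"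
  using shifted_op_approximate_solution[OF kern_meas[OF assms(1)] kern_le[OF assms(1)] Q_nonneg[OF assms(1)] _ Y assms(2), of "1 / lam"]
    lam unfolding approx_min_def by (metis divide_nonneg_pos less_imp_le zero_le_one)

text \<open>Coercivity bounds \<open>r\<close> by its image, which differs from \<open>Y\<close> by
  at most \<open>\<epsilon>\<close>; the bound is uniform in the form.\<close>

lemma approx_min_norm:
  assumes S: "S \<in> Sym_ge0" and r: "approx_min S \<epsilon> r"
  shows "norm2 M r \<le> norm2 M Y + \<epsilon>"
proof -
  note kS = kern_meas[OF S] kern_le[OF S]
  have c: "0 \<le> 1 / lam" using lam by simp
  have rs: "sq_int M r" using r by (simp add: approx_min_def)
  have A: "sq_int M (shifted_op (kern S) (1 / lam) r)" by (rule shifted_op_sq_int(1)[OF kS rs c])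
  have "norm2 M r \<le> norm2 M (shifted_op (kern S) (1 / lam) r)"
    by (rule shifted_op_coercive(2)[OF kS Q_nonneg[OF S] c rs])
  also have "\<dots> = norm2 M (\<lambda>w. Y w - (Y w - shifted_op (kern S) (1 / lam) r w))" by simp
  also have "\<dots> \<le> norm2 M Y + norm2 M (\<lambda>w. Y w - shifted_op (kern S) (1 / lam) r w)"
    by (intro norm2_triangle_diff Y sq_int_diff A)
  finally show ?thesis using r by (simp add: approx_min_def)
qed

text \<open>A resolvent argument: the operator of \<open>S\<close> maps \<open>r - s\<close> to the
  difference of the defects minus \<open>1 / lam\<close> times the change of kernel operator applied
  to \<open>s\<close>. Coercivity then bounds \<open>r - s\<close>.\<close>

lemma approx_min_diff:
  assumes S: "S \<in> Sym_ge0" and r: "approx_min S \<epsilon> r"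
    and T: "T \<in> Sym_ge0" and s: "approx_min T \<delta> s"
  shows "norm2 M (\<lambda>w. r w - s w) \<le> \<epsilon> + \<delta> + K'_bound * norm (S - T) * weight_norm / lam * norm2 M s"
proof -
  note kS = kern_meas[OF S] kern_le[OF S] and kT = kern_meas[OF T] kern_le[OF T]
  have c: "0 \<le> 1 / lam" using lam by simp
  have rs: "sq_int M r" and ss: "sq_int M s" using r s by (auto simp: approx_min_def)
  define e where "e w = Y w - shifted_op (kern S) (1 / lam) r w" for w
  define f where "f w = Y w - shifted_op (kern T) (1 / lam) s w" for w
  define g where "g w = kernel_op (kern S) s w - kernel_op (kern T) s w" for w
  have e: "sq_int M e" "norm2 M e \<le> \<epsilon>" and f: "sq_int M f" "norm2 M f \<le> \<delta>"
    using r s by (auto simp: e_def[abs_def] f_def[abs_def] approx_min_def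
        intro!: sq_int_diff Y shifted_op_sq_int(1) kS kT c)
  have g: "sq_int M g" unfolding g_def by (intro sq_int_diff kernel_op_sq_int(1) kS kT ss)
  have "norm2 M (\<lambda>w. r w - s w) \<le> norm2 M (shifted_op (kern S) (1 / lam) (\<lambda>w. r w - s w))"
    by (rule shifted_op_coercive(2)[OF kS Q_nonneg[OF S] c sq_int_diff[OF rs ss]])
  also have "\<dots> = norm2 M (\<lambda>w. (f w - e w) - (1 / lam) *\<^sub>R g w)"
  proof (rule norm2_cong)
    fix w assume w: "w \<in> space M"
    show "shifted_op (kern S) (1 / lam) (\<lambda>w. r w - s w) w = (f w - e w) - (1 / lam) *\<^sub>R g w"
    proof -
      have "kernel_op (kern S) (\<lambda>w. r w - s w) w = kernel_op (kern S) r w - kernel_op (kern S) s w"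
        using kernel_op_add_scaleR[OF kS w rs ss, of "-1"] by simp
      then show ?thesis
        by (simp only: shifted_op_def e_def f_def g_def) (simp add: algebra_simps)
    qed
  qed
  also have "\<dots> \<le> (norm2 M f + norm2 M e) + \<bar>1 / lam\<bar> * norm2 M g"
    by (rule order_trans[OF norm2_triangle_diff[OF sq_int_diff[OF f(1) e(1)] sq_int_scaleR[OF g]]])
      (simp only: norm2_scaleR add_right_mono norm2_triangle_diff f e)
  also have "norm2 M g \<le> norm2 MM (\<lambda>p. kern S p - kern T p) * norm2 M s"
    unfolding g_def by (rule kernel_op_diff_le[OF kS kT ss])
  also have "\<dots> \<le> K'_bound * norm (S - T) * weight_norm * norm2 M s"
    by (intro mult_right_mono kern_diff_bound S T) simp
  finally show ?thesis using e f lam by (simp add: mult_left_mono divide_right_mono)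
qed

text \<open>The \<open>+ 1\<close> accommodates every defect up to 1.\<close>

definition residual_bound :: real where "residual_bound = norm2 M Y + 1"
text \<open>The first summand is due to the change of \<open>dkern\<close> at fixed residual, the
  second to the change of the residual at fixed \<open>dkern\<close>.\<close>

definition grad_lip :: real where "grad_lip = (K''_bound * weight_norm * residual_bound\<^sup>2 + K'_bound * weight_norm * (2 * residual_bound) * (K'_bound * weight_norm / lam * residual_bound)) / (2 * lam)"
definition grad_err :: real where "grad_err = K'_bound * weight_norm * (2 * residual_bound) / (2 * lam)"

lemma residual_bound_nonneg: "0 \<le> residual_bound" by (simp add: residual_bound_def add_nonneg_nonneg)

lemma grad_diff:
  assumes S: "S \<in> Sym_ge0" and r: "approx_min S \<epsilon> r" "\<epsilon> \<le> 1"
    and T: "T \<in> Sym_ge0" and s: "approx_min T \<delta> s" "\<delta> \<le> 1"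
  shows "norm (grad S r - grad T s) \<le> grad_lip * norm (S - T) + grad_err * (\<epsilon> + \<delta>)"
proof -
  have rs: "sq_int M r" and ss: "sq_int M s" using r s by (auto simp: approx_min_def)
  have rR: "norm2 M r \<le> residual_bound" "norm2 M s \<le> residual_bound"
    using approx_min_norm[OF S r(1)] approx_min_norm[OF T s(1)] r s by (auto simp: residual_bound_def)
  define d where "d = norm (S - T)"
  have d: "0 \<le> d" by (simp add: d_def)
  have diff: "norm2 M (\<lambda>w. r w - s w) \<le> \<epsilon> + \<delta> + K'_bound * d * weight_norm / lam * residual_bound"
  proof -
    have "K'_bound * d * weight_norm / lam * norm2 M s \<le> K'_bound * d * weight_norm / lam * residual_bound"
      using K'_bound(1) weight_norm_nonneg d lam rR by (intro mult_left_mono) auto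
    then show ?thesis using approx_min_diff[OF S r(1) T s(1)] by (simp add: d_def)
  qed
  have "norm (kernel_form (dkern S) r r - kernel_form (dkern T) s s)
    \<le> norm2 MM (\<lambda>p. dkern S p - dkern T p) * (norm2 M r)\<^sup>2
      + norm2 MM (dkern T) * ((norm2 M r + norm2 M s) * norm2 M (\<lambda>w. r w - s w))"
    by (rule kernel_form_quadratic_diff_le[OF dkern_bound(1)[OF S] dkern_bound(1)[OF T] rs ss])
  also have "\<dots> \<le> (K''_bound * d * weight_norm) * residual_bound\<^sup>2 + (K'_bound * weight_norm) * ((residual_bound + residual_bound) * (\<epsilon> + \<delta> + K'_bound * d * weight_norm / lam * residual_bound))"
    using dkern_diff_bound[OF S T] dkern_bound(2)[OF T] diff rR residual_bound_nonneg K'_bound(1) K''_bound(1) weight_norm_nonneg d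
    by (intro add_mono mult_mono power_mono) (auto simp: d_def)
  finally have "norm (kernel_form (dkern S) r r - kernel_form (dkern T) s s) / (2 * lam)
      \<le> ((K''_bound * d * weight_norm) * residual_bound\<^sup>2 + (K'_bound * weight_norm) * ((residual_bound + residual_bound) * (\<epsilon> + \<delta> + K'_bound * d * weight_norm / lam * residual_bound))) / (2 * lam)"
    using lam by (simp add: divide_right_mono)
  moreover have "grad S r - grad T s = - ((1 / (2 * lam)) *\<^sub>R (kernel_form (dkern S) r r - kernel_form (dkern T) s s))"
    by (simp add: grad_def scaleR_right_diff_distrib)
  then have "norm (grad S r - grad T s) = norm (kernel_form (dkern S) r r - kernel_form (dkern T) s s) / (2 * lam)"
    using lam by (simp only: norm_minus_cancel norm_scaleR) (simp add: abs_mult)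
  moreover have "((K''_bound * d * weight_norm) * residual_bound\<^sup>2 + (K'_bound * weight_norm) * ((residual_bound + residual_bound) * (\<epsilon> + \<delta> + K'_bound * d * weight_norm / lam * residual_bound))) / (2 * lam)
      = grad_lip * d + grad_err * (\<epsilon> + \<delta>)"
    by (simp add: grad_lip_def grad_err_def add_divide_distrib algebra_simps)
  ultimately show ?thesis by (simp add: d_def)
qed

lemma transpose_grad:
  assumes S: "S \<in> Sym_ge0" and r: "sq_int M r"
  shows "transpose (grad S r) = grad S r"
proof -
  have "transpose (kernel_form (dkern S) r r) = kernel_form (dkern S) r r"
    unfolding kernel_form_def
    by (subst integral_bounded_linear[OF bounded_linear_transpose kernel_form_integrable[OF dkern_bound(1)[OF S] r r], symmetric])
      (simp add: transpose_scalar dkern_def transpose_outer)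
  then show ?thesis by (simp add: grad_def linear_neg[OF bounded_linear.linear[OF bounded_linear_transpose]] transpose_scalar)
qed

lemma grad_bound:
  assumes S: "S \<in> Sym_ge0" and r: "approx_min S \<epsilon> r" "\<epsilon> \<le> 1"
  shows "norm (grad S r) \<le> K'_bound * weight_norm * residual_bound\<^sup>2 / (2 * lam)"
proof -
  have rs: "sq_int M r" using r by (auto simp: approx_min_def)
  have rR: "norm2 M r \<le> residual_bound" using approx_min_norm[OF S r(1)] r by (auto simp: residual_bound_def)
  have "norm (kernel_form (dkern S) r r) \<le> norm2 MM (dkern S) * (norm2 M r * norm2 M r)"
    by (rule norm_kernel_form_le[OF dkern_bound(1)[OF S] rs rs])
  also have "\<dots> \<le> (K'_bound * weight_norm) * (residual_bound * residual_bound)"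
    using dkern_bound(2)[OF S] rR residual_bound_nonneg K'_bound(1) weight_norm_nonneg by (intro mult_mono) auto
  finally show ?thesis using lam by (simp add: grad_def abs_mult power2_eq_square divide_right_mono)
qed

section \<open>The limiting gradient and differentiability of the objective\<close>

definition approx_seq :: "real ^ 'n ^ 'n \<Rightarrow> nat \<Rightarrow> 'w \<Rightarrow> complex" where
  "approx_seq S n = (SOME r. approx_min S (inverse (real (Suc n))) r)"

lemma approx_seq: "S \<in> Sym_ge0 \<Longrightarrow> approx_min S (inverse (real (Suc n))) (approx_seq S n)"
  unfolding approx_seq_def by (rule someI_ex[OF approx_min_exists]) auto

lemma inverse_Suc_le_one: "inverse (real (Suc n)) \<le> 1"
  by (simp add: field_simps)

definition grad_lim :: "real ^ 'n ^ 'n \<Rightarrow> real ^ 'n ^ 'n" where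
  "grad_lim S = lim (\<lambda>n. grad S (approx_seq S n))"

text \<open>For equal forms \<open>grad_diff\<close> leaves only the defects, so the gradients form
  a Cauchy sequence of matrices.\<close>

lemma grad_tendsto:
  assumes S: "S \<in> Sym_ge0"
  shows "(\<lambda>n. grad S (approx_seq S n)) \<longlonglongrightarrow> grad_lim S"
proof -
  have "Cauchy (\<lambda>n. grad S (approx_seq S n))"
  proof (rule metric_CauchyI)
    fix \<epsilon> :: real assume \<epsilon>: "0 < \<epsilon>"
    have "(\<lambda>n. grad_err * (inverse (real (Suc n)) + inverse (real (Suc n)))) \<longlonglongrightarrow> grad_err * (0 + 0)"
      by (intro tendsto_intros LIMSEQ_inverse_real_of_nat)
    then have "eventually (\<lambda>n. grad_err * (inverse (real (Suc n)) + inverse (real (Suc n))) < \<epsilon>) sequentially"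
      using \<epsilon> by (intro order_tendstoD(2)) auto
    then obtain N where N: "grad_err * (inverse (real (Suc N)) + inverse (real (Suc N))) < \<epsilon>"
      by (auto simp: eventually_sequentially)
    have grad_err: "0 \<le> grad_err" using K'_bound(1) weight_norm_nonneg residual_bound_nonneg lam by (simp add: grad_err_def)
    have "dist (grad S (approx_seq S i)) (grad S (approx_seq S j)) < \<epsilon>" if "N \<le> i" "N \<le> j" for i j
    proof -
      have "dist (grad S (approx_seq S i)) (grad S (approx_seq S j))
          \<le> grad_err * (inverse (real (Suc i)) + inverse (real (Suc j)))"
        using grad_diff[OF S approx_seq[OF S] inverse_Suc_le_one S approx_seq[OF S] inverse_Suc_le_one, of i j]
        by (simp add: dist_norm)
      also have "\<dots> \<le> grad_err * (inverse (real (Suc N)) + inverse (real (Suc N)))"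
        using that grad_err by (intro mult_left_mono add_mono le_imp_inverse_le) auto
      finally show ?thesis using N by simp
    qed
    then show "\<exists>N. \<forall>i\<ge>N. \<forall>j\<ge>N. dist (grad S (approx_seq S i)) (grad S (approx_seq S j)) < \<epsilon>" by blast
  qed
  then show ?thesis unfolding grad_lim_def by (simp add: Cauchy_convergent_iff convergent_LIMSEQ_iff)
qed

lemma grad_lim_lip:
  assumes S: "S \<in> Sym_ge0" and T: "T \<in> Sym_ge0"
  shows "norm (grad_lim S - grad_lim T) \<le> grad_lip * norm (S - T)"
proof (rule LIMSEQ_le)
  show "(\<lambda>n. norm (grad S (approx_seq S n) - grad T (approx_seq T n))) \<longlonglongrightarrow> norm (grad_lim S - grad_lim T)"
    by (intro tendsto_intros grad_tendsto S T)
  have "(\<lambda>n. grad_lip * norm (S - T) + grad_err * (inverse (real (Suc n)) + inverse (real (Suc n)))) \<longlonglongrightarrow> grad_lip * norm (S - T) + grad_err * (0 + 0)"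
    by (intro tendsto_intros LIMSEQ_inverse_real_of_nat)
  then show "(\<lambda>n. grad_lip * norm (S - T) + grad_err * (inverse (real (Suc n)) + inverse (real (Suc n)))) \<longlonglongrightarrow> grad_lip * norm (S - T)"
    by simp
  show "\<exists>N. \<forall>n\<ge>N. norm (grad S (approx_seq S n) - grad T (approx_seq T n))
      \<le> grad_lip * norm (S - T) + grad_err * (inverse (real (Suc n)) + inverse (real (Suc n)))"
    using grad_diff[OF S approx_seq[OF S] inverse_Suc_le_one T approx_seq[OF T] inverse_Suc_le_one] by blast
qed

lemma grad_lim_bound:
  assumes S: "S \<in> Sym_ge0"
  shows "norm (grad_lim S) \<le> K'_bound * weight_norm * residual_bound\<^sup>2 / (2 * lam)"
  by (rule LIMSEQ_le_const2[OF tendsto_norm[OF grad_tendsto[OF S]]])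
    (use grad_bound[OF S approx_seq[OF S] inverse_Suc_le_one] in blast)

lemma transpose_grad_lim:
  assumes S: "S \<in> Sym_ge0"
  shows "transpose (grad_lim S) = grad_lim S"
proof -
  have "(\<lambda>n. transpose (grad S (approx_seq S n))) \<longlonglongrightarrow> transpose (grad_lim S)"
    by (rule bounded_linear.tendsto[OF bounded_linear_transpose grad_tendsto[OF S]])
  moreover have "transpose (grad S (approx_seq S n)) = grad S (approx_seq S n)" for n
    using approx_seq[OF S, of n] by (intro transpose_grad S) (simp add: approx_min_def)
  ultimately show ?thesis using grad_tendsto[OF S] LIMSEQ_unique by (metis (no_types, lifting) ext)
qed

text \<open>A nearly optimal \<open>r\<close> for \<open>S\<close> is an admissible competitor for
  \<open>T\<close>. Expanding its dual value around \<open>S\<close> and letting the defect tend to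
  zero gives the bound; \<open>(inverse (real (Suc n)))^2 / 2\<close> pays for the duality
  gap.\<close>

lemma J_Sym_lower:
  assumes S: "S \<in> Sym_ge0" and T: "T \<in> Sym_ge0"
  shows "J_Sym M X Y k lam S + grad_lim S \<bullet> (T - S) - K''_bound * weight_norm / (2 * lam) * residual_bound\<^sup>2 * (norm (T - S))\<^sup>2
    \<le> J_Sym M X Y k lam T"
proof (rule LIMSEQ_le_const2)
  let ?J = "J_Sym M X Y k lam" and ?c = "K''_bound * weight_norm / (2 * lam) * residual_bound\<^sup>2 * (norm (T - S))\<^sup>2"
  have "(\<lambda>n. ?J S - (inverse (real (Suc n)))\<^sup>2 / 2 + grad S (approx_seq S n) \<bullet> (T - S) - ?c)
      \<longlonglongrightarrow> ?J S - 0\<^sup>2 / 2 + grad_lim S \<bullet> (T - S) - ?c"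
    by (intro tendsto_intros LIMSEQ_inverse_real_of_nat grad_tendsto S) auto
  then show "(\<lambda>n. ?J S - (inverse (real (Suc n)))\<^sup>2 / 2 + grad S (approx_seq S n) \<bullet> (T - S) - ?c)
      \<longlonglongrightarrow> ?J S + grad_lim S \<bullet> (T - S) - ?c" by simp
  have "?J S - (inverse (real (Suc n)))\<^sup>2 / 2 + grad S (approx_seq S n) \<bullet> (T - S) - ?c \<le> ?J T" for n
  proof -
    define r where "r = approx_seq S n"
    have r: "sq_int M r" and ap: "approx_min S (inverse (real (Suc n))) r"
      using approx_seq[OF S, of n] by (auto simp: r_def approx_min_def)
    have rR: "norm2 M r \<le> residual_bound"
      using approx_min_norm[OF S ap] inverse_Suc_le_one[of n] by (simp add: residual_bound_def)
    have "K''_bound * weight_norm / (2 * lam) * (norm2 M r)\<^sup>2 * (norm (T - S))\<^sup>2 \<le> ?c"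
      using rR K''_bound(1) weight_norm_nonneg lam by (intro mult_right_mono mult_left_mono power_mono) auto
    moreover have "(norm2 M (\<lambda>w. Y w - shifted_op (kern S) (1 / lam) r w))\<^sup>2 \<le> (inverse (real (Suc n)))\<^sup>2"
      using ap by (intro power_mono) (auto simp: approx_min_def)
    ultimately show ?thesis
      using J_Sym_bounds(1)[OF T r] J_Sym_bounds(2)[OF S r] dual_value_Taylor[OF S T r]
      unfolding r_def[symmetric] by linarith
  qed
  then show "\<exists>N. \<forall>n\<ge>N. ?J S - (inverse (real (Suc n)))\<^sup>2 / 2 + grad S (approx_seq S n) \<bullet> (T - S) - ?c \<le> ?J T"
    by blast
qed

text \<open>The missing upper half is \<open>J_Sym_lower\<close> with \<open>S\<close> and
  \<open>T\<close> exchanged. Replacing the gradient at \<open>T\<close> by that at \<open>S\<close>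
  costs \<open>grad_lip\<close> times the squared distance.\<close>

lemma J_Sym_has_derivative:
  assumes S: "S \<in> Sym_ge0"
  shows "(J_Sym M X Y k lam has_derivative (\<lambda>H. grad_lim S \<bullet> H)) (at S within Sym_ge0)"
proof (rule has_derivative_quadratic_remainder[where C = "K''_bound * weight_norm / (2 * lam) * residual_bound\<^sup>2 + grad_lip"])
  show "bounded_linear ((\<bullet>) (grad_lim S))" by (rule bounded_linear_inner_right)
  fix T :: "real ^ 'n ^ 'n" assume T: "T \<in> Sym_ge0"
  let ?J = "J_Sym M X Y k lam" and ?c = "K''_bound * weight_norm / (2 * lam) * residual_bound\<^sup>2"
  define d where "d = norm (T - S)"
  have grad_lip: "0 \<le> grad_lip" using K'_bound(1) K''_bound(1) weight_norm_nonneg residual_bound_nonneg lam by (simp add: grad_lip_def)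
  have "(grad_lim T - grad_lim S) \<bullet> (T - S) \<le> norm (grad_lim T - grad_lim S) * d"
    unfolding d_def by (rule norm_cauchy_schwarz)
  also have "\<dots> \<le> (grad_lip * d) * d"
    using grad_lim_lip[OF T S] by (intro mult_right_mono) (auto simp: d_def)
  finally have "grad_lim T \<bullet> (T - S) - grad_lim S \<bullet> (T - S) \<le> grad_lip * d\<^sup>2"
    by (simp add: inner_diff_left power2_eq_square)
  moreover have "?J T + grad_lim T \<bullet> (S - T) - ?c * d\<^sup>2 \<le> ?J S"
    using J_Sym_lower[OF T S] by (simp add: d_def norm_minus_commute)
  moreover have "grad_lim T \<bullet> (S - T) = - (grad_lim T \<bullet> (T - S))" by (simp add: inner_diff_right)
  moreover have "?J S + grad_lim S \<bullet> (T - S) - ?c * d\<^sup>2 \<le> ?J T"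
    using J_Sym_lower[OF S T] by (simp add: d_def)
  moreover have "0 \<le> grad_lip * d\<^sup>2" using grad_lip by simp
  ultimately show "\<bar>?J T - ?J S - grad_lim S \<bullet> (T - S)\<bar> \<le> (?c + grad_lip) * (norm (T - S))\<^sup>2"
    unfolding d_def[symmetric] distrib_right by linarith
qed

lemma DJ_eq: "S \<in> Sym_ge0 \<Longrightarrow> DJ M X Y k lam S = grad_lim S"
  unfolding DJ_def
  by (rule the_equality)
    (use J_Sym_has_derivative transpose_grad_lim Sym_ge0_derivative_unique in blast)+

definition generator :: "real ^ 'n ^ 'n \<Rightarrow> real ^ 'n ^ 'n" where
  "generator S = - (1/2) *\<^sub>R (cov_lower M X ** grad_lim S)"

text \<open>Symmetry of \<open>grad_lim S\<close> makes the first double sum the matrix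
  \<open>S (C A)^T\<close>; symmetry of \<open>S\<close> makes the second one
  \<open>(C A) S\<close>.\<close>

lemma gradient_field_eq:
  assumes S: "S \<in> Sym_ge0"
  shows "gradient_field M X Y k lam S = generator S ** S + S ** transpose (generator S)"
proof -
  let ?C = "cov_lower M X" and ?A = "grad_lim S"
  have sym: "S $ i $ j = S $ j $ i" "?A $ i $ j = ?A $ j $ i" for i j
    using S transpose_grad_lim[OF S]
    by (auto simp: Sym_ge0_eq pos_semidef_def transpose_def vec_eq_iff)
  have 1: "(\<Sum>c\<in>UNIV. \<Sum>d\<in>UNIV. S $ a $ c * ?C $ b $ d * ?A $ c $ d) = (S ** transpose (?C ** ?A)) $ a $ b" for a b
    by (simp add: matrix_matrix_mult_def transpose_def sum_distrib_left sym(2)[of _ _] mult_ac)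
  have 2: "(\<Sum>c\<in>UNIV. \<Sum>d\<in>UNIV. S $ b $ d * ?C $ a $ c * ?A $ c $ d) = ((?C ** ?A) ** S) $ a $ b" for a b
  proof -
    have "((?C ** ?A) ** S) $ a $ b = (\<Sum>d\<in>UNIV. \<Sum>c\<in>UNIV. S $ b $ d * ?C $ a $ c * ?A $ c $ d)"
      by (simp add: matrix_matrix_mult_def sum_distrib_left sum_distrib_right sym(1)[of b] mult_ac)
    also have "\<dots> = (\<Sum>c\<in>UNIV. \<Sum>d\<in>UNIV. S $ b $ d * ?C $ a $ c * ?A $ c $ d)" by (rule sum.swap)
    finally show ?thesis by simp
  qed
  have "gradient_field M X Y k lam S = - (1/2) *\<^sub>R ((?C ** ?A) ** S + S ** transpose (?C ** ?A))"
    unfolding gradient_field_def DJ_eq[OF S] 1 2 by (simp add: vec_eq_iff)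
  also have "\<dots> = generator S ** S + S ** transpose (generator S)"
    unfolding generator_def transpose_scalar
    by (simp only: bounded_bilinear.scaleR_left[OF bounded_bilinear_matrix_mult]
        bounded_bilinear.scaleR_right[OF bounded_bilinear_matrix_mult] scaleR_right_distrib)
  finally show ?thesis .
qed

lemma congruence_flow_gradient_field:
  "congruence_flow generator (norm (cov_lower M X) * (K'_bound * weight_norm * residual_bound\<^sup>2 / (2 * lam))) (norm (cov_lower M X) * grad_lip)
     (gradient_field M X Y k lam)"
proof
  fix S T :: "real ^ 'n ^ 'n" assume S: "S \<in> Sym_ge0" and T: "T \<in> Sym_ge0"
  have "generator S - generator T = - (1/2) *\<^sub>R (cov_lower M X ** (grad_lim S - grad_lim T))"
    by (simp add: generator_def bounded_bilinear.diff_right[OF bounded_bilinear_matrix_mult] scaleR_right_diff_distrib)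
  then have "norm (generator S - generator T) \<le> norm (cov_lower M X ** (grad_lim S - grad_lim T))" by simp
  also have "\<dots> \<le> norm (cov_lower M X) * norm (grad_lim S - grad_lim T)" by (rule norm_matrix_mult_le)
  also have "\<dots> \<le> norm (cov_lower M X) * (grad_lip * norm (S - T))"
    by (intro mult_left_mono grad_lim_lip S T) simp
  finally show "norm (generator S - generator T) \<le> norm (cov_lower M X) * grad_lip * norm (S - T)" by (simp add: mult.assoc)
next
  fix S :: "real ^ 'n ^ 'n" assume S: "S \<in> Sym_ge0"
  have "norm (generator S) \<le> norm (cov_lower M X ** grad_lim S)" by (simp add: generator_def)
  also have "\<dots> \<le> norm (cov_lower M X) * norm (grad_lim S)" by (rule norm_matrix_mult_le)
  also have "\<dots> \<le> norm (cov_lower M X) * (K'_bound * weight_norm * residual_bound\<^sup>2 / (2 * lam))"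
    by (intro mult_left_mono grad_lim_bound S) simp
  finally show "norm (generator S) \<le> norm (cov_lower M X) * (K'_bound * weight_norm * residual_bound\<^sup>2 / (2 * lam))" .
  show "gradient_field M X Y k lam S = generator S ** S + S ** transpose (generator S)" by (rule gradient_field_eq[OF S])
qed (use K'_bound(1) K''_bound(1) weight_norm_nonneg residual_bound_nonneg lam in \<open>simp add: grad_lip_def\<close>)

end

section \<open>The Riemannian gradient flow\<close>

theorem theorem1p2:
  fixes M :: "'w measure"
    and X :: "'w \<Rightarrow> real ^ 'n"
    and Y :: "'w \<Rightarrow> complex"
    and k :: "real ^ 'n \<Rightarrow> real"
    and \<K> \<K>' \<K>'' :: "real \<Rightarrow> real"
    and lam :: real
  assumes "prob_space M"
    and "X \<in> borel_measurable M"
    and "Y \<in> borel_measurable M"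
    and "lam > 0"
    and "integrable M (\<lambda>w. (cmod (Y w))\<^sup>2)"
    and "integrable M (\<lambda>w. norm (X w) ^ 8)"
    and cov_pos: "\<And>\<omega>. \<omega> \<noteq> 0 \<Longrightarrow> cov_form M X \<omega> \<omega> > 0"
    and k_pos: "\<And>\<omega>. k \<omega> > 0"
    and k_rot: "\<exists>h. \<forall>\<omega>. k \<omega> = h (cov_form M X \<omega> \<omega>)"
    and k_int: "has_bochner_integral lborel k 1"
    and K_rot: "\<And>x. kernel_fun k x = complex_of_real (\<K> (V_norm_sq M X x))"
    and "\<And>r. r \<ge> 0 \<Longrightarrow> (\<K> has_real_derivative \<K>' r) (at r within {0..})"
    and "\<And>r. r \<ge> 0 \<Longrightarrow> (\<K>' has_real_derivative \<K>'' r) (at r within {0..})"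
    and "continuous_on {0..} \<K>'" and "bounded (\<K>' ` {0..})"
    and "continuous_on {0..} \<K>''" and "bounded (\<K>'' ` {0..})"
    and "\<exists>R. bounded ((\<lambda>r. r * \<K>' r) ` {R..})"
  shows "\<exists>\<phi>. global_flow (gradient_field M X Y k lam) Sym_ge0 \<phi> \<and>
             global_flow (gradient_field M X Y k lam) Sym_pos \<phi> \<and>
             continuous_on ({0..} \<times> Sym_ge0) (\<lambda>(t, S). \<phi> t S) \<and>
             (\<forall>l\<in>{0..CARD('n) - 1}. \<forall>S\<in>stratum l. \<forall>t\<ge>0. \<phi> t S \<in> stratum l)"
proof -
  have "ridge_regression M X Y k \<K> \<K>' \<K>'' lam"
  proof (intro ridge_regression.intro ridge_regression_axioms.intro)
    show "sq_int M Y" using assms(3,5) by (simp add: sq_int_def)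
  qed (fact assms)+
  then show ?thesis
    by (rule congruence_flow.flow_exists[OF ridge_regression.congruence_flow_gradient_field])
qed

end
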